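(* Consider the M/M/1 queue with control vacations described in the context, with baseline service rate $\mu=\mu_1>\lambda$, and assume that the critical gap is positive, $\Delta_c=c_r^\ast-c_r>0$. Let $\ell\in\mathbb{N}_0$ be such that $H_\infty^\ast(i,0)-H_\infty^\ast(i,1)\ge c_r^\ast$ for all $i\ge \ell$, let $k$ and $U_k$ be as in the context, and let $$T=\frac{\log\big(6U_k(1+\rho_\mu^{-\ell/2})/\Delta_c\big)}{(\sqrt{\mu}-\sqrt{\lambda})^2}.$$ Then the average expected cost of the policy $\phi_{T,0,\ell}$ satisfies $$g^{\phi_{T,0,\ell}}_{(0,1)}\le g_\mu-\frac{\Delta_c}{4(T+1/\beta)}.$$
   Context: **Model.** Customers arrive at a single-server queue according to a Poisson process of rate $\lambda>0$; service times are exponential. A sensor, when active, has an exponential lifetime of rate $\beta>0$. While the sensor is active, one of two service rates $0<\mu_1<\mu_2$ is used, chosen as a function of the number of customers; while it is broken, the baseline rate $\mu\in\{\mu_1,\mu_2\}$, $\mu>\lambda$, is used. Parameters are normalised so that $\lambda+\mu_1+\mu_2+\beta=1$. When the sensor breaks down with $i$ customers present, a repair is scheduled after a deterministic delay in $[0,\infty]$ depending only on $i$ ($0$: immediate repair; $\infty$: never). Each repair costs $c_r>0$, paid at the repair instant, and makes the sensor active with a fresh lifetime. Using service rate $\mu_j$ costs $c_{\mu_j}$ per unit time (also when the queue is empty), with $0=c_{\mu_1}<c_{\mu_2}$; holding costs are $h(i)$ per unit time when $i$ customers are present. The function $h:\mathbb{N}_0\to[0,\infty)$ satisfies $h(0)=0$,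 is non-decreasing, convex, non-constant, and $\sum_{i\ge 0}h(i)x^i<\infty$ for all $0<x<1$. All arrivals, services, and lifetimes are independent. States: $(i,1)$ ($i$ customers, sensor active); $(i,0)$ (sensor broken, never repaired again); $(i,0,t)$ (sensor broken, repair in $t$ time units); and initialisation states $i\in\mathbb{N}_0$ ($i$ customers, broken sensor, the repair delay is chosen instantaneously). A policy is a pair $\phi=(\phi_c,\phi_t)$, $\phi_c:\mathbb{N}_0\to\{\mu_1,\mu_2\}$ (service rate in $(i,1)$), $\phi_t:\mathbb{N}_0\to[0,\infty]$ (repair delay chosen upon breakdown with $i$ customers present, and also in initialisation state $i$). The cost rate is $c^\phi(i,1)=c_{\phi_c(i)}+h(i)$ and $c^\phi(i,0)=c^\phi(i,0,t)=c_\mu+h(i)$. With $X(t)$ the state and $N(t)$ the number of repairs up to time $t$, $$g_s^\phi=\limsup_{T'\to\infty}\frac1{T'}\Big(\mathbb{E}^\phi_s\Big[\int_0^{T'}c^\phi(X(t))\,dt\Big]+c_r\,\mathbb{E}^\phi_s[N(T')]\Big).$$ Put $\rho_\mu=\lambda/\mu$, $\pi_\mu(i)=(1-\rho_\mu)\rho_\mu^i$ and $g_\mu=c_\mu+\sum_{i\ge0}h(i)\pi_\mu(i)$ (average cost if the sensor is never repaired). **No-repair model.** This is the discrete-time Markov decision process on $\{(i,1),(i,0):i\in\mathbb{N}_0\}$ in which in $(i,1)$ a rate $a\in\{\mu_1,\mu_2\}$ is chosen, with one-step cost $c_a+h(i)$ and transition probabilities $\lambda$ to $(i+1,1)$, $\beta$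 to $(i,0)$, $a\mathbf{1}_{\{i>0\}}$ to $(i-1,1)$, remaining probability to stay; in $(i,0)$ the one-step cost is $c_\mu+h(i)$ and the transition probabilities are $\lambda$ to $(i+1,0)$, $\mu\mathbf{1}_{\{i>0\}}$ to $(i-1,0)$, remaining probability to stay. For $0<\alpha<1$ let $V_\alpha^\ast(s)$ be the minimal expected total discounted cost $\mathbb{E}_s\sum_{n\ge0}(1-\alpha)^nc(X_n)$. Define $H_\infty^\ast(s)=\lim_{\alpha\downarrow0}(V_\alpha^\ast(s)-V_\alpha^\ast(0,0))$; it is known that these limits exist, that $(g_\mu,H_\infty^\ast)$ solves the average cost optimality equation of this model, and that $H_\infty^\ast(s)=\lim_n(V_n(s)-V_n(0,0))$ for the value iteration vectors $V_n$ started from $V_0\equiv0$. Let $\tilde\phi_c$ be a strongly Blackwell optimal control policy (discount optimal for all sufficiently small $\alpha>0$); it is of threshold form: for some $i^\ast\in\mathbb{N}_0$, $\tilde\phi_c(i)=\mu_1$ for $i\le i^\ast$ and $\tilde\phi_c(i)=\mu_2$ for $i>i^\ast$. The critical cost is $c_r^\ast=\sum_{i\ge0}\pi_\mu(i)\big(H_\infty^\ast(i,0)-H_\infty^\ast(i,1)\big)$ (finite), and $\Delta_c=c_r^\ast-c_r$. **Policies.** $\phi_{A,B,\ell}$ is the policy with control part $\tilde\phi_c$ and repair delay $A$ if $i\le\ell$, $B$ if $i>\ell$. **Constants.** $k\in\mathbb{N}_0$ is an index with $\sum_{i=0}^k\pi_\mu(i)\big(H_\infty^\ast(i,0)-H_\infty^\ast(i,1)\big)\ge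 c_r^\ast-\Delta_c/3$, and $U_k=H_\infty^\ast(k,0)-\tilde H_1(k,1)+1$, where $\tilde H_1(k,1)$ is a number with $|\tilde H_1(k,1)-H_\infty^\ast(k,1)|\le1$ (so $U_k\ge H_\infty^\ast(k,0)-H_\infty^\ast(k,1)$). *)

theory Defs
  imports "HOL-Probability.Probability"
begin

section \<open>Parameters\<close>

datatype speed = Slow | Fast

text \<open>The baseline rate is recorded as a speed, so \<open>\<mu>\<close> is \<open>srv Q (base Q)\<close>
  and \<open>c\<^sub>\<mu>\<close> is \<open>srv_cost Q (base Q)\<close>.\<close>

record queue =
  arr :: real
  srv :: "speed \<Rightarrow> real"
  brk :: real
  base :: speed
  srv_cost :: "speed \<Rightarrow> real"
  rep_cost :: real
  hcost :: "nat \<Rightarrow> real"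

locale vacation_queue =
  fixes Q :: queue
  assumes arr_pos: "0 < arr Q"
    and brk_pos: "0 < brk Q"
    and slow_pos: "0 < srv Q Slow"
    and slow_less_fast: "srv Q Slow < srv Q Fast"
    and stable: "arr Q < srv Q (base Q)"
    and normalised: "arr Q + srv Q Slow + srv Q Fast + brk Q = 1"
    and rep_cost_pos: "0 < rep_cost Q"
    and slow_free: "srv_cost Q Slow = 0"
    and fast_cost_pos: "0 < srv_cost Q Fast"
    and hcost_nonneg: "\<And>i. 0 \<le> hcost Q i"
    and hcost_0: "hcost Q 0 = 0"
    and hcost_mono: "mono (hcost Q)"
    and hcost_convex: "\<And>i. hcost Q (Suc i) - hcost Q i \<le> hcost Q (Suc (Suc i)) - hcost Q (Suc i)"
    and hcost_nonconst: "\<exists>i j. hcost Q i \<noteq> hcost Q j"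
    and hcost_growth: "\<And>x. 0 < x \<Longrightarrow> x < 1 \<Longrightarrow> summable (\<lambda>i. hcost Q i * x ^ i)"

definition rho :: "queue \<Rightarrow> real"
  where "rho Q = arr Q / srv Q (base Q)"

definition stat_dist :: "queue \<Rightarrow> nat \<Rightarrow> real"
  where "stat_dist Q i = (1 - rho Q) * rho Q ^ i"

definition g_base :: "queue \<Rightarrow> real"
  where "g_base Q = srv_cost Q (base Q) + (\<Sum>i. hcost Q i * stat_dist Q i)"


section \<open>The queue with repairs, in continuous time\<close>

text \<open>\<open>Active i\<close>, \<open>Dead i\<close> and \<open>Waiting i t\<close> (for \<open>t \<ge> 0\<close>) are the states \<open>(i,1)\<close>,
  \<open>(i,0)\<close> and \<open>(i,0,t)\<close>; \<open>Init i\<close> is the initialisation state \<open>i\<close>.\<close>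

datatype state = is_Active: Active nat | Dead nat | is_Waiting: Waiting nat real | Init nat

text \<open>A policy consists of the control part and the repair delays in \<open>[0,\<infinity>]\<close>.\<close>

type_synonym policy = "(nat \<Rightarrow> speed) \<times> (nat \<Rightarrow> ennreal)"

definition schedule :: "policy \<Rightarrow> nat \<Rightarrow> state"
  where "schedule \<phi> i = (if snd \<phi> i = \<infinity> then Dead i else Waiting i (enn2real (snd \<phi> i)))"

text \<open>The process is built path by path from independent exponential clocks. At each
  transition a fresh triple \<open>(a, v, b)\<close> is used: the time \<open>a\<close> to the next arrival, the
  amount of work \<open>v\<close> (of rate 1) of the customer in service, which is done at the current
  service rate, and the sensor lifetime \<open>b\<close>. By lack of memory of the exponential
  distribution, replacing the residual clocks by fresh ones does not change the law.
  The residual repair delay is not redrawn; it is carried along in the state.\<close>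

type_synonym clocks = "real \<times> real \<times> real"

definition clock_law :: "queue \<Rightarrow> clocks measure"
  where "clock_law Q =
    density lborel (exponential_density (arr Q)) \<Otimes>\<^sub>M
    (density lborel (exponential_density 1) \<Otimes>\<^sub>M density lborel (exponential_density (brk Q)))"

definition clock_space :: "queue \<Rightarrow> clocks stream measure"
  where "clock_space Q = stream_space (clock_law Q)"

text \<open>Time to the next arrival or service completion, with \<open>i\<close> customers present and
  speed \<open>s\<close>.\<close>

definition queue_event :: "queue \<Rightarrow> speed \<Rightarrow> nat \<Rightarrow> real \<Rightarrow> real \<Rightarrow> real"
  where "queue_event Q s i a v = (if i = 0 then a else min a (v / srv Q s))"

fun sojourn :: "queue \<Rightarrow> policy \<Rightarrow> state \<Rightarrow> clocks \<Rightarrow> real" where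
  "sojourn Q \<phi> (Active i) (a, v, b) = min b (queue_event Q (fst \<phi> i) i a v)"
| "sojourn Q \<phi> (Dead i) (a, v, b) = queue_event Q (base Q) i a v"
| "sojourn Q \<phi> (Waiting i t) (a, v, b) = min t (queue_event Q (base Q) i a v)"
| "sojourn Q \<phi> (Init i) (a, v, b) = 0"

fun successor :: "queue \<Rightarrow> policy \<Rightarrow> state \<Rightarrow> clocks \<Rightarrow> state" where
  "successor Q \<phi> (Active i) (a, v, b) =
     (let d = queue_event Q (fst \<phi> i) i a v in
      if b \<le> d then schedule \<phi> i else if a \<le> d then Active (i + 1) else Active (i - 1))"
| "successor Q \<phi> (Dead i) (a, v, b) =
     (let d = queue_event Q (base Q) i a v in
      if a \<le> d then Dead (i + 1) else Dead (i - 1))"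
| "successor Q \<phi> (Waiting i t) (a, v, b) =
     (let d = queue_event Q (base Q) i a v in
      if t \<le> d then Active i else if a \<le> d then Waiting (i + 1) (t - d) else Waiting (i - 1) (t - d))"
| "successor Q \<phi> (Init i) (a, v, b) = schedule \<phi> i"

text \<open>Epoch of the \<open>n\<close>-th transition and the state entered there.\<close>

primrec jump :: "queue \<Rightarrow> policy \<Rightarrow> state \<Rightarrow> clocks stream \<Rightarrow> nat \<Rightarrow> real \<times> state" where
  "jump Q \<phi> s \<omega> 0 = (0, s)"
| "jump Q \<phi> s \<omega> (Suc n) =
     (let (t, x) = jump Q \<phi> s \<omega> n in (t + sojourn Q \<phi> x (\<omega> !! n), successor Q \<phi> x (\<omega> !! n)))"

fun flow :: "state \<Rightarrow> real \<Rightarrow> state" where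
  "flow (Waiting i t) u = Waiting i (t - u)"
| "flow x u = x"

definition state_at :: "queue \<Rightarrow> policy \<Rightarrow> state \<Rightarrow> real \<Rightarrow> clocks stream \<Rightarrow> state"
  where "state_at Q \<phi> s t \<omega> =
    (let n = (LEAST n. t < fst (jump Q \<phi> s \<omega> (Suc n)))
     in flow (snd (jump Q \<phi> s \<omega> n)) (t - fst (jump Q \<phi> s \<omega> n)))"

text \<open>Only a repair leads from a \<open>Waiting\<close> state to an \<open>Active\<close> one. An immediate repair
  passes through \<open>Waiting i 0\<close>, in which no time is spent, and is counted too.\<close>

definition num_repairs :: "queue \<Rightarrow> policy \<Rightarrow> state \<Rightarrow> real \<Rightarrow> clocks stream \<Rightarrow> ennreal"
  where "num_repairs Q \<phi> s t \<omega> =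
    (\<Sum>n. if is_Waiting (snd (jump Q \<phi> s \<omega> n)) \<and> is_Active (snd (jump Q \<phi> s \<omega> (Suc n)))
             \<and> fst (jump Q \<phi> s \<omega> (Suc n)) \<le> t
         then 1 else 0)"

fun cost_rate :: "queue \<Rightarrow> policy \<Rightarrow> state \<Rightarrow> real" where
  "cost_rate Q \<phi> (Active i) = srv_cost Q (fst \<phi> i) + hcost Q i"
| "cost_rate Q \<phi> (Dead i) = srv_cost Q (base Q) + hcost Q i"
| "cost_rate Q \<phi> (Waiting i t) = srv_cost Q (base Q) + hcost Q i"
| "cost_rate Q \<phi> (Init i) = srv_cost Q (base Q) + hcost Q i"

definition total_cost :: "queue \<Rightarrow> policy \<Rightarrow> state \<Rightarrow> real \<Rightarrow> ennreal"
  where "total_cost Q \<phi> s t =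
    (\<integral>\<^sup>+ \<omega>. (\<integral>\<^sup>+ u\<in>{0..t}. ennreal (cost_rate Q \<phi> (state_at Q \<phi> s u \<omega>)) \<partial>lborel) \<partial>clock_space Q)
    + ennreal (rep_cost Q) * (\<integral>\<^sup>+ \<omega>. num_repairs Q \<phi> s t \<omega> \<partial>clock_space Q)"

definition avg_cost :: "queue \<Rightarrow> policy \<Rightarrow> state \<Rightarrow> ereal"
  where "avg_cost Q \<phi> s = Limsup at_top (\<lambda>t::real. enn2ereal (total_cost Q \<phi> s t) / ereal t)"


section \<open>The no-repair model, a discrete-time Markov decision process\<close>

text \<open>\<open>On i\<close> and \<open>Off i\<close> are the states \<open>(i,1)\<close> and \<open>(i,0)\<close>. In \<open>Off i\<close> the action
  has no effect.\<close>

datatype nr_state = On nat | Off nat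

fun nr_kernel :: "queue \<Rightarrow> nr_state \<Rightarrow> speed \<Rightarrow> nr_state pmf" where
  "nr_kernel Q (On i) a =
     (let m = (if i > 0 then srv Q a else 0) in
      pmf_of_list [(On (i + 1), arr Q), (Off i, brk Q), (On (i - 1), m),
                   (On i, 1 - arr Q - brk Q - m)])"
| "nr_kernel Q (Off i) a =
     (let m = (if i > 0 then srv Q (base Q) else 0) in
      pmf_of_list [(Off (i + 1), arr Q), (Off (i - 1), m), (Off i, 1 - arr Q - m)])"

fun nr_cost :: "queue \<Rightarrow> nr_state \<Rightarrow> speed \<Rightarrow> real" where
  "nr_cost Q (On i) a = srv_cost Q a + hcost Q i"
| "nr_cost Q (Off i) a = srv_cost Q (base Q) + hcost Q i"

text \<open>Policies may be randomised and history dependent: they see the past state-action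
  pairs (latest first) and the current state.\<close>

type_synonym nr_policy = "(nr_state \<times> speed) list \<Rightarrow> nr_state \<Rightarrow> speed pmf"

primrec nr_history ::
  "queue \<Rightarrow> nr_policy \<Rightarrow> nr_state \<Rightarrow> nat \<Rightarrow> ((nr_state \<times> speed) list \<times> nr_state) pmf" where
  "nr_history Q \<sigma> s 0 = return_pmf ([], s)"
| "nr_history Q \<sigma> s (Suc n) =
     bind_pmf (nr_history Q \<sigma> s n) (\<lambda>(past, x).
       bind_pmf (\<sigma> past x) (\<lambda>a.
         map_pmf (\<lambda>y. ((x, a) # past, y)) (nr_kernel Q x a)))"

definition nr_disc_cost :: "queue \<Rightarrow> real \<Rightarrow> nr_policy \<Rightarrow> nr_state \<Rightarrow> ennreal"
  where "nr_disc_cost Q \<alpha> \<sigma> s =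
    (\<Sum>n. ennreal ((1 - \<alpha>) ^ n) *
       (\<integral>\<^sup>+ (past, x). (\<integral>\<^sup>+ a. ennreal (nr_cost Q x a) \<partial>measure_pmf (\<sigma> past x))
          \<partial>measure_pmf (nr_history Q \<sigma> s n)))"

definition nr_opt :: "queue \<Rightarrow> real \<Rightarrow> nr_state \<Rightarrow> ennreal"
  where "nr_opt Q \<alpha> s = (INF \<sigma>. nr_disc_cost Q \<alpha> \<sigma> s)"

definition H_inf :: "queue \<Rightarrow> nr_state \<Rightarrow> real"
  where "H_inf Q s = Lim (at_right 0) (\<lambda>\<alpha>. enn2real (nr_opt Q \<alpha> s) - enn2real (nr_opt Q \<alpha> (Off 0)))"

definition stationary :: "(nat \<Rightarrow> speed) \<Rightarrow> nr_policy"
  where "stationary f = (\<lambda>past x. case x of On i \<Rightarrow> return_pmf (f i) | Off i \<Rightarrow> return_pmf Slow)"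

definition strongly_blackwell_optimal :: "queue \<Rightarrow> (nat \<Rightarrow> speed) \<Rightarrow> bool"
  where "strongly_blackwell_optimal Q f \<longleftrightarrow>
    (\<exists>\<alpha>\<^sub>0>0. \<forall>\<alpha>. 0 < \<alpha> \<and> \<alpha> < \<alpha>\<^sub>0 \<and> \<alpha> < 1 \<longrightarrow>
       (\<forall>s. nr_disc_cost Q \<alpha> (stationary f) s = nr_opt Q \<alpha> s))"

definition crit_cost :: "queue \<Rightarrow> real"
  where "crit_cost Q = (\<Sum>i. stat_dist Q i * (H_inf Q (Off i) - H_inf Q (On i)))"

definition crit_gap :: "queue \<Rightarrow> real"
  where "crit_gap Q = crit_cost Q - rep_cost Q"

definition two_delay_policy :: "(nat \<Rightarrow> speed) \<Rightarrow> ennreal \<Rightarrow> ennreal \<Rightarrow> nat \<Rightarrow> policy"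
  where "two_delay_policy f A B l = (f, \<lambda>i. if i \<le> l then A else B)"

end

theory Submission
  imports Defs
begin

text \<open>Write \<open>H0 i\<close> and \<open>H1 i\<close> for the relative values of \<open>Off i\<close> and \<open>On i\<close>, \<open>D = H0 - H1\<close> for the
value of a working sensor, \<open>g\<close> for the cost of never repairing, \<open>c\<close> for the cost of a repair and
\<open>\<Delta>\<close> for the critical gap. The optimality equation of the no-repair model says that the
accumulated excess cost over \<open>g\<close> plus the current relative value is a martingale as long as no
repair happens. A repair with \<open>i\<close> customers present costs \<open>c\<close> and moves the relative value from
\<open>H0 i\<close> to \<open>H1 i\<close>, hence it earns \<open>D i - c\<close>. Under the policy considered, a repair made immediately
earns at least \<open>\<Delta>\<close>, because \<open>D\<close> is at least the critical cost beyond \<open>l\<close>. A repair made after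
the delay \<open>T\<close> earns the mean of \<open>D - c\<close> over an M/M/1 queue observed at time \<open>T\<close>; its stationary
mean is \<open>\<Delta>\<close>, and \<open>T\<close> is so large that the mean at time \<open>T\<close> still exceeds \<open>\<Delta> / 4\<close>. A cycle from
one repair to the next takes at most \<open>T + 1 / \<beta>\<close> on average, which gives the claimed improvement
per unit of time.

The martingale is replaced by an inequality for a potential: the relative value, corrected in the
waiting states by the elapsed part of the cycle and by the expected earning of the pending repair
(\<open>delay_supersolution\<close>). A potential that does not increase on average bounds the expected
cost up to the \<open>n\<close>-th transition, for every \<open>n\<close>, by induction on \<open>n\<close>: condition on the first
transition (\<open>expected_cost_le\<close>). The same bound, applied to the number of transitions, shows that
the process does not explode, so that one may let \<open>n\<close> tend to infinity
(\<open>avg_cost_supersolution\<close>).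

Convergence of the M/M/1 queue is needed from below only and for the nondecreasing function
\<open>min D U\<close>. It is therefore enough to compare with the queue started empty, whose deficit against
stationarity is controlled by the weight \<open>(\<mu>/\<lambda>)^(i/2)\<close>: away from \<open>0\<close> the generator of the queue
multiplies it by \<open>- (sqrt \<mu> - sqrt \<lambda>)^2\<close>, which is the rate in the definition of \<open>T\<close>
(\<open>unif_spread\<close>, \<open>mm1_lower\<close>).

What remains are the properties of the relative values. Value iteration for a fixed discount
factor shows that both value functions are convex, that \<open>D\<close> is nonnegative and nondecreasing, and
that the increments of the value in \<open>Off\<close> states are bounded uniformly in the discount factor
(\<open>shaped_iter\<close>). With these bounds, the values in \<open>Off\<close> states converge by the recursion that
they satisfy, and \<open>D\<close> is a geometrically dominated series to which dominated convergence applies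
(\<open>discounted_rate_tendsto\<close>, \<open>advantage_converges\<close>). Strong Blackwell optimality enters here: one
and the same control policy is optimal for all small discount rates, so it also attains the
limiting equation (\<open>optimality_equation_On\<close>).\<close>

section \<open>Competing exponential clocks\<close>

abbreviation expo :: "real \<Rightarrow> real measure"
  where "expo r \<equiv> density lborel (exponential_density r)"

lemma nn_integral_expo:
  assumes [measurable]: "f \<in> borel_measurable borel" and "0 < r"
  shows "(\<integral>\<^sup>+x. f x \<partial>expo r) = (\<integral>\<^sup>+x\<in>{0..}. ennreal (exp (- r * x)) * (ennreal r * f x) \<partial>lborel)"
proof -
  have "(\<integral>\<^sup>+x. f x \<partial>expo r) = (\<integral>\<^sup>+x. ennreal (exponential_density r x) * f x \<partial>lborel)"
    by (subst nn_integral_density) auto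
  also have "\<dots> = (\<integral>\<^sup>+x\<in>{0..}. ennreal (exp (- r * x)) * (ennreal r * f x) \<partial>lborel)"
    using \<open>0 < r\<close>
    by (intro nn_integral_cong)
       (auto simp: exponential_density_def ennreal_mult mult_ac split: split_indicator)
  finally show ?thesis .
qed

lemma expo_tail:
  assumes "0 < r" "0 \<le> x"
  shows "emeasure (expo r) {x..} = ennreal (exp (- r * x))"
    and "emeasure (expo r) {x<..} = ennreal (exp (- r * x))"
proof -
  have "(\<integral>\<^sup>+y. ennreal (r * exp (- r * y)) * indicator {x..} y \<partial>lborel) = ennreal (0 - (- exp (- r * x)))"
  proof (rule nn_integral_FTC_atLeast[where F = "\<lambda>y. - exp (- r * y)"])
    show "((\<lambda>y. - exp (- r * y)) \<longlongrightarrow> 0) at_top"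
      using \<open>0 < r\<close> by real_asymp
  qed (use assms in \<open>auto intro!: derivative_eq_intros\<close>)
  moreover have "(\<integral>\<^sup>+y. indicator {x..} y \<partial>expo r) = (\<integral>\<^sup>+y. ennreal (r * exp (- r * y)) * indicator {x..} y \<partial>lborel)"
    using assms by (subst nn_integral_expo) (auto intro!: nn_integral_cong simp: ennreal_mult mult_ac split: split_indicator)
  ultimately show *: "emeasure (expo r) {x..} = ennreal (exp (- r * x))"
    by simp
  have "AE y in lborel. y \<noteq> x" by (rule AE_lborel_singleton)
  then have "AE y in expo r. y \<noteq> x" by (subst AE_density) auto
  then have "(\<integral>\<^sup>+y. indicator {x<..} y \<partial>expo r) = (\<integral>\<^sup>+y. indicator {x..} y \<partial>expo r)"
    by (intro nn_integral_cong_AE) (auto split: split_indicator)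
  with * show "emeasure (expo r) {x<..} = ennreal (exp (- r * x))"
    by simp
qed

lemma AE_expo_pos:
  assumes "0 < r"
  shows "AE x in expo r. 0 < x"
proof -
  have "AE x in lborel. x \<noteq> (0::real)" by (rule AE_lborel_singleton)
  then have "AE x in lborel. 0 < ennreal (exponential_density r x) \<longrightarrow> 0 < x"
    by eventually_elim (auto simp: exponential_density_def)
  then show ?thesis by (subst AE_density) auto
qed

text \<open>The first of two exponential clocks to ring has the sum of the rates as its rate, and it is
either of them with probability proportional to its rate, independently of the time.\<close>

lemma expo_race:
  assumes p: "0 < p" and q: "0 < q"
    and [measurable]: "F \<in> borel_measurable borel" "G \<in> borel_measurable borel"
  shows "(\<integral>\<^sup>+x. \<integral>\<^sup>+y. (if y \<le> x then G y else F x) \<partial>expo q \<partial>expo p) =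
    (\<integral>\<^sup>+s\<in>{0..}. ennreal (exp (- (p + q) * s)) * (ennreal p * F s + ennreal q * G s) \<partial>lborel)"
proof -
  interpret P: prob_space "expo p" by (rule prob_space_exponential_density[OF p])
  interpret Q: prob_space "expo q" by (rule prob_space_exponential_density[OF q])
  interpret PQ: pair_sigma_finite "expo p" "expo q" ..
  have "(\<integral>\<^sup>+x. \<integral>\<^sup>+y. (if y \<le> x then G y else F x) \<partial>expo q \<partial>expo p) =
    (\<integral>\<^sup>+x. \<integral>\<^sup>+y. G y * indicator {y..} x + F x * indicator {x<..} y \<partial>expo q \<partial>expo p)"
    by (intro nn_integral_cong) (auto split: split_indicator)
  also have "\<dots> = (\<integral>\<^sup>+x. \<integral>\<^sup>+y. G y * indicator {y..} x \<partial>expo q \<partial>expo p)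
      + (\<integral>\<^sup>+x. \<integral>\<^sup>+y. F x * indicator {x<..} y \<partial>expo q \<partial>expo p)"
    by (subst nn_integral_add[symmetric], (simp add: indicator_def; measurable)+)
       (subst nn_integral_add, (simp add: indicator_def; measurable)+)
  also have "(\<integral>\<^sup>+x. \<integral>\<^sup>+y. G y * indicator {y..} x \<partial>expo q \<partial>expo p) =
      (\<integral>\<^sup>+y. \<integral>\<^sup>+x. G y * indicator {y..} x \<partial>expo p \<partial>expo q)"
    by (rule PQ.Fubini'[symmetric]) (simp add: indicator_def)
  also have "\<dots> = (\<integral>\<^sup>+y. G y * emeasure (expo p) {y..} \<partial>expo q)"
    by (intro nn_integral_cong nn_integral_cmult_indicator) simp
  also have "\<dots> = (\<integral>\<^sup>+y. G y * ennreal (exp (- p * y)) \<partial>expo q)"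
    using AE_expo_pos[OF q] by (intro nn_integral_cong_AE) (auto simp: expo_tail[OF p])
  also have "\<dots> = (\<integral>\<^sup>+s\<in>{0..}. ennreal (exp (- (p + q) * s)) * (ennreal q * G s) \<partial>lborel)"
    by (subst nn_integral_expo[OF _ q], measurable, intro nn_integral_cong)
       (auto simp: mult_ac ring_distribs exp_diff exp_minus exp_add divide_inverse ennreal_mult split: split_indicator)
  also have "(\<integral>\<^sup>+x. \<integral>\<^sup>+y. F x * indicator {x<..} y \<partial>expo q \<partial>expo p) =
      (\<integral>\<^sup>+x. F x * emeasure (expo q) {x<..} \<partial>expo p)"
    by (intro nn_integral_cong nn_integral_cmult_indicator) simp
  also have "\<dots> = (\<integral>\<^sup>+x. F x * ennreal (exp (- q * x)) \<partial>expo p)"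
    using AE_expo_pos[OF p] by (intro nn_integral_cong_AE) (auto simp: expo_tail[OF q])
  also have "\<dots> = (\<integral>\<^sup>+s\<in>{0..}. ennreal (exp (- (p + q) * s)) * (ennreal p * F s) \<partial>lborel)"
    by (subst nn_integral_expo[OF _ p], measurable, intro nn_integral_cong)
       (auto simp: mult_ac ring_distribs exp_diff exp_minus exp_add divide_inverse ennreal_mult split: split_indicator)
  also have "(\<integral>\<^sup>+s\<in>{0..}. ennreal (exp (- (p + q) * s)) * (ennreal q * G s) \<partial>lborel) +
      (\<integral>\<^sup>+s\<in>{0..}. ennreal (exp (- (p + q) * s)) * (ennreal p * F s) \<partial>lborel) =
    (\<integral>\<^sup>+s\<in>{0..}. ennreal (exp (- (p + q) * s)) * (ennreal p * F s + ennreal q * G s) \<partial>lborel)"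
    by (subst nn_integral_add[symmetric]) (auto intro!: nn_integral_cong simp: algebra_simps)
  finally show ?thesis .
qed

lemma nn_integral_expo_scale:
  assumes [measurable]: "f \<in> borel_measurable borel" and "0 < r"
  shows "(\<integral>\<^sup>+x. f (x / r) \<partial>expo 1) = (\<integral>\<^sup>+x. f x \<partial>expo r)"
proof -
  have "(\<integral>\<^sup>+x. f (x / r) \<partial>expo 1) =
      (\<integral>\<^sup>+x\<in>{0..}. ennreal (exp (- 1 * x)) * (ennreal 1 * f (x / r)) \<partial>lborel)"
    by (rule nn_integral_expo) simp_all
  also have "\<dots> = ennreal \<bar>r\<bar> * (\<integral>\<^sup>+x. ennreal (exp (- 1 * (0 + r * x))) * (ennreal 1 * f ((0 + r * x) / r)) * indicator {0..} (0 + r * x) \<partial>lborel)"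
    using \<open>0 < r\<close> by (subst nn_integral_real_affine[where c = r and t = 0]) auto
  also have "\<dots> = (\<integral>\<^sup>+x. ennreal r * (ennreal (exp (- 1 * (0 + r * x))) * (ennreal 1 * f ((0 + r * x) / r)) * indicator {0..} (0 + r * x)) \<partial>lborel)"
    using \<open>0 < r\<close> by (subst nn_integral_cmult) auto
  also have "\<dots> = (\<integral>\<^sup>+x\<in>{0..}. ennreal (exp (- r * x)) * (ennreal r * f x) \<partial>lborel)"
    using \<open>0 < r\<close> by (intro nn_integral_cong) (auto simp: mult_ac zero_le_mult_iff split: split_indicator)
  also have "\<dots> = (\<integral>\<^sup>+x. f x \<partial>expo r)"
    by (rule nn_integral_expo[symmetric]) (simp_all add: \<open>0 < r\<close>)
  finally show ?thesis .
qed

lemma (in vacation_queue) nn_integral_clock: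
  assumes [measurable]: "f \<in> borel_measurable (borel \<Otimes>\<^sub>M (borel \<Otimes>\<^sub>M borel))"
  shows "(\<integral>\<^sup>+c. f c \<partial>clock_law Q) =
    (\<integral>\<^sup>+a. \<integral>\<^sup>+v. \<integral>\<^sup>+b. f (a, v, b) \<partial>expo (brk Q) \<partial>expo 1 \<partial>expo (arr Q))"
proof -
  interpret A: prob_space "expo (arr Q)" by (rule prob_space_exponential_density[OF arr_pos])
  interpret V: prob_space "expo 1" by (rule prob_space_exponential_density) simp
  interpret B: prob_space "expo (brk Q)" by (rule prob_space_exponential_density[OF brk_pos])
  interpret VB: pair_prob_space "expo 1" "expo (brk Q)" ..
  interpret AVB: pair_prob_space "expo (arr Q)" "expo 1 \<Otimes>\<^sub>M expo (brk Q)" ..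
  have "(\<integral>\<^sup>+c. f c \<partial>clock_law Q) = (\<integral>\<^sup>+a. \<integral>\<^sup>+x. f (a, x) \<partial>(expo 1 \<Otimes>\<^sub>M expo (brk Q)) \<partial>expo (arr Q))"
    unfolding clock_law_def by (rule VB.nn_integral_fst[symmetric]) measurable
  also have "\<dots> = (\<integral>\<^sup>+a. \<integral>\<^sup>+v. \<integral>\<^sup>+b. f (a, v, b) \<partial>expo (brk Q) \<partial>expo 1 \<partial>expo (arr Q))"
    by (intro nn_integral_cong B.nn_integral_fst[symmetric]) measurable
  finally show ?thesis .
qed

lemma (in vacation_queue) prob_space_clock: "prob_space (clock_law Q)"
proof -
  interpret A: prob_space "expo (arr Q)" by (rule prob_space_exponential_density[OF arr_pos])
  interpret V: prob_space "expo 1" by (rule prob_space_exponential_density) simp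
  interpret B: prob_space "expo (brk Q)" by (rule prob_space_exponential_density[OF brk_pos])
  interpret VB: pair_prob_space "expo 1" "expo (brk Q)" ..
  interpret AVB: pair_prob_space "expo (arr Q)" "expo 1 \<Otimes>\<^sub>M expo (brk Q)" ..
  show ?thesis unfolding clock_law_def by unfold_locales
qed

lemma sets_clock_law [measurable_cong]: "sets (clock_law Q) = sets (borel \<Otimes>\<^sub>M (borel \<Otimes>\<^sub>M borel))"
  unfolding clock_law_def by (intro sets_pair_measure_cong) auto

definition srv_rate :: "queue \<Rightarrow> speed \<Rightarrow> nat \<Rightarrow> real"
  where "srv_rate Q u i = (if i = 0 then 0 else srv Q u)"

lemma (in vacation_queue) srv_pos: "0 < srv Q u"
  using slow_pos slow_less_fast by (cases u) auto

text \<open>The clock of the service is a unit exponential run at the current speed. In an empty queue it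
does not take part, which the rate \<open>srv_rate\<close> records as \<open>0\<close>.\<close>

lemma (in vacation_queue) queue_race:
  assumes [measurable]: "A \<in> borel_measurable borel" "V \<in> borel_measurable borel"
  shows "(\<integral>\<^sup>+(a, v, b). (if a \<le> queue_event Q u i a v then A a else V (v / srv Q u)) \<partial>clock_law Q) =
    (\<integral>\<^sup>+s\<in>{0..}. ennreal (exp (- (arr Q + srv_rate Q u i) * s)) *
      (ennreal (arr Q) * A s + ennreal (srv_rate Q u i) * V s) \<partial>lborel)"
proof -
  interpret V: prob_space "expo 1" by (rule prob_space_exponential_density) simp
  interpret B: prob_space "expo (brk Q)" by (rule prob_space_exponential_density[OF brk_pos])
  have meas: "(\<lambda>(a, v, b). if a \<le> queue_event Q u i a v then A a else V (v / srv Q u))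
      \<in> borel_measurable (borel \<Otimes>\<^sub>M (borel \<Otimes>\<^sub>M (borel :: real measure)))"
    unfolding queue_event_def by (cases "i = 0") (simp_all, measurable)
  have "(\<integral>\<^sup>+(a, v, b). (if a \<le> queue_event Q u i a v then A a else V (v / srv Q u)) \<partial>clock_law Q) =
    (\<integral>\<^sup>+a. \<integral>\<^sup>+v. (if a \<le> queue_event Q u i a v then A a else V (v / srv Q u)) \<partial>expo 1 \<partial>expo (arr Q))"
    by (subst nn_integral_clock[OF meas]) (simp add: B.emeasure_space_1[simplified])
  also have "\<dots> = (\<integral>\<^sup>+s\<in>{0..}. ennreal (exp (- (arr Q + srv_rate Q u i) * s)) *
      (ennreal (arr Q) * A s + ennreal (srv_rate Q u i) * V s) \<partial>lborel)"
  proof (cases "i = 0")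
    case True
    then show ?thesis
      by (simp add: queue_event_def srv_rate_def V.emeasure_space_1[simplified] nn_integral_expo[OF _ arr_pos])
  next
    case False
    have "(\<integral>\<^sup>+a. \<integral>\<^sup>+v. (if a \<le> queue_event Q u i a v then A a else V (v / srv Q u)) \<partial>expo 1 \<partial>expo (arr Q)) =
      (\<integral>\<^sup>+a. \<integral>\<^sup>+v. (if a \<le> v then A a else V v) \<partial>expo (srv Q u) \<partial>expo (arr Q))"
      using False
      by (intro nn_integral_cong, subst nn_integral_expo_scale[symmetric, OF _ srv_pos])
         (auto intro!: nn_integral_cong simp: queue_event_def)
    also have "\<dots> = (\<integral>\<^sup>+a. \<integral>\<^sup>+v. (if v \<le> a then V v else A a) \<partial>expo (srv Q u) \<partial>expo (arr Q))"
    proof (rule nn_integral_cong, rule nn_integral_cong_AE)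
      fix a :: real
      have "AE v in lborel. v \<noteq> a" by (rule AE_lborel_singleton)
      then have "AE v in expo (srv Q u). v \<noteq> a" by (subst AE_density) auto
      then show "AE v in expo (srv Q u). (if a \<le> v then A a else V v) = (if v \<le> a then V v else A a)"
        by eventually_elim auto
    qed
    also have "\<dots> = (\<integral>\<^sup>+s\<in>{0..}. ennreal (exp (- (arr Q + srv_rate Q u i) * s)) *
      (ennreal (arr Q) * A s + ennreal (srv_rate Q u i) * V s) \<partial>lborel)"
      using False by (subst expo_race) (auto simp: arr_pos srv_pos srv_rate_def)
    finally show ?thesis .
  qed
  finally show ?thesis .
qed

text \<open>For a fixed lifetime \<open>b\<close> of the sensor the event of the queue is described by \<open>queue_race\<close>; as a
function of its time, it is one exponential clock which then races against \<open>b\<close>.\<close>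

lemma (in vacation_queue) sensor_race:
  assumes [measurable]: "A \<in> borel_measurable borel" "V \<in> borel_measurable borel" "B \<in> borel_measurable borel"
  shows "(\<integral>\<^sup>+(a, v, b). (if b \<le> queue_event Q u i a v then B b
        else if a \<le> queue_event Q u i a v then A a else V (v / srv Q u)) \<partial>clock_law Q) =
    (\<integral>\<^sup>+s\<in>{0..}. ennreal (exp (- (arr Q + srv_rate Q u i + brk Q) * s)) *
      (ennreal (arr Q) * A s + ennreal (srv_rate Q u i) * V s + ennreal (brk Q) * B s) \<partial>lborel)"
proof -
  let ?X = "\<lambda>a v b. if b \<le> queue_event Q u i a v then B b
    else if a \<le> queue_event Q u i a v then A a else V (v / srv Q u)"
  interpret V: prob_space "expo 1" by (rule prob_space_exponential_density) simp
  interpret B: prob_space "expo (brk Q)" by (rule prob_space_exponential_density[OF brk_pos])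
  interpret A: prob_space "expo (arr Q)" by (rule prob_space_exponential_density[OF arr_pos])
  interpret VB: pair_sigma_finite "expo 1" "expo (brk Q)" ..
  interpret AB: pair_sigma_finite "expo (arr Q)" "expo (brk Q)" ..
  let ?m = "srv_rate Q u i"
  let ?r = "arr Q + ?m"
  have r: "0 < ?r" using arr_pos srv_pos by (auto simp: srv_rate_def intro: add_pos_pos)
  have m: "0 \<le> ?m" using srv_pos[of u] by (simp add: srv_rate_def)
  have rmult: "ennreal ?r * (x / ennreal ?r) = x" for x
    using r by (simp add: ennreal_times_divide mult_divide_eq_ennreal mult.commute[of "ennreal ?r"])
  interpret R: prob_space "expo ?r" by (rule prob_space_exponential_density[OF r])
  interpret RB: pair_sigma_finite "expo ?r" "expo (brk Q)" ..
  have [measurable]: "(\<lambda>x. queue_event Q u i (f x) (g x)) \<in> borel_measurable M"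
    if [measurable]: "f \<in> borel_measurable M" "g \<in> borel_measurable M" for f g and M :: "'z measure"
    unfolding queue_event_def by (cases "i = 0") auto
  have meas: "(\<lambda>(a, v, b). ?X a v b)
      \<in> borel_measurable (borel \<Otimes>\<^sub>M (borel \<Otimes>\<^sub>M (borel :: real measure)))"
    by measurable
  have "(\<integral>\<^sup>+(a, v, b). ?X a v b \<partial>clock_law Q) =
    (\<integral>\<^sup>+a. \<integral>\<^sup>+v. \<integral>\<^sup>+b. ?X a v b \<partial>expo (brk Q) \<partial>expo 1 \<partial>expo (arr Q))"
    by (subst nn_integral_clock[OF meas]) simp
  also have "\<dots> = (\<integral>\<^sup>+a. \<integral>\<^sup>+b. \<integral>\<^sup>+v. ?X a v b \<partial>expo 1 \<partial>expo (brk Q) \<partial>expo (arr Q))"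
    by (intro nn_integral_cong VB.Fubini'[symmetric]) measurable
  also have "\<dots> = (\<integral>\<^sup>+b. \<integral>\<^sup>+a. \<integral>\<^sup>+v. ?X a v b \<partial>expo 1 \<partial>expo (arr Q) \<partial>expo (brk Q))"
    by (rule AB.Fubini'[symmetric]) measurable
  also have "\<dots> = (\<integral>\<^sup>+b. \<integral>\<^sup>+(a, v, b'). ?X a v b \<partial>clock_law Q \<partial>expo (brk Q))"
    by (intro nn_integral_cong, subst nn_integral_clock, measurable) (simp add: B.emeasure_space_1[simplified])
  also have "\<dots> = (\<integral>\<^sup>+b. \<integral>\<^sup>+(a, v, b'). (if a \<le> queue_event Q u i a v then (if b \<le> a then B b else A a)
        else (if b \<le> v / srv Q u then B b else V (v / srv Q u))) \<partial>clock_law Q \<partial>expo (brk Q))"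
    by (intro nn_integral_cong) (auto simp: queue_event_def min_def)
  also have "\<dots> = (\<integral>\<^sup>+b. (\<integral>\<^sup>+s\<in>{0..}. ennreal (exp (- ?r * s)) *
      (ennreal (arr Q) * (if b \<le> s then B b else A s) + ennreal ?m * (if b \<le> s then B b else V s)) \<partial>lborel) \<partial>expo (brk Q))"
    by (intro nn_integral_cong queue_race) measurable
  also have "\<dots> = (\<integral>\<^sup>+b. (\<integral>\<^sup>+s. (if b \<le> s then B b else (ennreal (arr Q) * A s + ennreal ?m * V s) / ennreal ?r) \<partial>expo ?r) \<partial>expo (brk Q))"
  proof (intro nn_integral_cong)
    fix b
    have "ennreal (arr Q) * (if b \<le> s then B b else A s) + ennreal ?m * (if b \<le> s then B b else V s) =
      ennreal ?r * (if b \<le> s then B b else (ennreal (arr Q) * A s + ennreal ?m * V s) / ennreal ?r)" for s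
      using m arr_pos by (cases "b \<le> s") (simp_all only: rmult if_True if_False, simp add: ennreal_plus less_imp_le distrib_right)
    then show "(\<integral>\<^sup>+s\<in>{0..}. ennreal (exp (- ?r * s)) *
      (ennreal (arr Q) * (if b \<le> s then B b else A s) + ennreal ?m * (if b \<le> s then B b else V s)) \<partial>lborel) =
      (\<integral>\<^sup>+s. (if b \<le> s then B b else (ennreal (arr Q) * A s + ennreal ?m * V s) / ennreal ?r) \<partial>expo ?r)"
      by (subst nn_integral_expo[OF _ r]) simp_all
  qed
  also have "\<dots> = (\<integral>\<^sup>+s. (\<integral>\<^sup>+b. (if b \<le> s then B b else (ennreal (arr Q) * A s + ennreal ?m * V s) / ennreal ?r) \<partial>expo (brk Q)) \<partial>expo ?r)"
    by (rule RB.Fubini') measurable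
  also have "\<dots> = (\<integral>\<^sup>+s\<in>{0..}. ennreal (exp (- (?r + brk Q) * s)) * (ennreal ?r * ((ennreal (arr Q) * A s + ennreal ?m * V s) / ennreal ?r) + ennreal (brk Q) * B s) \<partial>lborel)"
    by (rule expo_race[OF r brk_pos]) measurable
  also have "\<dots> = (\<integral>\<^sup>+s\<in>{0..}. ennreal (exp (- (?r + brk Q) * s)) * (ennreal (arr Q) * A s + ennreal ?m * V s + ennreal (brk Q) * B s) \<partial>lborel)"
    using r by (simp only: rmult)
  finally show ?thesis .
qed

section \<open>Measurability of the jump chain\<close>

text \<open>The left-hand side is the expectation of a payoff collected at an exponential time of rate \<open>r\<close>
that is cut off at \<open>m\<close>, where \<open>z\<close> is paid if the clock has not rung by then. The function \<open>F\<close> is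
the discounted continuation value; if its decrease pays for the payoff rate, the fundamental theorem
of calculus bounds the total by \<open>F 0\<close>.\<close>

lemma killed_integral_bound:
  fixes F F' :: "real \<Rightarrow> real" and P :: "real \<Rightarrow> ennreal"
  assumes [measurable]: "P \<in> borel_measurable borel"
    and m: "0 \<le> m" and r: "0 < r" and z: "0 \<le> z"
    and F: "\<And>s. 0 \<le> s \<Longrightarrow> s \<le> m \<Longrightarrow> (F has_real_derivative F' s) (at s within {0..m})"
    and F': "\<And>s. 0 \<le> s \<Longrightarrow> s \<le> m \<Longrightarrow> F' s \<le> 0"
    and before: "\<And>s. 0 \<le> s \<Longrightarrow> s < m \<Longrightarrow> P s \<le> ennreal (- F' s)"
    and after: "\<And>s. m < s \<Longrightarrow> P s \<le> ennreal (exp (- r * s)) * ennreal (r * z)"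
    and last: "exp (- r * m) * z \<le> F m"
  shows "(\<integral>\<^sup>+s\<in>{0..}. P s \<partial>lborel) \<le> ennreal (F 0)"
proof -
  have FTC: "((\<lambda>s. - F' s) has_integral (- F m - - F 0)) {0..m}"
    using m F by (intro fundamental_theorem_of_calculus)
      (auto simp: has_real_derivative_iff_has_vector_derivative[symmetric] intro!: DERIV_minus)
  then have I: "(\<integral>\<^sup>+s. indicator {0..m} s * (- F' s) \<partial>lborel) = ennreal (F 0 - F m)"
    using F' by (subst nn_integral_has_integral_lebesgue[OF _ FTC]) auto
  have nonneg: "0 \<le> F 0 - F m"
    using has_integral_nonneg[OF FTC] F' by auto
  let ?J = "\<lambda>s. ennreal z * (ennreal (exp (- r * s)) * (ennreal r * 1)) * indicator {m..} s"
  have "(\<integral>\<^sup>+s. ?J s \<partial>lborel) = ennreal z * (\<integral>\<^sup>+s. indicator {m..} s * (ennreal (exp (- r * s)) * (ennreal r * 1)) \<partial>lborel)"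
    by (subst nn_integral_cmult[symmetric]) (auto intro!: nn_integral_cong simp: mult_ac)
  also have "(\<integral>\<^sup>+s. indicator {m..} s * (ennreal (exp (- r * s)) * (ennreal r * 1)) \<partial>lborel) =
     (\<integral>\<^sup>+s\<in>{0..}. (ennreal (exp (- r * s)) * (ennreal r * indicator {m..} s)) \<partial>lborel)"
    using m by (intro nn_integral_cong) (auto split: split_indicator)
  also have "\<dots> = emeasure (expo r) {m..}"
    by (subst nn_integral_expo[symmetric, OF _ r]) auto
  finally have J: "(\<integral>\<^sup>+s. ?J s \<partial>lborel) = ennreal z * ennreal (exp (- r * m))"
    using m by (simp add: expo_tail[OF r])
  have neq: "AE s in lborel. s \<noteq> m" by (rule AE_lborel_singleton)
  have "(\<integral>\<^sup>+s\<in>{0..}. P s \<partial>lborel) = (\<integral>\<^sup>+s. P s * indicator {m<..} s + P s * indicator {0..m} s \<partial>lborel)"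
    using m by (intro nn_integral_cong) (auto split: split_indicator)
  also have "\<dots> = (\<integral>\<^sup>+s. P s * indicator {m<..} s \<partial>lborel) + (\<integral>\<^sup>+s. P s * indicator {0..m} s \<partial>lborel)"
    by (rule nn_integral_add) measurable
  also have "\<dots> \<le> (\<integral>\<^sup>+s. ?J s \<partial>lborel) + (\<integral>\<^sup>+s. indicator {0..m} s * (- F' s) \<partial>lborel)"
  proof (intro add_mono nn_integral_mono_AE)
    show "AE s in lborel. P s * indicator {m<..} s \<le> ?J s"
      using after r z by (intro AE_I2) (auto simp: mult_ac ennreal_mult split: split_indicator)
    show "AE s in lborel. P s * indicator {0..m} s \<le> ennreal (indicator {0..m} s * (- F' s))"
      using neq by eventually_elim (use before in \<open>auto split: split_indicator\<close>)
  qed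
  also have "\<dots> = ennreal (z * exp (- r * m) + (F 0 - F m))"
    unfolding I J using nonneg z by (simp add: ennreal_mult ennreal_plus)
  also have "\<dots> \<le> ennreal (F 0)"
    using last by (intro ennreal_leI) (simp add: mult_ac)
  finally show ?thesis .
qed

text \<open>States are coded in a product of two discrete spaces and the real line, because the datatype of
states carries no measurable structure of its own. Only the residual delay is continuous.\<close>

fun enc :: "state \<Rightarrow> nat \<times> nat \<times> real" where
  "enc (Active i) = (0, i, 0)"
| "enc (Dead i) = (1, i, 0)"
| "enc (Waiting i t) = (2, i, t)"
| "enc (Init i) = (3, i, 0)"

fun dec :: "nat \<times> nat \<times> real \<Rightarrow> state" where
  "dec (n, i, t) = (if n = 0 then Active i else if n = 1 then Dead i else if n = 2 then Waiting i t else Init i)"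

lemma dec_enc [simp]: "dec (enc x) = x"
  by (cases x) auto

abbreviation state_codes :: "(nat \<times> nat \<times> real) measure"
  where "state_codes \<equiv> count_space UNIV \<Otimes>\<^sub>M (count_space UNIV \<Otimes>\<^sub>M borel)"

lemma enc_in_space: "enc x \<in> space state_codes"
  by (simp add: space_pair_measure)

text \<open>The kind of a state and the number of customers take countably many values, so measurability may be
checked with both fixed.\<close>

lemma measurable_by_state_kind:
  assumes E [measurable]: "E \<in> N \<rightarrow>\<^sub>M state_codes"
    and "\<And>n i. (\<lambda>x. g (dec (n, i, snd (snd (E x)))) x) \<in> N \<rightarrow>\<^sub>M K"
  shows "(\<lambda>x. g (dec (E x)) x) \<in> N \<rightarrow>\<^sub>M K"
proof -
  have "(\<lambda>x. g (dec (fst (E x), snd (E x))) x) \<in> N \<rightarrow>\<^sub>M K"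
  proof (rule measurable_compose_countable[where f = "\<lambda>n x. g (dec (n, snd (E x))) x"])
    fix n
    have "(\<lambda>x. g (dec (n, fst (snd (E x)), snd (snd (E x)))) x) \<in> N \<rightarrow>\<^sub>M K"
      by (rule measurable_compose_countable[where f = "\<lambda>i x. g (dec (n, i, snd (snd (E x)))) x"])
         (use assms in simp_all)
    then show "(\<lambda>x. g (dec (n, snd (E x))) x) \<in> N \<rightarrow>\<^sub>M K" by simp
  qed simp
  then show ?thesis by simp
qed

lemma measurable_queue_event [measurable]:
  "(\<lambda>x. queue_event Q u i (f x) (g x)) \<in> borel_measurable M"
  if [measurable]: "f \<in> borel_measurable M" "g \<in> borel_measurable M"
  unfolding queue_event_def by (cases "i = 0") auto

lemma if_distrib_enc: "enc (if P then x else y) = (if P then enc x else enc y)"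
  by simp

lemma measurable_sojourn:
  assumes [measurable]: "E \<in> N \<rightarrow>\<^sub>M state_codes" "C \<in> N \<rightarrow>\<^sub>M borel \<Otimes>\<^sub>M (borel \<Otimes>\<^sub>M borel)"
  shows "(\<lambda>x. sojourn Q \<phi> (dec (E x)) (C x)) \<in> borel_measurable N"
proof (rule measurable_by_state_kind[where E = E])
  fix n i
  let ?a = "\<lambda>x. fst (C x)" and ?v = "\<lambda>x. fst (snd (C x))" and ?b = "\<lambda>x. snd (snd (C x))"
  have *: "(\<lambda>x. sojourn Q \<phi> (dec (n, i, snd (snd (E x)))) (?a x, ?v x, ?b x)) \<in> borel_measurable N"
    by (cases "n = 0"; cases "n = 1"; cases "n = 2"; simp del: prod.collapse; measurable)
  then show "(\<lambda>x. sojourn Q \<phi> (dec (n, i, snd (snd (E x)))) (C x)) \<in> borel_measurable N"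
    by (simp del: dec.simps)
qed measurable

lemma measurable_enc_successor:
  assumes [measurable]: "E \<in> N \<rightarrow>\<^sub>M state_codes" "C \<in> N \<rightarrow>\<^sub>M borel \<Otimes>\<^sub>M (borel \<Otimes>\<^sub>M borel)"
  shows "(\<lambda>x. enc (successor Q \<phi> (dec (E x)) (C x))) \<in> N \<rightarrow>\<^sub>M state_codes"
proof (rule measurable_by_state_kind[where E = E])
  fix n i
  let ?a = "\<lambda>x. fst (C x)" and ?v = "\<lambda>x. fst (snd (C x))" and ?b = "\<lambda>x. snd (snd (C x))"
  have *: "(\<lambda>x. enc (successor Q \<phi> (dec (n, i, snd (snd (E x)))) (?a x, ?v x, ?b x))) \<in> N \<rightarrow>\<^sub>M state_codes"
    by (cases "n = 0"; cases "n = 1"; cases "n = 2"; simp add: Let_def enc_in_space del: prod.collapse; (unfold if_distrib_enc enc.simps)?; measurable?)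
  then show "(\<lambda>x. enc (successor Q \<phi> (dec (n, i, snd (snd (E x)))) (C x))) \<in> N \<rightarrow>\<^sub>M state_codes"
    by (simp del: dec.simps)
qed measurable

lemma sets_clock_space [measurable_cong]:
  "sets (clock_space Q) = sets (stream_space (borel \<Otimes>\<^sub>M (borel \<Otimes>\<^sub>M borel)))"
  unfolding clock_space_def by (rule sets_stream_space_cong) (rule sets_clock_law)

lemma measurable_jump:
  "(\<lambda>\<omega>. fst (jump Q \<phi> s \<omega> n)) \<in> borel_measurable (clock_space Q)"
  "(\<lambda>\<omega>. enc (snd (jump Q \<phi> s \<omega> n))) \<in> clock_space Q \<rightarrow>\<^sub>M state_codes"
proof (induction n)
  case (Suc n)
  note [measurable] = Suc
  have [measurable]: "(\<lambda>\<omega>. \<omega> !! n) \<in> clock_space Q \<rightarrow>\<^sub>M borel \<Otimes>\<^sub>M (borel \<Otimes>\<^sub>M borel)"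
    by measurable
  case 1
  show ?case
    using borel_measurable_add[OF Suc(1) measurable_sojourn[OF Suc(2), of "\<lambda>\<omega>. \<omega> !! n" Q \<phi>]]
    by (simp add: split_beta)
  case 2
  show ?case
    using measurable_enc_successor[OF Suc(2), of "\<lambda>\<omega>. \<omega> !! n" Q \<phi>]
    by (simp add: split_beta)
qed (simp_all add: enc_in_space)

text \<open>The chain is defined by adding transitions at the end; conditioning on the first transition needs
it the other way round.\<close>

lemma jump_Cons:
  "jump Q \<phi> s (c ## \<omega>) (Suc n) =
    (sojourn Q \<phi> s c + fst (jump Q \<phi> (successor Q \<phi> s c) \<omega> n), snd (jump Q \<phi> (successor Q \<phi> s c) \<omega> n))"
proof (induction n)
  case (Suc n)
  show ?case
    by (subst jump.simps(2), subst Suc) (simp add: split_beta)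
qed simp

fun reachable :: "state \<Rightarrow> bool" where
  "reachable (Active i) = True"
| "reachable (Waiting i t) = (0 \<le> t)"
| "reachable _ = False"

section \<open>Expected cost below a supersolution\<close>

fun positive_clocks :: "clocks \<Rightarrow> bool"
  where "positive_clocks (a, v, b) = (0 < a \<and> 0 < v \<and> 0 < b)"

lemma (in vacation_queue) AE_clock_pos:
  "AE c in clock_law Q. positive_clocks c"
proof -
  have pred: "{c \<in> space (borel \<Otimes>\<^sub>M (borel \<Otimes>\<^sub>M borel)). \<not> (0 < fst c \<and> 0 < fst (snd c) \<and> 0 < snd (snd c))}
     \<in> sets (borel \<Otimes>\<^sub>M (borel \<Otimes>\<^sub>M (borel::real measure)) :: clocks measure)"
    by measurable
  let ?N = "{c. \<not> (0 < fst c \<and> 0 < fst (snd c) \<and> 0 < snd (snd c))} :: clocks set"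
  have N: "?N \<in> sets (clock_law Q)"
    unfolding sets_clock_law using pred by (simp add: space_pair_measure)
  then have "emeasure (clock_law Q) ?N = (\<integral>\<^sup>+c. indicator ?N c \<partial>clock_law Q)"
    by simp
  also have "\<dots> = (\<integral>\<^sup>+a. \<integral>\<^sup>+v. \<integral>\<^sup>+b. indicator ?N (a, v, b) \<partial>expo (brk Q) \<partial>expo 1 \<partial>expo (arr Q))"
    using N by (intro nn_integral_clock) (simp add: sets_clock_law[symmetric] borel_measurable_indicator_iff cong: measurable_cong_sets)
  also have "\<dots> = (\<integral>\<^sup>+a. \<integral>\<^sup>+v. \<integral>\<^sup>+b. 0 \<partial>expo (brk Q) \<partial>expo 1 \<partial>expo (arr Q))"
    using AE_expo_pos[OF arr_pos]
  proof (intro nn_integral_cong_AE, eventually_elim)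
    fix a :: real assume a: "0 < a"
    show "(\<integral>\<^sup>+v. \<integral>\<^sup>+b. indicator ?N (a, v, b) \<partial>expo (brk Q) \<partial>expo 1) = (\<integral>\<^sup>+v. \<integral>\<^sup>+b. 0 \<partial>expo (brk Q) \<partial>expo 1)"
      using AE_expo_pos[of 1, simplified]
    proof (intro nn_integral_cong_AE, eventually_elim)
      fix v :: real assume v: "0 < v"
      show "(\<integral>\<^sup>+b. indicator ?N (a, v, b) \<partial>expo (brk Q)) = (\<integral>\<^sup>+b. 0 \<partial>expo (brk Q))"
        using AE_expo_pos[OF brk_pos] by (intro nn_integral_cong_AE, eventually_elim) (simp add: a v)
    qed
  qed
  finally have "emeasure (clock_law Q) ?N = 0" by simp
  with N have "?N \<in> null_sets (clock_law Q)" by (rule null_setsI[rotated])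
  then have "AE c in clock_law Q. c \<notin> ?N" by (rule AE_not_in)
  then show ?thesis by eventually_elim auto
qed

text \<open>The queue under a policy that schedules a repair after the finite delay \<open>d i\<close>, with general costs:
rates \<open>kA\<close> in active and \<open>kW\<close> in waiting states, \<open>qr\<close> for every repair and \<open>qj\<close> for every other
transition. One choice gives the cost of the policy, another one the number of transitions.\<close>

locale controlled_queue = vacation_queue +
  fixes f :: "nat \<Rightarrow> speed" and d :: "nat \<Rightarrow> real"
    and kA kW :: "nat \<Rightarrow> real" and qj qr :: real
  assumes d_nonneg: "0 \<le> d i"
    and kA_nonneg: "0 \<le> kA i" and kW_nonneg: "0 \<le> kW i"
    and qj_nonneg: "0 \<le> qj" and qr_nonneg: "0 \<le> qr"
begin

abbreviation \<phi> :: policy where "\<phi> \<equiv> (f, \<lambda>i. ennreal (d i))"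

abbreviation epoch :: "state \<Rightarrow> clocks stream \<Rightarrow> nat \<Rightarrow> real"
  where "epoch s \<omega> n \<equiv> fst (jump Q \<phi> s \<omega> n)"

abbreviation entered :: "state \<Rightarrow> clocks stream \<Rightarrow> nat \<Rightarrow> state"
  where "entered s \<omega> n \<equiv> snd (jump Q \<phi> s \<omega> n)"

definition run_rate :: "state \<Rightarrow> real"
  where "run_rate x = (case x of Active i \<Rightarrow> kA i | Waiting i t \<Rightarrow> kW i | _ \<Rightarrow> 0)"

definition jump_cost :: "state \<Rightarrow> state \<Rightarrow> real"
  where "jump_cost x y = (if is_Waiting x \<and> is_Active y then qr else qj)"

definition step_cost :: "state \<Rightarrow> clocks \<Rightarrow> real \<Rightarrow> ennreal"
  where "step_cost x c t =
    (if sojourn Q \<phi> x c \<le> t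
     then ennreal (run_rate x * sojourn Q \<phi> x c + jump_cost x (successor Q \<phi> x c))
     else ennreal (run_rate x * t))"

text \<open>The cost of the \<open>n\<close>-th sojourn and of the transition that ends it, up to the horizon \<open>t\<close>. All
earlier epochs are required to be at most \<open>t\<close>, which for nonnegative sojourns follows from the last
one; in this form \<open>leg_cost_Suc\<close> holds on every path and not only almost surely.\<close>

definition leg_cost :: "nat \<Rightarrow> state \<Rightarrow> real \<Rightarrow> clocks stream \<Rightarrow> ennreal"
  where "leg_cost n s t \<omega> =
    (if \<forall>j\<le>n. epoch s \<omega> j \<le> t
     then step_cost (entered s \<omega> n) (\<omega> !! n) (t - epoch s \<omega> n) else 0)"

definition expected_cost :: "nat \<Rightarrow> state \<Rightarrow> real \<Rightarrow> ennreal"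
  where "expected_cost n s t = (\<integral>\<^sup>+\<omega>. (\<Sum>m<n. leg_cost m s t \<omega>) \<partial>clock_space Q)"

lemma schedule_eq [simp]: "schedule \<phi> i = Waiting i (d i)"
  by (simp add: schedule_def d_nonneg)

lemma measurable_run_rate:
  assumes "E \<in> N \<rightarrow>\<^sub>M state_codes"
  shows "(\<lambda>x. run_rate (dec (E x))) \<in> borel_measurable N"
  proof (rule measurable_by_state_kind[OF assms])
  fix n i
  show "(\<lambda>x. run_rate (dec (n, i, snd (snd (E x))))) \<in> borel_measurable N"
    by (cases "n = 0"; cases "n = 1"; cases "n = 2"; simp add: run_rate_def)
qed

lemma measurable_jump_cost:
  assumes [measurable]: "E \<in> N \<rightarrow>\<^sub>M state_codes" "E' \<in> N \<rightarrow>\<^sub>M state_codes"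
  shows "(\<lambda>x. jump_cost (dec (E x)) (dec (E' x))) \<in> borel_measurable N"
proof -
  have "jump_cost (dec e) (dec e') = (if fst e = 2 \<and> fst e' = 0 then qr else qj)" for e e'
    by (cases e; cases e') (auto simp: jump_cost_def)
  then show ?thesis by simp
qed

lemma measurable_leg_cost [measurable]:
  "leg_cost n s t \<in> borel_measurable (clock_space Q)"
proof -
  note [measurable] = measurable_jump
  have [measurable]: "(\<lambda>\<omega>. \<omega> !! n) \<in> clock_space Q \<rightarrow>\<^sub>M borel \<Otimes>\<^sub>M (borel \<Otimes>\<^sub>M borel)"
    by measurable
  note E = measurable_jump(2)[of Q \<phi> s n]
  have [measurable]: "(\<lambda>\<omega>. sojourn Q \<phi> (entered s \<omega> n) (\<omega> !! n)) \<in> borel_measurable (clock_space Q)"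
    using measurable_sojourn[OF E, of "\<lambda>\<omega>. \<omega> !! n" Q \<phi>] by simp
  have [measurable]: "(\<lambda>\<omega>. run_rate (entered s \<omega> n)) \<in> borel_measurable (clock_space Q)"
    using measurable_run_rate[OF E] by simp
  have [measurable]: "(\<lambda>\<omega>. jump_cost (entered s \<omega> n) (successor Q \<phi> (entered s \<omega> n) (\<omega> !! n)))
      \<in> borel_measurable (clock_space Q)"
    using measurable_jump_cost[OF E measurable_enc_successor[OF E, of "\<lambda>\<omega>. \<omega> !! n" Q \<phi>]] by simp
  show ?thesis
    unfolding leg_cost_def step_cost_def by measurable
qed

lemma leg_cost_neg: "t < 0 \<Longrightarrow> leg_cost n s t \<omega> = 0"
  unfolding leg_cost_def by (auto intro: exI[of _ 0])

lemma expected_cost_neg: "t < 0 \<Longrightarrow> expected_cost n s t = 0"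
  by (simp add: expected_cost_def leg_cost_neg)

lemma leg_cost_0: "0 \<le> t \<Longrightarrow> leg_cost 0 s t (c ## \<omega>) = step_cost s c t"
  by (simp add: leg_cost_def)

lemma leg_cost_Suc:
  assumes "0 \<le> t"
  shows "leg_cost (Suc n) s t (c ## \<omega>) = leg_cost n (successor Q \<phi> s c) (t - sojourn Q \<phi> s c) \<omega>"
proof -
  have "(\<forall>j\<le>Suc n. epoch s (c ## \<omega>) j \<le> t) \<longleftrightarrow>
    (\<forall>j\<le>n. epoch (successor Q \<phi> s c) \<omega> j \<le> t - sojourn Q \<phi> s c)"
    using assms All_less_Suc2[of "Suc n" "\<lambda>j. epoch s (c ## \<omega>) j \<le> t"]
    by (simp add: less_Suc_eq_le jump_Cons le_diff_eq add.commute del: jump.simps(2))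
  then show ?thesis
    unfolding leg_cost_def by (rule if_cong) (simp_all add: jump_Cons diff_diff_eq del: jump.simps(2))
qed

lemma expected_cost_Suc:
  assumes "0 \<le> t"
  shows "expected_cost (Suc n) s t =
    (\<integral>\<^sup>+c. step_cost s c t + expected_cost n (successor Q \<phi> s c) (t - sojourn Q \<phi> s c) \<partial>clock_law Q)"
proof -
  interpret C: prob_space "clock_law Q" by (rule prob_space_clock)
  interpret S: prob_space "clock_space Q"
    unfolding clock_space_def by (rule C.prob_space_stream_space)
  have meas: "(\<lambda>\<omega>. \<Sum>m<Suc n. leg_cost m s t \<omega>) \<in> borel_measurable (stream_space (clock_law Q))"
    using borel_measurable_sum[of "{..<Suc n}" "\<lambda>m. leg_cost m s t" "clock_space Q"] measurable_leg_cost
    unfolding clock_space_def by simp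
  have "expected_cost (Suc n) s t =
    (\<integral>\<^sup>+c. (\<integral>\<^sup>+\<omega>. (\<Sum>m<Suc n. leg_cost m s t (c ## \<omega>)) \<partial>clock_space Q) \<partial>clock_law Q)"
    unfolding expected_cost_def clock_space_def by (rule C.nn_integral_stream_space[OF meas])
  also have "\<dots> = (\<integral>\<^sup>+c. step_cost s c t + expected_cost n (successor Q \<phi> s c) (t - sojourn Q \<phi> s c) \<partial>clock_law Q)"
  proof (rule nn_integral_cong)
    fix c
    have "(\<integral>\<^sup>+\<omega>. (\<Sum>m<Suc n. leg_cost m s t (c ## \<omega>)) \<partial>clock_space Q) =
      (\<integral>\<^sup>+\<omega>. step_cost s c t + (\<Sum>m<n. leg_cost m (successor Q \<phi> s c) (t - sojourn Q \<phi> s c) \<omega>) \<partial>clock_space Q)"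
      by (simp add: sum.lessThan_Suc_shift leg_cost_0 leg_cost_Suc assms del: sum.lessThan_Suc)
    also have "\<dots> = step_cost s c t + expected_cost n (successor Q \<phi> s c) (t - sojourn Q \<phi> s c)"
      unfolding expected_cost_def by (subst nn_integral_add) (simp_all add: S.emeasure_space_1)
    finally show "(\<integral>\<^sup>+\<omega>. (\<Sum>m<Suc n. leg_cost m s t (c ## \<omega>)) \<partial>clock_space Q) =
      step_cost s c t + expected_cost n (successor Q \<phi> s c) (t - sojourn Q \<phi> s c)" .
  qed
  finally show ?thesis .
qed

end

text \<open>A potential, \<open>WA\<close> in active and \<open>WW\<close> in waiting states, and a rate \<open>\<gamma>\<close>. The inequalities say that
cost minus \<open>\<gamma>\<close> times elapsed time plus potential does not increase on average: \<open>active\<close> is a statement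
about the generator, \<open>waiting\<close> as well, with the time derivative from the decreasing residual delay,
and \<open>repair\<close> concerns the deterministic instant at which the delay expires.\<close>

locale supersolution = controlled_queue +
  fixes WA :: "nat \<Rightarrow> real" and WW WW' :: "nat \<Rightarrow> real \<Rightarrow> real" and \<gamma> :: real
  assumes \<gamma>_nonneg: "0 \<le> \<gamma>"
    and WA_nonneg: "0 \<le> WA i"
    and WW_nonneg: "0 \<le> t \<Longrightarrow> 0 \<le> WW i t"
    and WW_measurable: "WW i \<in> borel_measurable borel"
    and WW_deriv: "0 \<le> t \<Longrightarrow> (WW i has_real_derivative WW' i t) (at t within {0..})"
    and active: "kA i + arr Q * (qj + WA (Suc i)) + srv_rate Q (f i) i * (qj + WA (i - 1))
        + brk Q * (qj + WW i (d i)) \<le> \<gamma> + (arr Q + srv_rate Q (f i) i + brk Q) * WA i"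
    and repair: "qr + WA i \<le> WW i 0"
    and waiting: "0 \<le> t \<Longrightarrow> kW i + arr Q * (qj + WW (Suc i) t) + srv_rate Q (base Q) i * (qj + WW (i - 1) t)
        \<le> \<gamma> + (arr Q + srv_rate Q (base Q) i) * WW i t + WW' i t"
begin

fun potential :: "state \<Rightarrow> real" where
  "potential (Active i) = WA i"
| "potential (Waiting i t) = WW i t"
| "potential _ = 0"

lemma potential_nonneg: "reachable x \<Longrightarrow> 0 \<le> potential x"
  by (cases x) (auto simp: WA_nonneg WW_nonneg)

lemma srv_rate_nonneg: "0 \<le> srv_rate Q u i"
  using srv_pos[of u] by (simp add: srv_rate_def)

text \<open>The horizon is part of the state here: with \<open>s\<close> time units gone, the remaining cost is at most
\<open>\<gamma> * (t - s)\<close> plus the potential. The cost collected so far is added to it, so that no separate integral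
for the running cost is needed.\<close>

lemma step_bound_active:
  assumes IH: "\<And>x t. reachable x \<Longrightarrow> 0 \<le> t \<Longrightarrow> expected_cost n x t \<le> ennreal (\<gamma> * t + potential x)"
    and t: "0 \<le> t"
  shows "expected_cost (Suc n) (Active i) t \<le> ennreal (\<gamma> * t + WA i)"
proof -
  define G where "G w s = (if s \<le> t then ennreal (kA i * s + qj + \<gamma> * (t - s) + w) else ennreal (kA i * t))" for w s
  have [measurable]: "G w \<in> borel_measurable borel" for w unfolding G_def by measurable
  let ?m = "srv_rate Q (f i) i"
  let ?r = "arr Q + ?m + brk Q"
  let ?P = "\<lambda>s. ennreal (arr Q) * G (WA (Suc i)) s + ennreal ?m * G (WA (i - 1)) s + ennreal (brk Q) * G (WW i (d i)) s"
  let ?R = "\<lambda>s. ?r * (kA i * s + \<gamma> * (t - s) + WA i) + \<gamma> - kA i"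
  have r: "0 < ?r" using arr_pos brk_pos srv_rate_nonneg[of "f i" i] by linarith
  have step: "step_cost (Active i) c t + expected_cost n x (t - s) \<le> G (potential x) s"
    if "sojourn Q \<phi> (Active i) c = s" "successor Q \<phi> (Active i) c = x" "reachable x" "0 < s" for c x s
  proof (cases "s \<le> t")
    case True
    have jc: "jump_cost (Active i) x = qj" by (simp add: jump_cost_def)
    have "step_cost (Active i) c t + expected_cost n x (t - s)
      \<le> ennreal (kA i * s + qj) + ennreal (\<gamma> * (t - s) + potential x)"
      using True that IH[of x "t - s"] by (intro add_mono) (simp_all add: step_cost_def run_rate_def jc)
    also have "\<dots> = G (potential x) s"
      using True that t \<gamma>_nonneg potential_nonneg[of x] kA_nonneg[of i] qj_nonneg
      by (simp add: G_def ennreal_plus[symmetric] add_ac del: ennreal_plus)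
    finally show ?thesis .
  next
    case False
    then show ?thesis
      using that by (simp add: G_def step_cost_def run_rate_def expected_cost_neg)
  qed
  have "expected_cost (Suc n) (Active i) t \<le>
    (\<integral>\<^sup>+(a, v, b). (if b \<le> queue_event Q (f i) i a v then G (WW i (d i)) b
       else if a \<le> queue_event Q (f i) i a v then G (WA (Suc i)) a else G (WA (i - 1)) (v / srv Q (f i))) \<partial>clock_law Q)"
    unfolding expected_cost_Suc[OF t]
  proof (rule nn_integral_mono_AE, use AE_clock_pos in eventually_elim)
    fix c :: clocks
    obtain a v b where c: "c = (a, v, b)" by (cases c)
    assume "positive_clocks c"
    then have pos: "0 < a" "0 < v" "0 < b" by (auto simp: c)
    have v': "0 < v / srv Q (f i)" using pos srv_pos[of "f i"] by simp
    have ev: "queue_event Q (f i) i a v = (if a \<le> queue_event Q (f i) i a v then a else v / srv Q (f i))"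
      by (auto simp: queue_event_def min_def)
    show "step_cost (Active i) c t + expected_cost n (successor Q \<phi> (Active i) c) (t - sojourn Q \<phi> (Active i) c)
      \<le> (case c of (a, v, b) \<Rightarrow> (if b \<le> queue_event Q (f i) i a v then G (WW i (d i)) b
       else if a \<le> queue_event Q (f i) i a v then G (WA (Suc i)) a else G (WA (i - 1)) (v / srv Q (f i))))"
    proof (cases "b \<le> queue_event Q (f i) i a v")
      case True
      then show ?thesis
        using step[of c b "Waiting i (d i)"] pos by (simp add: c Let_def d_nonneg)
    next
      case b: False
      show ?thesis
      proof (cases "a \<le> queue_event Q (f i) i a v")
        case True
        then show ?thesis
          using step[of c a "Active (Suc i)"] pos b ev by (simp add: c Let_def)
      next
        case False
        then show ?thesis
          using step[of c "v / srv Q (f i)" "Active (i - 1)"] pos b ev v' by (simp add: c Let_def)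
      qed
    qed
  qed
  also have "\<dots> = (\<integral>\<^sup>+s\<in>{0..}. ennreal (exp (- ?r * s)) *
      ?P s \<partial>lborel)"
    by (rule sensor_race) measurable
  also have "\<dots> \<le> ennreal (exp (- ?r * 0) * (kA i * 0 + \<gamma> * (t - 0) + WA i))"
  proof (rule killed_integral_bound[where m = t and r = ?r and z = "kA i * t"
        and F = "\<lambda>s. exp (- ?r * s) * (kA i * s + \<gamma> * (t - s) + WA i)"
        and F' = "\<lambda>s. - (exp (- ?r * s) * ?R s)"])
    show "exp (- ?r * t) * (kA i * t) \<le> exp (- ?r * t) * (kA i * t + \<gamma> * (t - t) + WA i)"
      using WA_nonneg[of i] by (intro mult_left_mono) auto
    fix s :: real
    assume s: "0 \<le> s"
    let ?g = "\<lambda>w. kA i * s + qj + \<gamma> * (t - s) + w"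
    { assume "s \<le> t"
      then have pos: "0 \<le> ?g w" if "0 \<le> w" for w
        using that s kA_nonneg[of i] qj_nonneg \<gamma>_nonneg by (intro add_nonneg_nonneg mult_nonneg_nonneg) auto
      have 1: "arr Q * ?g (WA (Suc i)) + ?m * ?g (WA (i - 1)) + brk Q * ?g (WW i (d i)) \<le>
        ?R s"
        using active[of i] by (simp add: algebra_simps)
      have 2: "0 \<le> arr Q * ?g (WA (Suc i)) + ?m * ?g (WA (i - 1)) + brk Q * ?g (WW i (d i))"
        using arr_pos brk_pos srv_rate_nonneg
        by (intro add_nonneg_nonneg[OF add_nonneg_nonneg] mult_nonneg_nonneg pos WA_nonneg WW_nonneg d_nonneg) auto
      show "- (exp (- ?r * s) * ?R s) \<le> 0"
        using 1 2 by simp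
      have "ennreal (exp (- ?r * s)) *
          ?P s =
        ennreal (exp (- ?r * s) * (arr Q * ?g (WA (Suc i)) + ?m * ?g (WA (i - 1)) + brk Q * ?g (WW i (d i))))"
        using \<open>s \<le> t\<close> arr_pos brk_pos srv_rate_nonneg[of "f i" i]
        by (simp add: G_def ennreal_mult[symmetric] ennreal_plus[symmetric] pos WA_nonneg WW_nonneg d_nonneg less_imp_le
             del: ennreal_plus)
      also have "\<dots> \<le> ennreal (exp (- ?r * s) * ?R s)"
        using 1 by (intro ennreal_leI mult_left_mono) auto
      finally have "ennreal (exp (- ?r * s)) *
          ?P s \<le>
        ennreal (- (- (exp (- ?r * s) * ?R s)))" by simp }
    then show "ennreal (exp (- ?r * s)) *
          ?P s \<le>
        ennreal (- (- (exp (- ?r * s) * ?R s)))" if "s < t"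
      using that by simp
    show "((\<lambda>s. exp (- ?r * s) * (kA i * s + \<gamma> * (t - s) + WA i)) has_real_derivative
         - (exp (- ?r * s) * ?R s)) (at s within {0..t})"
      by (auto intro!: derivative_eq_intros simp: algebra_simps)
  next
    fix s :: real assume "t < s"
    then show "ennreal (exp (- ?r * s)) *
          ?P s \<le>
          ennreal (exp (- ?r * s)) * ennreal (?r * (kA i * t))"
      using t arr_pos brk_pos srv_rate_nonneg[of "f i" i] kA_nonneg[of i]
      by (simp add: G_def ennreal_mult[symmetric] ennreal_plus[symmetric] less_imp_le distrib_right del: ennreal_plus)
  qed (use t r kA_nonneg in auto)
  finally show ?thesis by simp
qed


text \<open>As for active states, except that the sojourn is cut off both by the horizon and by the end of the
repair delay.\<close>

lemma step_bound_waiting: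
  assumes IH: "\<And>x t. reachable x \<Longrightarrow> 0 \<le> t \<Longrightarrow> expected_cost n x t \<le> ennreal (\<gamma> * t + potential x)"
    and t: "0 \<le> t" and \<tau>: "0 \<le> \<tau>"
  shows "expected_cost (Suc n) (Waiting i \<tau>) t \<le> ennreal (\<gamma> * t + WW i \<tau>)"
proof -
  let ?m = "srv_rate Q (base Q) i"
  let ?r = "arr Q + ?m"
  let ?d = "queue_event Q (base Q) i"
  define z where "z = (if \<tau> \<le> t then kW i * \<tau> + qr + \<gamma> * (t - \<tau>) + WA i else kW i * t)"
  define G where "G j s = (if s < \<tau> then if s \<le> t then ennreal (kW i * s + qj + \<gamma> * (t - s) + WW j (\<tau> - s)) else ennreal (kW i * t)
      else ennreal z)" for j s
  note [measurable] = WW_measurable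
  have [measurable]: "G j \<in> borel_measurable borel" for j unfolding G_def by measurable
  have r: "0 < ?r" using arr_pos srv_rate_nonneg[of "base Q" i] by linarith
  have z: "0 \<le> z"
    unfolding z_def using t \<tau> kW_nonneg[of i] qr_nonneg \<gamma>_nonneg WA_nonneg[of i] by auto
  have step: "step_cost (Waiting i \<tau>) c t + expected_cost n (Waiting j (\<tau> - s)) (t - s) \<le> G j s"
    if "sojourn Q \<phi> (Waiting i \<tau>) c = s" "successor Q \<phi> (Waiting i \<tau>) c = Waiting j (\<tau> - s)" "0 < s" "s < \<tau>" for c j s
  proof (cases "s \<le> t")
    case True
    have "step_cost (Waiting i \<tau>) c t + expected_cost n (Waiting j (\<tau> - s)) (t - s)
      \<le> ennreal (kW i * s + qj) + ennreal (\<gamma> * (t - s) + WW j (\<tau> - s))"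
      using True that IH[of "Waiting j (\<tau> - s)" "t - s"]
      by (intro add_mono) (simp_all add: step_cost_def run_rate_def jump_cost_def)
    also have "\<dots> = G j s"
      using True that t \<gamma>_nonneg WW_nonneg[of "\<tau> - s" j] kW_nonneg[of i] qj_nonneg
      by (simp add: G_def ennreal_plus[symmetric] add_ac del: ennreal_plus)
    finally show ?thesis .
  next
    case False
    then show ?thesis
      using that by (simp add: G_def step_cost_def run_rate_def expected_cost_neg)
  qed
  have "expected_cost (Suc n) (Waiting i \<tau>) t \<le>
    (\<integral>\<^sup>+(a, v, b). (if a \<le> ?d a v then G (Suc i) a else G (i - 1) (v / srv Q (base Q))) \<partial>clock_law Q)"
    unfolding expected_cost_Suc[OF t]
  proof (rule nn_integral_mono_AE, use AE_clock_pos in eventually_elim)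
    fix c :: clocks
    obtain a v b where c: "c = (a, v, b)" by (cases c)
    assume "positive_clocks c"
    then have pos: "0 < a" "0 < v" "0 < b" by (auto simp: c)
    have v': "0 < v / srv Q (base Q)" using pos srv_pos[of "base Q"] by simp
    have ev: "?d a v = (if a \<le> ?d a v then a else v / srv Q (base Q))"
      by (auto simp: queue_event_def min_def)
    show "step_cost (Waiting i \<tau>) c t + expected_cost n (successor Q \<phi> (Waiting i \<tau>) c) (t - sojourn Q \<phi> (Waiting i \<tau>) c)
      \<le> (case c of (a, v, b) \<Rightarrow> (if a \<le> ?d a v then G (Suc i) a else G (i - 1) (v / srv Q (base Q))))"
    proof (cases "\<tau> \<le> ?d a v")
      case rep: True
      have "step_cost (Waiting i \<tau>) c t + expected_cost n (Active i) (t - \<tau>) \<le> ennreal z"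
      proof (cases "\<tau> \<le> t")
        case True
        have "step_cost (Waiting i \<tau>) c t + expected_cost n (Active i) (t - \<tau>)
          \<le> ennreal (kW i * \<tau> + qr) + ennreal (\<gamma> * (t - \<tau>) + WA i)"
          using True IH[of "Active i" "t - \<tau>"] rep
          by (intro add_mono) (simp_all add: step_cost_def run_rate_def jump_cost_def c Let_def)
        also have "\<dots> = ennreal z"
          using True \<tau> \<gamma>_nonneg WA_nonneg[of i] kW_nonneg[of i] qr_nonneg
          by (simp add: z_def ennreal_plus[symmetric] add_ac del: ennreal_plus)
        finally show ?thesis .
      next
        case False
        then show ?thesis
          using rep by (simp add: z_def step_cost_def run_rate_def expected_cost_neg c)
      qed
      moreover have "successor Q \<phi> (Waiting i \<tau>) c = Active i" "sojourn Q \<phi> (Waiting i \<tau>) c = \<tau>"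
        using rep by (simp_all add: c Let_def)
      moreover have "(if a \<le> ?d a v then G (Suc i) a else G (i - 1) (v / srv Q (base Q))) = ennreal z"
        using rep ev by (auto simp: G_def split: if_splits)
      ultimately show ?thesis by (simp add: c del: successor.simps sojourn.simps)
    next
      case nrep: False
      show ?thesis
      proof (cases "a \<le> ?d a v")
        case True
        then have "?d a v = a" using ev by simp
        then show ?thesis
          using step[of c a "Suc i"] pos nrep by (simp add: c Let_def)
      next
        case False
        then have "?d a v = v / srv Q (base Q)" using ev by simp
        then show ?thesis
          using step[of c "v / srv Q (base Q)" "i - 1"] False pos nrep v' by (simp add: c Let_def)
      qed
    qed
  qed
  also have "\<dots> = (\<integral>\<^sup>+s\<in>{0..}. ennreal (exp (- ?r * s)) *
      (ennreal (arr Q) * G (Suc i) s + ennreal ?m * G (i - 1) s) \<partial>lborel)"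
    by (rule queue_race) measurable
  also have "\<dots> \<le> ennreal (exp (- ?r * 0) * (kW i * 0 + \<gamma> * (t - 0) + WW i (\<tau> - 0)))"
  proof (rule killed_integral_bound[where m = "min \<tau> t" and r = ?r and z = z
        and F = "\<lambda>s. exp (- ?r * s) * (kW i * s + \<gamma> * (t - s) + WW i (\<tau> - s))"
        and F' = "\<lambda>s. - (exp (- ?r * s) * (?r * (kW i * s + \<gamma> * (t - s) + WW i (\<tau> - s)) + \<gamma> - kW i + WW' i (\<tau> - s)))"])
    show "exp (- ?r * min \<tau> t) * z \<le>
      exp (- ?r * min \<tau> t) * (kW i * min \<tau> t + \<gamma> * (t - min \<tau> t) + WW i (\<tau> - min \<tau> t))"
      using repair[of i] WW_nonneg[of "\<tau> - t" i] by (intro mult_left_mono) (auto simp: z_def min_def)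
    fix s :: real
    assume s: "0 \<le> s"
    let ?g = "\<lambda>j. kW i * s + qj + \<gamma> * (t - s) + WW j (\<tau> - s)"
    let ?R = "?r * (kW i * s + \<gamma> * (t - s) + WW i (\<tau> - s)) + \<gamma> - kW i + WW' i (\<tau> - s)"
    have pos: "0 \<le> ?g j" if "s \<le> min \<tau> t" for j
      using that s kW_nonneg[of i] qj_nonneg \<gamma>_nonneg
      by (intro add_nonneg_nonneg mult_nonneg_nonneg WW_nonneg) auto
    have 1: "arr Q * ?g (Suc i) + ?m * ?g (i - 1) \<le> ?R" if "s \<le> min \<tau> t"
      using waiting[of "\<tau> - s" i] that by (simp add: algebra_simps)
    show "- (exp (- ?r * s) * ?R) \<le> 0" if "s \<le> min \<tau> t"
    proof -
      have "0 \<le> arr Q * ?g (Suc i) + ?m * ?g (i - 1)"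
        using arr_pos srv_rate_nonneg that
        by (intro add_nonneg_nonneg mult_nonneg_nonneg pos) auto
      then show ?thesis using 1[OF that] by simp
    qed
    show "ennreal (exp (- ?r * s)) * (ennreal (arr Q) * G (Suc i) s + ennreal ?m * G (i - 1) s)
          \<le> ennreal (- (- (exp (- ?r * s) * ?R)))" if "s < min \<tau> t"
    proof -
      have "ennreal (exp (- ?r * s)) * (ennreal (arr Q) * G (Suc i) s + ennreal ?m * G (i - 1) s) =
        ennreal (exp (- ?r * s) * (arr Q * ?g (Suc i) + ?m * ?g (i - 1)))"
        using that arr_pos srv_rate_nonneg[of "base Q" i]
        by (simp add: G_def ennreal_mult[symmetric] ennreal_plus[symmetric] pos less_imp_le del: ennreal_plus)
      also have "\<dots> \<le> ennreal (exp (- ?r * s) * ?R)"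
        using 1 that by (intro ennreal_leI mult_left_mono) auto
      finally show ?thesis by simp
    qed
    show "((\<lambda>s. exp (- ?r * s) * (kW i * s + \<gamma> * (t - s) + WW i (\<tau> - s))) has_real_derivative
         - (exp (- ?r * s) * ?R)) (at s within {0..min \<tau> t})" if "s \<le> min \<tau> t"
    proof -
      have D: "((\<lambda>s. WW i (\<tau> - s)) has_real_derivative WW' i (\<tau> - s) * (-1)) (at s within {0..min \<tau> t})"
      proof -
        have "(WW i has_real_derivative WW' i (\<tau> - s)) (at (\<tau> - s) within (\<lambda>s. \<tau> - s) ` {0..min \<tau> t})"
          using that by (intro has_field_derivative_subset[OF WW_deriv]) auto
        moreover have "((\<lambda>s. \<tau> - s) has_real_derivative -1) (at s within {0..min \<tau> t})"
          by (auto intro!: derivative_eq_intros)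
        ultimately show ?thesis
          unfolding o_def[symmetric, of "WW i" "\<lambda>s. \<tau> - s"] by (rule DERIV_image_chain)
      qed
      show ?thesis
        by (auto intro!: derivative_eq_intros D simp: algebra_simps)
    qed
  next
    fix s :: real assume "min \<tau> t < s"
    then have "G j s = ennreal z" for j
      by (auto simp: G_def z_def)
    then show "ennreal (exp (- ?r * s)) * (ennreal (arr Q) * G (Suc i) s + ennreal ?m * G (i - 1) s) \<le>
          ennreal (exp (- ?r * s)) * ennreal (?r * z)"
      using z arr_pos srv_rate_nonneg[of "base Q" i]
      by (simp add: ennreal_mult[symmetric] ennreal_plus[symmetric] less_imp_le distrib_right del: ennreal_plus)
  qed (use t \<tau> r z in auto)
  finally show ?thesis by simp
qed

theorem expected_cost_le:
  "reachable x \<Longrightarrow> 0 \<le> t \<Longrightarrow> expected_cost n x t \<le> ennreal (\<gamma> * t + potential x)"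
proof (induction n arbitrary: x t)
  case 0
  then show ?case by (simp add: expected_cost_def)
next
  case (Suc n)
  then show ?case
    using step_bound_active[OF Suc.IH] step_bound_waiting[OF Suc.IH] by (cases x) auto
qed

end

section \<open>From transitions to continuous time\<close>

context controlled_queue begin

lemma expected_total_cost:
  "(\<integral>\<^sup>+\<omega>. (\<Sum>m. leg_cost m s t \<omega>) \<partial>clock_space Q) = (SUP n. expected_cost n s t)"
proof -
  have "(\<integral>\<^sup>+\<omega>. (\<Sum>m. leg_cost m s t \<omega>) \<partial>clock_space Q) = (\<integral>\<^sup>+\<omega>. (SUP n. \<Sum>m<n. leg_cost m s t \<omega>) \<partial>clock_space Q)"
    by (simp add: suminf_eq_SUP)
  also have "\<dots> = (SUP n. expected_cost n s t)"
    unfolding expected_cost_def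
    by (intro nn_integral_monotone_convergence_SUP) (auto intro!: incseq_SucI le_funI)
  finally show ?thesis .
qed

lemma AE_clocks_pos:
  "AE \<omega> in clock_space Q. \<forall>n. positive_clocks (\<omega> !! n)"
proof -
  interpret C: prob_space "clock_law Q" by (rule prob_space_clock)
  have eq: "positive_clocks = (\<lambda>c. 0 < fst c \<and> 0 < fst (snd c) \<and> 0 < snd (snd c))"
    by (auto simp: fun_eq_iff)
  have [measurable]: "Measurable.pred (clock_law Q) positive_clocks"
    unfolding eq by measurable
  have "AE \<omega> in stream_space (clock_law Q). stream_all positive_clocks \<omega>"
    by (rule C.AE_stream_all[OF _ AE_clock_pos]) measurable
  then show ?thesis
    unfolding clock_space_def by (simp add: sset_range)
qed

lemma queue_event_pos: "0 < a \<Longrightarrow> 0 < v \<Longrightarrow> 0 < queue_event Q u i a v"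
  using srv_pos[of u] by (simp add: queue_event_def)

lemma reachable_successor:
  "reachable x \<Longrightarrow> reachable (successor Q \<phi> x c)"
  by (cases c; cases x) (auto simp: Let_def d_nonneg)

lemma sojourn_nonneg:
  "reachable x \<Longrightarrow> positive_clocks c \<Longrightarrow> 0 \<le> sojourn Q \<phi> x c"
  by (cases x; cases c) (auto simp: min_def less_imp_le queue_event_pos)

lemma reachable_jump: "reachable s \<Longrightarrow> reachable (entered s \<omega> n)"
  by (induction n) (simp_all add: split_beta reachable_successor)

lemma jump_time_Suc:
  "epoch s \<omega> (Suc n) = epoch s \<omega> n + sojourn Q \<phi> (entered s \<omega> n) (\<omega> !! n)"
  by (simp add: split_beta)

lemma jump_state_Suc:
  "entered s \<omega> (Suc n) = successor Q \<phi> (entered s \<omega> n) (\<omega> !! n)"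
  by (simp add: split_beta)

declare jump.simps(2) [simp del]

lemma jump_time_mono:
  assumes "reachable s" "\<forall>n. positive_clocks (\<omega> !! n)"
  shows "mono (\<lambda>n. epoch s \<omega> n)"
  unfolding mono_iff_le_Suc jump_time_Suc
  using sojourn_nonneg[OF reachable_jump[OF assms(1)]] assms(2) by simp

lemma run_rate_nonneg: "0 \<le> run_rate x"
  by (cases x) (auto simp: run_rate_def kA_nonneg kW_nonneg)

lemma jump_cost_nonneg: "0 \<le> jump_cost x y"
  by (simp add: jump_cost_def qj_nonneg qr_nonneg)

text \<open>On paths with nonnegative sojourns a leg costs its rate times the part of it before the horizon,
written so that the lengths telescope.\<close>

lemma leg_cost_eq:
  assumes "mono (\<lambda>n. epoch s \<omega> n)"
  shows "leg_cost n s t \<omega> = (if epoch s \<omega> n \<le> t then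
      ennreal (run_rate (entered s \<omega> n) * (min t (epoch s \<omega> (Suc n)) - epoch s \<omega> n))
      + (if epoch s \<omega> (Suc n) \<le> t
         then ennreal (jump_cost (entered s \<omega> n) (entered s \<omega> (Suc n))) else 0)
      else 0)"
proof -
  have guard: "(\<forall>j\<le>n. epoch s \<omega> j \<le> t) \<longleftrightarrow> epoch s \<omega> n \<le> t"
    using monoD[OF assms] by (meson order_refl order_trans)
  have soj: "0 \<le> sojourn Q \<phi> (entered s \<omega> n) (\<omega> !! n)"
    using monoD[OF assms, of n "Suc n"] unfolding jump_time_Suc by simp
  show ?thesis
    unfolding leg_cost_def guard
    by (rule if_cong)
       (auto simp: step_cost_def jump_time_Suc jump_state_Suc min_def ennreal_plus run_rate_nonneg jump_cost_nonneg soj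
          simp del: jump.simps)
qed

lemma state_at_between:
  assumes T0: "0 \<le> u" and n: "u < epoch s \<omega> n"
  obtains m where "epoch s \<omega> m \<le> u" "u < epoch s \<omega> (Suc m)"
    "state_at Q \<phi> s u \<omega> = flow (entered s \<omega> m) (u - epoch s \<omega> m)"
proof
  let ?P = "\<lambda>n. u < epoch s \<omega> (Suc n)"
  let ?m = "LEAST n. ?P n"
  obtain n' where "n = Suc n'" using assms by (cases n) auto
  with n have "?P n'" by (simp del: jump.simps)
  then show "?P ?m" by (rule LeastI)
  show "epoch s \<omega> ?m \<le> u"
  proof (cases ?m)
    case 0
    then show ?thesis using T0 by simp
  next
    case (Suc k)
    then have "\<not> ?P k" using not_less_Least[of k ?P] by simp
    then show ?thesis unfolding Suc by (simp add: not_less del: jump.simps)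
  qed
  show "state_at Q \<phi> s u \<omega> = flow (entered s \<omega> ?m) (u - epoch s \<omega> ?m)"
    by (simp only: state_at_def Let_def)
qed

lemma cost_rate_flow [simp]: "cost_rate Q \<phi> (flow x u) = cost_rate Q \<phi> x"
  by (cases x) auto

text \<open>Each time before the horizon lies in exactly one sojourn, during which the cost rate is constant.\<close>

lemma running_cost_le:
  assumes mono: "mono (\<lambda>n. epoch s \<omega> n)" and n: "t < epoch s \<omega> N"
    and nonneg: "\<And>x. 0 \<le> cost_rate Q \<phi> x"
  shows "(\<integral>\<^sup>+u\<in>{0..t}. ennreal (cost_rate Q \<phi> (state_at Q \<phi> s u \<omega>)) \<partial>lborel) \<le>
    (\<Sum>n. ennreal (cost_rate Q \<phi> (entered s \<omega> n) *
       (min t (epoch s \<omega> (Suc n)) - min t (epoch s \<omega> n))))"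
proof -
  let ?T = "\<lambda>n. epoch s \<omega> n"
  let ?c = "\<lambda>n. ennreal (cost_rate Q \<phi> (entered s \<omega> n))"
  have "(\<integral>\<^sup>+u\<in>{0..t}. ennreal (cost_rate Q \<phi> (state_at Q \<phi> s u \<omega>)) \<partial>lborel) \<le>
    (\<integral>\<^sup>+u. (\<Sum>n. ?c n * indicator ({?T n..<?T (Suc n)} \<inter> {0..t}) u) \<partial>lborel)"
  proof (rule nn_integral_mono)
    fix u
    show "ennreal (cost_rate Q \<phi> (state_at Q \<phi> s u \<omega>)) * indicator {0..t} u \<le>
      (\<Sum>n. ?c n * indicator ({?T n..<?T (Suc n)} \<inter> {0..t}) u)"
    proof (cases "u \<in> {0..t}")
      case True
      then have "0 \<le> u" "u < ?T N" using n by auto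
      then obtain m where m: "?T m \<le> u" "u < ?T (Suc m)"
        "state_at Q \<phi> s u \<omega> = flow (entered s \<omega> m) (u - ?T m)"
        by (rule state_at_between)
      have "ennreal (cost_rate Q \<phi> (state_at Q \<phi> s u \<omega>)) * indicator {0..t} u =
        (\<Sum>n\<in>{m}. ?c n * indicator ({?T n..<?T (Suc n)} \<inter> {0..t}) u)"
        using True m by (simp del: jump.simps)
      also have "\<dots> \<le> (\<Sum>n. ?c n * indicator ({?T n..<?T (Suc n)} \<inter> {0..t}) u)"
        by (rule sum_le_suminf) auto
      finally show ?thesis .
    qed simp
  qed
  also have "\<dots> = (\<Sum>n. \<integral>\<^sup>+u. ?c n * indicator ({?T n..<?T (Suc n)} \<inter> {0..t}) u \<partial>lborel)"
    by (rule nn_integral_suminf) measurable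
  also have "\<dots> \<le> (\<Sum>n. ennreal (cost_rate Q \<phi> (entered s \<omega> n) * (min t (?T (Suc n)) - min t (?T n))))"
  proof (intro suminf_le summableI allI)
    fix n
    have le: "?T n \<le> ?T (Suc n)" using monoD[OF mono, of n "Suc n"] by simp
    have "(\<integral>\<^sup>+u. ?c n * indicator ({?T n..<?T (Suc n)} \<inter> {0..t}) u \<partial>lborel) =
       ?c n * emeasure lborel ({?T n..<?T (Suc n)} \<inter> {0..t})"
      by (subst nn_integral_cmult_indicator) auto
    also have "\<dots> \<le> ?c n * ennreal (min t (?T (Suc n)) - min t (?T n))"
    proof (intro mult_left_mono)
      have "emeasure lborel ({?T n..<?T (Suc n)} \<inter> {0..t}) \<le> ennreal (min t (?T (Suc n)) - min t (?T n))"
      proof (cases "?T n \<le> t")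
        case True
        have "emeasure lborel ({?T n..<?T (Suc n)} \<inter> {0..t}) \<le> emeasure lborel {?T n..min t (?T (Suc n))}"
          by (rule emeasure_mono) (auto simp del: jump.simps)
        also have "\<dots> = ennreal (min t (?T (Suc n)) - min t (?T n))"
          using True le by (simp add: emeasure_lborel_Icc_eq del: jump.simps)
        finally show ?thesis .
      next
        case False
        then have "{?T n..<?T (Suc n)} \<inter> {0..t} = {}" by auto
        then show ?thesis by simp
      qed
      then show "emeasure lborel ({?T n..<?T (Suc n)} \<inter> {0..t}) \<le> ennreal (min t (?T (Suc n)) - min t (?T n))" .
    qed simp
    also have "\<dots> = ennreal (cost_rate Q \<phi> (entered s \<omega> n) * (min t (?T (Suc n)) - min t (?T n)))"
      using le by (intro ennreal_mult[symmetric] nonneg) (auto simp del: jump.simps)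
    finally show "(\<integral>\<^sup>+u. ?c n * indicator ({?T n..<?T (Suc n)} \<inter> {0..t}) u \<partial>lborel) \<le> \<dots>" .
  qed
  finally show ?thesis .
qed

end

context supersolution begin

lemma total_cost_le:
  assumes "reachable s" "0 \<le> t"
  shows "(\<integral>\<^sup>+\<omega>. (\<Sum>m. leg_cost m s t \<omega>) \<partial>clock_space Q) \<le> ennreal (\<gamma> * t + potential s)"
  unfolding expected_total_cost using expected_cost_le[OF assms] by (intro SUP_least)

end

text \<open>The transition rates out of a state are at most \<open>1\<close> by the normalisation, and the
potential of a waiting state pays in advance for the repair, which may follow at once.\<close>

lemma (in vacation_queue) counting_supersolution:
  assumes "\<And>i. 0 \<le> d i"
  shows "supersolution Q f d (\<lambda>_. 0) (\<lambda>_. 0) 1 1 (\<lambda>_. 1) (\<lambda>_ _. 2) (\<lambda>_ _. 0) 3"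
proof unfold_locales
  have brk: "srv_rate Q u i \<le> 1 - arr Q - brk Q" "0 \<le> srv_rate Q u i" for u i
    using normalised slow_pos slow_less_fast arr_pos brk_pos by (cases u; simp add: srv_rate_def)+
  fix i t
  show "0 + arr Q * (1 + 1) + srv_rate Q (f i) i * (1 + 1) + brk Q * (1 + 2)
        \<le> 3 + (arr Q + srv_rate Q (f i) i + brk Q) * (1::real)"
    using brk[of "f i" i] arr_pos brk_pos by argo
  show "0 + arr Q * (1 + 2) + srv_rate Q (base Q) i * (1 + 2) \<le> 3 + (arr Q + srv_rate Q (base Q) i) * 2 + (0::real)"
    using brk[of "base Q" i] arr_pos brk_pos by argo
qed (use assms in auto)

text \<open>The expected number of transitions up to time \<open>t\<close> is finite, so almost surely there are only finitely
many.\<close>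

lemma (in vacation_queue) AE_no_explosion:
  assumes d: "\<And>i. 0 \<le> d i"
  shows "AE \<omega> in clock_space Q. \<exists>n. t < fst (jump Q (f, \<lambda>i. ennreal (d i)) (Active j) \<omega> n)"
proof (cases "0 \<le> t")
  case True
  interpret supersolution Q f d "\<lambda>_. 0" "\<lambda>_. 0" 1 1 "\<lambda>_. 1" "\<lambda>_ _. 2" "\<lambda>_ _. 0" 3
    by (rule counting_supersolution[OF d])
  let ?T = "\<lambda>\<omega> n. epoch (Active j) \<omega> n"
  have "(\<integral>\<^sup>+\<omega>. (\<Sum>m. leg_cost m (Active j) t \<omega>) \<partial>clock_space Q) \<noteq> \<infinity>"
    using total_cost_le[of "Active j" t] True by (auto simp: top_unique)
  then have "AE \<omega> in clock_space Q. (\<Sum>m. leg_cost m (Active j) t \<omega>) \<noteq> \<infinity>"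
    by (intro nn_integral_PInf_AE) auto
  then show ?thesis
    using AE_clocks_pos
  proof eventually_elim
    fix \<omega> assume fin: "(\<Sum>m. leg_cost m (Active j) t \<omega>) \<noteq> \<infinity>"
      and pos: "\<forall>n. positive_clocks (\<omega> !! n)"
    have mono: "mono (?T \<omega>)"
      by (rule jump_time_mono[OF _ pos]) simp
    show "\<exists>n. t < ?T \<omega> n"
    proof (rule ccontr)
      assume "\<not> ?thesis"
      then have "leg_cost n (Active j) t \<omega> = 1" for n
        unfolding leg_cost_eq[OF mono] by (auto simp: not_less run_rate_def jump_cost_def simp del: jump.simps split: state.splits)
      then have "(\<Sum>m. leg_cost m (Active j) t \<omega>) = (\<Sum>m::nat. (1::ennreal))" by simp
      also have "\<dots> = \<infinity>"
        by (simp add: suminf_eq_SUP ennreal_SUP_of_nat_eq_top)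
      finally show False using fin by simp
    qed
  qed
next
  case False
  then show ?thesis by (intro AE_I2 exI[of _ 0]) simp
qed


lemma (in vacation_queue) srv_cost_nonneg: "0 \<le> srv_cost Q u"
  using slow_free fast_cost_pos by (cases u) auto

lemma (in vacation_queue) cost_rate_nonneg: "0 \<le> cost_rate Q \<phi> x"
  by (cases x) (simp_all add: srv_cost_nonneg hcost_nonneg)

lemma measurable_cost_rate:
  assumes "E \<in> N \<rightarrow>\<^sub>M state_codes"
  shows "(\<lambda>x. cost_rate Q \<phi> (dec (E x))) \<in> borel_measurable N"
proof (rule measurable_by_state_kind[OF assms])
  fix n i
  show "(\<lambda>x. cost_rate Q \<phi> (dec (n, i, snd (snd (E x))))) \<in> borel_measurable N"
    by (cases "n = 0"; cases "n = 1"; cases "n = 2"; simp)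
qed

text \<open>The cost rates are shifted by \<open>M\<close>, which adds exactly \<open>M * t\<close> to the total. The shift permits a
rate \<open>\<gamma> - M\<close> of the average cost without knowing its sign, while all integrals stay nonnegative.\<close>

lemma (in vacation_queue) total_cost_supersolution:
  assumes "supersolution Q f d (\<lambda>i. srv_cost Q (f i) + hcost Q i + M) (\<lambda>i. srv_cost Q (base Q) + hcost Q i + M)
     0 (rep_cost Q) WA WW WW' \<gamma>"
    and M: "0 \<le> M" and t: "0 \<le> t"
  shows "total_cost Q (f, \<lambda>i. ennreal (d i)) (Active j) t + ennreal (M * t) \<le> ennreal (\<gamma> * t + WA j)"
proof -
  interpret supersolution Q f d "\<lambda>i. srv_cost Q (f i) + hcost Q i + M" "\<lambda>i. srv_cost Q (base Q) + hcost Q i + M"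
     0 "rep_cost Q" WA WW WW' \<gamma> by fact
  interpret C: prob_space "clock_law Q" by (rule prob_space_clock)
  interpret S: prob_space "clock_space Q"
    unfolding clock_space_def by (rule C.prob_space_stream_space)
  let ?T = "\<lambda>\<omega> n. epoch (Active j) \<omega> n" and ?X = "\<lambda>\<omega> n. entered (Active j) \<omega> n"
  let ?len = "\<lambda>\<omega> n. min t (?T \<omega> (Suc n)) - min t (?T \<omega> n)"
  define A where "A \<omega> = (\<Sum>n. ennreal (cost_rate Q \<phi> (?X \<omega> n) * ?len \<omega> n))" for \<omega>
  let ?rep = "\<lambda>\<omega> n. is_Waiting (?X \<omega> n) \<and> is_Active (?X \<omega> (Suc n)) \<and> ?T \<omega> (Suc n) \<le> t"
  have N: "num_repairs Q \<phi> (Active j) t = (\<lambda>\<omega>. \<Sum>n. if ?rep \<omega> n then 1 else 0)"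
    unfolding num_repairs_def by (rule refl)
  note [measurable] = measurable_jump(1)
  have [measurable]: "A \<in> borel_measurable (clock_space Q)"
  proof -
    have [measurable]: "(\<lambda>\<omega>. cost_rate Q \<phi> (?X \<omega> n)) \<in> borel_measurable (clock_space Q)" for n
      using measurable_cost_rate[OF measurable_jump(2)[of Q \<phi> "Active j" n], of Q \<phi>] by simp
    show ?thesis unfolding A_def by measurable
  qed
  have [measurable]: "num_repairs Q \<phi> (Active j) t \<in> borel_measurable (clock_space Q)"
  proof -
    note [measurable] = measurable_jump(2)
    have "is_Waiting x \<longleftrightarrow> fst (enc x) = 2" "is_Active x \<longleftrightarrow> fst (enc x) = 0" for x
      by (cases x; simp)+
    then show ?thesis unfolding N by (simp del: jump.simps)
  qed
  have "total_cost Q \<phi> (Active j) t + ennreal (M * t) \<le>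
    (\<integral>\<^sup>+\<omega>. A \<omega> \<partial>clock_space Q) + ennreal (rep_cost Q) * (\<integral>\<^sup>+\<omega>. num_repairs Q \<phi> (Active j) t \<omega> \<partial>clock_space Q)
      + ennreal (M * t)"
    unfolding total_cost_def
  proof (intro add_mono order_refl nn_integral_mono_AE, use AE_clocks_pos AE_no_explosion[where d = d and f = f and t = t and j = j, OF d_nonneg] in eventually_elim)
    fix \<omega> assume "\<forall>n. positive_clocks (\<omega> !! n)" and "\<exists>n. t < ?T \<omega> n"
    then show "(\<integral>\<^sup>+u\<in>{0..t}. ennreal (cost_rate Q \<phi> (state_at Q \<phi> (Active j) u \<omega>)) \<partial>lborel) \<le> A \<omega>"
      unfolding A_def by (elim exE, intro running_cost_le jump_time_mono cost_rate_nonneg) auto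
  qed
  also have "\<dots> = (\<integral>\<^sup>+\<omega>. A \<omega> + ennreal (rep_cost Q) * num_repairs Q \<phi> (Active j) t \<omega> + ennreal (M * t) \<partial>clock_space Q)"
    by (simp add: nn_integral_add nn_integral_cmult S.emeasure_space_1)
  also have "\<dots> \<le> (\<integral>\<^sup>+\<omega>. (\<Sum>m. leg_cost m (Active j) t \<omega>) \<partial>clock_space Q)"
  proof (intro nn_integral_mono_AE, use AE_clocks_pos AE_no_explosion[where d = d and f = f and t = t and j = j, OF d_nonneg] in eventually_elim)
    fix \<omega> assume pos: "\<forall>n. positive_clocks (\<omega> !! n)" and "\<exists>n. t < ?T \<omega> n"
    then obtain n where n: "t < ?T \<omega> n" by auto
    have mono: "mono (?T \<omega>)"
      by (rule jump_time_mono[OF _ pos]) simp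
    have len: "0 \<le> ?len \<omega> m" for m
      using monoD[OF mono, of m "Suc m"] by (auto simp del: jump.simps)
    have "ennreal (M * t) = ennreal (\<Sum>m<n. M * ?len \<omega> m)"
      using n t sum_lessThan_telescope[of "\<lambda>m. min t (?T \<omega> m)" n]
      by (simp add: sum_distrib_left[symmetric])
    also have "\<dots> = (\<Sum>m<n. ennreal (M * ?len \<omega> m))"
      using len M by (subst sum_ennreal) (auto simp del: jump.simps)
    also have "\<dots> \<le> (\<Sum>m. ennreal (M * ?len \<omega> m))"
      by (rule sum_le_suminf) auto
    finally have "A \<omega> + ennreal (rep_cost Q) * num_repairs Q \<phi> (Active j) t \<omega> + ennreal (M * t) \<le>
      A \<omega> + ennreal (rep_cost Q) * num_repairs Q \<phi> (Active j) t \<omega> + (\<Sum>m. ennreal (M * ?len \<omega> m))"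
      by (intro add_mono order_refl)
    also have "\<dots> = (\<Sum>m. ennreal (cost_rate Q \<phi> (?X \<omega> m) * ?len \<omega> m)
        + ennreal (rep_cost Q) * (if ?rep \<omega> m then 1 else 0) + ennreal (M * ?len \<omega> m))"
      unfolding A_def N by (simp only: suminf_add[OF summableI summableI] ennreal_suminf_cmult[symmetric])
    also have "\<dots> = (\<Sum>m. leg_cost m (Active j) t \<omega>)"
    proof (intro suminf_cong)
      fix m
      have ok: "reachable (?X \<omega> m)" by (rule reachable_jump) simp
      then have rate: "run_rate (?X \<omega> m) = cost_rate Q \<phi> (?X \<omega> m) + M"
        by (cases "?X \<omega> m") (simp_all add: run_rate_def)
      have le: "?T \<omega> m \<le> ?T \<omega> (Suc m)" using monoD[OF mono, of m "Suc m"] by simp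
      have "ennreal (cost_rate Q \<phi> (?X \<omega> m) * ?len \<omega> m) + ennreal (M * ?len \<omega> m) =
        ennreal (run_rate (?X \<omega> m) * ?len \<omega> m)"
        unfolding rate using len[of m] M cost_rate_nonneg[of \<phi> "?X \<omega> m"]
        by (subst ennreal_plus[symmetric]) (auto simp only: distrib_right intro!: mult_nonneg_nonneg)
      then show "ennreal (cost_rate Q \<phi> (?X \<omega> m) * ?len \<omega> m)
        + ennreal (rep_cost Q) * (if ?rep \<omega> m then 1 else 0) + ennreal (M * ?len \<omega> m) = leg_cost m (Active j) t \<omega>"
        unfolding leg_cost_eq[OF mono] using le
        by (auto simp: jump_cost_def min_def add_ac simp del: jump.simps)
    qed
    finally show "A \<omega> + ennreal (rep_cost Q) * num_repairs Q \<phi> (Active j) t \<omega> + ennreal (M * t) \<le>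
      (\<Sum>m. leg_cost m (Active j) t \<omega>)" .
  qed
  also have "\<dots> \<le> ennreal (\<gamma> * t + potential (Active j))"
    by (rule total_cost_le) (simp_all add: t)
  finally show ?thesis by simp
qed

lemma (in vacation_queue) avg_cost_supersolution:
  assumes sup: "supersolution Q f d (\<lambda>i. srv_cost Q (f i) + hcost Q i + M) (\<lambda>i. srv_cost Q (base Q) + hcost Q i + M)
     0 (rep_cost Q) WA WW WW' \<gamma>"
    and M: "0 \<le> M"
  shows "avg_cost Q (f, \<lambda>i. ennreal (d i)) (Active j) \<le> ereal (\<gamma> - M)"
proof -
  let ?\<phi> = "(f, \<lambda>i. ennreal (d i))"
  have le: "enn2ereal (total_cost Q ?\<phi> (Active j) t) / ereal t \<le> ereal (\<gamma> - M + WA j / t)" if t: "0 < t" for t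
  proof -
    have *: "total_cost Q ?\<phi> (Active j) t + ennreal (M * t) \<le> ennreal (\<gamma> * t + WA j)"
      using t by (intro total_cost_supersolution[OF sup M]) auto
    then have "total_cost Q ?\<phi> (Active j) t \<noteq> \<infinity>"
      by (auto simp: top_unique)
    then obtain x where x: "0 \<le> x" "total_cost Q ?\<phi> (Active j) t = ennreal x"
      by (cases "total_cost Q ?\<phi> (Active j) t" rule: ennreal_cases) auto
    have "ennreal (x + M * t) \<le> ennreal (\<gamma> * t + WA j)"
      using * x M t by (simp add: ennreal_plus)
    moreover have "0 \<le> \<gamma> * t + WA j"
      using t supersolution.\<gamma>_nonneg[OF sup] supersolution.WA_nonneg[OF sup, of j] by auto
    ultimately have "x + M * t \<le> \<gamma> * t + WA j" by simp
    then have "x / t \<le> \<gamma> - M + WA j / t"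
      using t by (simp add: field_simps)
    then show ?thesis using x t by (simp add: enn2ereal_ennreal)
  qed
  have "avg_cost Q ?\<phi> (Active j) \<le> Limsup at_top (\<lambda>t. ereal (\<gamma> - M + WA j / t))"
    unfolding avg_cost_def using le
    by (intro Limsup_mono eventually_mono[OF eventually_gt_at_top[of 0]]) auto
  also have "\<dots> = ereal (\<gamma> - M)"
  proof (rule lim_imp_Limsup)
    have "((\<lambda>t. \<gamma> - M + WA j / t) \<longlongrightarrow> \<gamma> - M) at_top" by real_asymp
    then show "((\<lambda>t. ereal (\<gamma> - M + WA j / t)) \<longlongrightarrow> ereal (\<gamma> - M)) at_top" by simp
  qed simp
  finally show ?thesis .
qed

section \<open>Relaxation of the M/M/1 queue\<close>

text \<open>The mean of \<open>a\<close> at a Poisson variable with parameter \<open>x\<close>, up to the factor \<open>exp (- x)\<close>.\<close>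

definition poisson_sum :: "(nat \<Rightarrow> real) \<Rightarrow> real \<Rightarrow> real"
  where "poisson_sum a x = (\<Sum>n. a n / fact n * x ^ n)"

lemma summable_poisson:
  fixes a :: "nat \<Rightarrow> real"
  assumes "\<And>n. \<bar>a n\<bar> \<le> K"
  shows "summable (\<lambda>n. a n / fact n * x ^ n)"
proof (rule summable_comparison_test')
  show "summable (\<lambda>n. K * (\<bar>x\<bar> ^ n / fact n))"
    using summable_exp[of "\<bar>x\<bar>"] by (intro summable_mult) (simp add: field_simps)
  fix n :: nat
  have "\<bar>a n\<bar> * (\<bar>x\<bar> ^ n / fact n) \<le> K * (\<bar>x\<bar> ^ n / fact n)"
    by (rule mult_right_mono) (use assms in auto)
  then show "norm (a n / fact n * x ^ n) \<le> K * (\<bar>x\<bar> ^ n / fact n)"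
    by (simp add: abs_mult power_abs)
qed

lemma poisson_sum_mono:
  assumes "\<And>n. \<bar>a n\<bar> \<le> K" "\<And>n. \<bar>b n\<bar> \<le> L" "\<And>n. a n \<le> b n" "0 \<le> x"
  shows "poisson_sum a x \<le> poisson_sum b x"
  unfolding poisson_sum_def
  by (intro suminf_le summable_poisson[OF assms(1)] summable_poisson[OF assms(2)])
     (use assms(3,4) in \<open>auto intro!: mult_right_mono divide_right_mono\<close>)

lemma poisson_sum_geometric: "poisson_sum (\<lambda>n. p + q * r ^ n) x = p * exp x + q * exp (r * x)"
proof -
  have "(\<lambda>n. p * (x ^ n /\<^sub>R fact n) + q * ((r * x) ^ n /\<^sub>R fact n)) sums (p * exp x + q * exp (r * x))"
    by (intro sums_add sums_mult exp_converges)
  then show ?thesis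
    unfolding poisson_sum_def by (intro sums_unique[symmetric]) (simp add: field_simps power_mult_distrib)
qed

lemma poisson_sum_const: "poisson_sum (\<lambda>n. p) x = p * exp x"
  using poisson_sum_geometric[of p 0 0 x] by simp

lemma poisson_sum_deriv:
  assumes "\<And>n. \<bar>a n\<bar> \<le> K"
  shows "(poisson_sum a has_real_derivative poisson_sum (\<lambda>n. a (Suc n)) x) (at x)"
proof -
  have "((\<lambda>x. \<Sum>n. (a n / fact n) * x ^ n) has_real_derivative (\<Sum>n. diffs (\<lambda>n. a n / fact n) n * x ^ n)) (at x)"
    by (rule termdiffs_strong_converges_everywhere[OF summable_poisson[OF assms]])
  moreover have "diffs (\<lambda>n. a n / fact n) n = a (Suc n) / fact n" for n
    by (simp add: diffs_def field_simps del: of_nat_Suc)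
  ultimately show ?thesis
    by (simp add: poisson_sum_def[abs_def])
qed

context vacation_queue begin

abbreviation lam :: real where "lam \<equiv> arr Q"
abbreviation mu :: real where "mu \<equiv> srv Q (base Q)"

lemma base_pos: "0 < mu" by (rule srv_pos)

lemma rho_bounds: "0 < rho Q" "rho Q < 1"
  using arr_pos base_pos stable by (auto simp: rho_def)

text \<open>The jump chain of the uniformised M/M/1 queue; with truncated subtraction, the service completions in
an empty queue leave it empty.\<close>

definition unif_step :: "(nat \<Rightarrow> real) \<Rightarrow> nat \<Rightarrow> real"
  where "unif_step u i = (lam * u (Suc i) + mu * u (i - 1)) / (lam + mu)"

definition unif :: "(nat \<Rightarrow> real) \<Rightarrow> nat \<Rightarrow> nat \<Rightarrow> real"
  where "unif \<psi> n = (unif_step ^^ n) \<psi>"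

lemma unif_0 [simp]: "unif \<psi> 0 = \<psi>"
  by (simp add: unif_def)

lemma unif_Suc: "unif \<psi> (Suc n) = unif_step (unif \<psi> n)"
  by (simp add: unif_def)

lemma unif_Suc_eq: "(lam + mu) * unif \<psi> (Suc n) i = lam * unif \<psi> n (Suc i) + mu * unif \<psi> n (i - 1)"
  using arr_pos base_pos by (simp add: unif_Suc unif_step_def)

lemma unif_bounds:
  assumes "\<And>i. 0 \<le> \<psi> i" "\<And>i. \<psi> i \<le> U"
  shows "0 \<le> unif \<psi> n i \<and> unif \<psi> n i \<le> U"
proof (induction n arbitrary: i)
  case (Suc n)
  have "lam * unif \<psi> n (Suc i) + mu * unif \<psi> n (i - 1) \<le> lam * U + mu * U"
    using Suc arr_pos base_pos by (intro add_mono mult_left_mono) auto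
  moreover have "0 \<le> lam * unif \<psi> n (Suc i) + mu * unif \<psi> n (i - 1)"
    using Suc arr_pos base_pos by simp
  ultimately show ?case
    using arr_pos base_pos by (simp add: unif_Suc unif_step_def divide_simps ring_distribs mult.commute)
qed (use assms in simp)

lemma unif_mono:
  assumes "mono \<psi>"
  shows "mono (unif \<psi> n)"
proof (induction n)
  case (Suc n)
  show ?case
    unfolding unif_Suc unif_step_def mono_def
    using arr_pos base_pos
    by (auto intro!: divide_right_mono add_mono mult_left_mono monoD[OF Suc])
qed (use assms in simp)

definition contraction :: real
  where "contraction = 2 * sqrt (lam * mu) / (lam + mu)"

definition weight :: real
  where "weight = sqrt (mu / lam)"

lemma weight_ge_1: "1 \<le> weight"
  using arr_pos stable by (simp add: weight_def)

text \<open>Away from \<open>0\<close> the weights are an eigenfunction of the uniformised step. Among the geometric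
functions this one has the least eigenvalue, so it gives the best rate of decay.\<close>

lemma weight_eigen: "lam * weight ^ Suc (Suc i) + mu * weight ^ i = (lam + mu) * contraction * weight ^ Suc i"
proof -
  have w: "weight * weight = mu / lam"
    using arr_pos base_pos by (simp add: weight_def)
  have 1: "lam * weight = sqrt (lam * mu)"
    using arr_pos base_pos w weight_ge_1
    by (intro real_sqrt_unique[symmetric]) (auto simp: power2_eq_square mult_ac)
  have 2: "mu = sqrt (lam * mu) * weight"
    using arr_pos w by (simp add: 1[symmetric] mult.assoc)
  have 3: "mu * weight ^ i = sqrt (lam * mu) * weight ^ Suc i"
    using arg_cong[OF 2, of "\<lambda>x. x * weight ^ i"] by (simp only: mult.assoc power_Suc)
  have 4: "lam * weight ^ Suc (Suc i) = sqrt (lam * mu) * weight ^ Suc i"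
    unfolding 1[symmetric] by (simp only: mult.assoc power_Suc)
  have "(lam + mu) * contraction = sqrt (lam * mu) + sqrt (lam * mu)"
    using arr_pos base_pos by (simp add: contraction_def)
  then show ?thesis
    by (simp only: 3 4 distrib_right)
qed

lemma contraction_bounds: "0 \<le> contraction" "contraction \<le> 1"
proof -
  show "0 \<le> contraction" using arr_pos base_pos by (simp add: contraction_def)
  have "sqrt (lam * mu) \<le> (lam + mu) / 2"
    using arr_pos base_pos by (intro arith_geo_mean_sqrt) auto
  then show "contraction \<le> 1" using arr_pos base_pos by (simp add: contraction_def)
qed

text \<open>The difference to the queue started empty vanishes at \<open>0\<close> and elsewhere obeys the recursion of the
uniformised step, except that the empty queue may also receive a customer; by monotonicity, this
only diminishes the difference.\<close>

lemma unif_spread: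
  assumes "mono \<psi>" "\<And>i. 0 \<le> \<psi> i" "\<And>i. \<psi> i \<le> U"
  shows "unif \<psi> n y - unif \<psi> n 0 \<le> U * contraction ^ n * weight ^ y"
proof (induction n arbitrary: y)
  case 0
  have U: "0 \<le> U" using assms(2,3)[of 0] by simp
  have "\<psi> y - \<psi> 0 \<le> U * 1" using assms(2)[of 0] assms(3)[of y] by simp
  also have "\<dots> \<le> U * weight ^ y" using U weight_ge_1 by (intro mult_left_mono one_le_power) auto
  finally show ?case by simp
next
  case (Suc n)
  have U: "0 \<le> U" using assms(2,3)[of 0] by simp
  have c: "0 \<le> contraction" by (rule contraction_bounds)
  show ?case
  proof (cases y)
    case 0
    then show ?thesis using U c by simp
  next
    case (Suc i)
    have *: "0 < lam + mu" using arr_pos base_pos by simp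
    have "(lam + mu) * (unif \<psi> (Suc n) y - unif \<psi> (Suc n) 0) =
        lam * (unif \<psi> n (Suc (Suc i)) - unif \<psi> n 1) + mu * (unif \<psi> n i - unif \<psi> n 0)"
      using unif_Suc_eq[of \<psi> n y] unif_Suc_eq[of \<psi> n 0] by (simp add: Suc algebra_simps)
    also have "\<dots> \<le> lam * (unif \<psi> n (Suc (Suc i)) - unif \<psi> n 0) + mu * (unif \<psi> n i - unif \<psi> n 0)"
      using monoD[OF unif_mono[OF assms(1)], of 0 1 n] arr_pos base_pos by (intro add_mono mult_left_mono) auto
    also have "\<dots> \<le> lam * (U * contraction ^ n * weight ^ Suc (Suc i)) + mu * (U * contraction ^ n * weight ^ i)"
      using arr_pos base_pos by (intro add_mono mult_left_mono Suc.IH) auto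
    also have "\<dots> = U * contraction ^ n * (lam * weight ^ Suc (Suc i) + mu * weight ^ i)"
      by (simp add: algebra_simps)
    also have "\<dots> = (lam + mu) * (U * contraction ^ Suc n * weight ^ y)"
      unfolding weight_eigen by (simp add: Suc algebra_simps)
    finally show ?thesis using * by (simp only: mult_le_cancel_left_pos)
  qed
qed

lemma stat_dist_nonneg: "0 \<le> stat_dist Q i"
  using rho_bounds by (simp add: stat_dist_def)

lemma stat_dist_sums: "stat_dist Q sums 1"
  unfolding stat_dist_def using sums_mult[OF geometric_sums[of "rho Q"], of "1 - rho Q"] rho_bounds by simp

lemma stat_dist_balance: "mu * stat_dist Q (Suc i) = lam * stat_dist Q i"
  using base_pos by (simp add: stat_dist_def rho_def)

lemma summable_stat_dist:
  assumes "\<And>i. \<bar>u i\<bar> \<le> K"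
  shows "summable (\<lambda>i. stat_dist Q i * u i)"
proof (rule summable_comparison_test')
  show "summable (\<lambda>i. stat_dist Q i * K)"
    using stat_dist_sums by (intro summable_mult2) (rule sums_summable)
  show "norm (stat_dist Q i * u i) \<le> stat_dist Q i * K" for i
    using assms[of i] stat_dist_nonneg[of i] by (simp add: abs_mult mult_left_mono)
qed

lemma stat_dist_step:
  assumes "\<And>i. \<bar>u i\<bar> \<le> K"
  shows "(\<Sum>i. stat_dist Q i * unif_step u i) = (\<Sum>i. stat_dist Q i * u i)"
proof -
  let ?p = "stat_dist Q"
  have s0: "summable (\<lambda>i. ?p i * u i)" and s1: "summable (\<lambda>i. ?p i * u (Suc i))" and s2: "summable (\<lambda>i. ?p i * u (i - 1))"
    using assms by (rule summable_stat_dist)+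
  have sS: "summable (\<lambda>i. ?p (Suc i) * u (Suc i))" using s0 by (subst summable_Suc_iff)
  have a: "lam * (\<Sum>i. ?p i * u (Suc i)) = mu * (\<Sum>i. ?p (Suc i) * u (Suc i))"
    using s1 sS stat_dist_balance by (simp add: suminf_mult[symmetric] mult.assoc[symmetric])
  have b: "mu * (\<Sum>i. ?p i * u (i - 1)) = mu * (?p 0 * u 0) + lam * (\<Sum>i. ?p i * u i)"
  proof -
    have "(\<Sum>i. ?p i * u (i - 1)) = ?p 0 * u 0 + (\<Sum>i. ?p (Suc i) * u i)"
      using suminf_split_head[OF s2] by simp
    moreover have "mu * (\<Sum>i. ?p (Suc i) * u i) = lam * (\<Sum>i. ?p i * u i)"
      using s0 s2 stat_dist_balance summable_Suc_iff[of "\<lambda>i. ?p i * u (i - 1)"]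
      by (simp add: suminf_mult[symmetric] mult.assoc[symmetric])
    ultimately show ?thesis by (simp add: algebra_simps)
  qed
  have "(\<Sum>i. ?p i * unif_step u i) = (\<Sum>i. (lam * (?p i * u (Suc i)) + mu * (?p i * u (i - 1))) / (lam + mu))"
    by (simp add: unif_step_def algebra_simps)
  also have "\<dots> = (lam * (\<Sum>i. ?p i * u (Suc i)) + mu * (\<Sum>i. ?p i * u (i - 1))) / (lam + mu)"
    using s1 s2 by (simp add: suminf_divide suminf_add[symmetric] summable_add summable_mult suminf_mult)
  also have "\<dots> = (mu * (?p 0 * u 0 + (\<Sum>i. ?p (Suc i) * u (Suc i))) + lam * (\<Sum>i. ?p i * u i)) / (lam + mu)"
    unfolding a b by (simp add: algebra_simps)
  also have "?p 0 * u 0 + (\<Sum>i. ?p (Suc i) * u (Suc i)) = (\<Sum>i. ?p i * u i)"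
    using suminf_split_head[OF s0] by simp
  also have "(mu * (\<Sum>i. ?p i * u i) + lam * (\<Sum>i. ?p i * u i)) / (lam + mu) = (\<Sum>i. ?p i * u i)"
    using arr_pos base_pos by (simp add: distrib_right[symmetric] add.commute)
  finally show ?thesis .
qed

lemma stat_dist_unif:
  assumes "\<And>i. 0 \<le> \<psi> i" "\<And>i. \<psi> i \<le> U"
  shows "(\<Sum>i. stat_dist Q i * unif \<psi> n i) = (\<Sum>i. stat_dist Q i * \<psi> i)"
proof (induction n)
  case (Suc n)
  have "\<bar>unif \<psi> n i\<bar> \<le> U" for i using unif_bounds[OF assms, where n = n and i = i] by auto
  then show ?case unfolding unif_Suc using Suc stat_dist_step by metis
qed simp

lemma stat_dist_weight_sums: "(\<lambda>y. stat_dist Q y * weight ^ y) sums (1 + sqrt (rho Q))"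
proof -
  have r: "0 < sqrt (rho Q)" "sqrt (rho Q) < 1" using rho_bounds by auto
  have "rho Q * weight = sqrt (rho Q)"
    using arr_pos base_pos by (simp add: rho_def weight_def real_sqrt_divide field_simps)
  then have eq: "stat_dist Q y * weight ^ y = (1 - rho Q) * sqrt (rho Q) ^ y" for y
    by (simp add: stat_dist_def power_mult_distrib[symmetric])
  have "(1 - rho Q) * (1 / (1 - sqrt (rho Q))) = 1 + sqrt (rho Q)"
  proof -
    have "1 - rho Q = (1 - sqrt (rho Q)) * (1 + sqrt (rho Q))"
      using rho_bounds by (simp add: algebra_simps)
    then show ?thesis using r by simp
  qed
  then show ?thesis
    unfolding eq using sums_mult[OF geometric_sums[of "sqrt (rho Q)"], of "1 - rho Q"] r by simp
qed

text \<open>Stationarity preserves the mean of \<open>\<psi>\<close>, and by monotonicity every starting point does at least as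
well as the empty queue. So the deficit is at most the stationary mean of the bound in
\<open>unif_spread\<close>, where the weights have mean \<open>1 + sqrt \<rho> \<le> 2\<close>.\<close>

lemma unif_lower:
  assumes "mono \<psi>" "\<And>i. 0 \<le> \<psi> i" "\<And>i. \<psi> i \<le> U"
  shows "(\<Sum>i. stat_dist Q i * \<psi> i) - 2 * U * contraction ^ n \<le> unif \<psi> n i"
proof -
  have U: "0 \<le> U" using assms(2,3)[of 0] by simp
  have c: "0 \<le> contraction" by (rule contraction_bounds)
  have b: "\<bar>unif \<psi> n i\<bar> \<le> U" for i using unif_bounds[OF assms(2,3), where n = n and i = i] by auto
  have "(\<Sum>i. stat_dist Q i * \<psi> i) = (\<Sum>i. stat_dist Q i * unif \<psi> n i)"
    by (rule stat_dist_unif[OF assms(2,3), symmetric])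
  also have "\<dots> \<le> (\<Sum>y. unif \<psi> n 0 * stat_dist Q y + U * contraction ^ n * (stat_dist Q y * weight ^ y))"
  proof (intro suminf_le summable_stat_dist[OF b] summable_add summable_mult)
    show "summable (stat_dist Q)" "summable (\<lambda>y. stat_dist Q y * weight ^ y)"
      using stat_dist_sums stat_dist_weight_sums by (auto simp: sums_iff)
    fix y
    have "stat_dist Q y * unif \<psi> n y \<le> stat_dist Q y * (unif \<psi> n 0 + U * contraction ^ n * weight ^ y)"
      using unif_spread[OF assms, of n y] by (intro mult_left_mono stat_dist_nonneg) simp
    then show "stat_dist Q y * unif \<psi> n y \<le> unif \<psi> n 0 * stat_dist Q y + U * contraction ^ n * (stat_dist Q y * weight ^ y)"
      by (simp add: algebra_simps)
  qed
  also have "\<dots> = unif \<psi> n 0 * 1 + U * contraction ^ n * (1 + sqrt (rho Q))"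
    by (intro sums_unique[symmetric] sums_add sums_mult stat_dist_sums stat_dist_weight_sums)
  also have "\<dots> \<le> unif \<psi> n i * 1 + U * contraction ^ n * 2"
    using rho_bounds U c monoD[OF unif_mono[OF assms(1)], of 0 i n] by (intro add_mono mult_left_mono) auto
  finally show ?thesis by simp
qed

text \<open>The expectation of \<open>\<psi>\<close> at time \<open>t\<close> for the M/M/1 queue started with \<open>i\<close> customers, as a Poisson
mixture of the steps of the uniformised chain.\<close>

definition mm1 :: "(nat \<Rightarrow> real) \<Rightarrow> nat \<Rightarrow> real \<Rightarrow> real"
  where "mm1 \<psi> i t = exp (- (lam + mu) * t) * poisson_sum (\<lambda>n. unif \<psi> n i) ((lam + mu) * t)"

context
  fixes \<psi> :: "nat \<Rightarrow> real" and U :: real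
  assumes mono: "mono \<psi>" and nonneg: "\<And>i. 0 \<le> \<psi> i" and le: "\<And>i. \<psi> i \<le> U"
begin

lemma unif_abs: "\<bar>unif \<psi> n i\<bar> \<le> U"
  using unif_bounds[OF nonneg le, where n = n and i = i] by auto

lemma mm1_0: "mm1 \<psi> i 0 = \<psi> i"
  using suminf_finite[of "{0}" "\<lambda>n. unif \<psi> n i / fact n * 0 ^ n"]
  by (simp add: mm1_def poisson_sum_def)

lemma mm1_le:
  assumes "0 \<le> t"
  shows "mm1 \<psi> i t \<le> U"
proof -
  have "poisson_sum (\<lambda>n. unif \<psi> n i) ((lam + mu) * t) \<le> poisson_sum (\<lambda>n. U) ((lam + mu) * t)"
    using unif_bounds[OF nonneg le] assms arr_pos base_pos
    by (intro poisson_sum_mono[OF unif_abs, of _ "\<bar>U\<bar>"]) auto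
  then have "mm1 \<psi> i t \<le> exp (- (lam + mu) * t) * (U * exp ((lam + mu) * t))"
    unfolding mm1_def poisson_sum_const by (intro mult_left_mono) auto
  also have "\<dots> = U * (exp (- (lam + mu) * t) * exp ((lam + mu) * t))" by simp
  also have "exp (- (lam + mu) * t) * exp ((lam + mu) * t) = 1" by (simp add: exp_add[symmetric] algebra_simps)
  finally show ?thesis by simp
qed

lemma mm1_lower:
  assumes "0 \<le> t"
  shows "(\<Sum>i. stat_dist Q i * \<psi> i) - 2 * U * exp (- ((sqrt mu - sqrt lam)\<^sup>2 * t)) \<le> mm1 \<psi> i t"
proof -
  let ?s = "\<Sum>i. stat_dist Q i * \<psi> i" and ?n = "lam + mu"
  have c: "0 \<le> contraction" "contraction \<le> 1" by (rule contraction_bounds)+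
  have U: "0 \<le> U" using nonneg[of 0] le[of 0] by simp
  have "\<bar>?s + (- 2 * U) * contraction ^ n\<bar> \<le> \<bar>?s\<bar> + 2 * U" for n
  proof -
    have "0 \<le> 2 * U * contraction ^ n" "2 * U * contraction ^ n \<le> 2 * U"
      using U c power_le_one[OF c, of n] mult_left_mono[of "contraction ^ n" 1 "2 * U"] by auto
    then show ?thesis by linarith
  qed
  then have "poisson_sum (\<lambda>n. ?s + (- 2 * U) * contraction ^ n) (?n * t) \<le> poisson_sum (\<lambda>n. unif \<psi> n i) (?n * t)"
    using unif_lower[OF mono nonneg le] assms arr_pos base_pos
    by (intro poisson_sum_mono[OF _ unif_abs]) auto
  then have "exp (- ?n * t) * (?s * exp (?n * t) + (- 2 * U) * exp (contraction * (?n * t))) \<le> mm1 \<psi> i t"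
    unfolding mm1_def poisson_sum_geometric by (intro mult_left_mono) auto
  also have "exp (- ?n * t) * (?s * exp (?n * t) + (- 2 * U) * exp (contraction * (?n * t))) =
    ?s * (exp (- ?n * t) * exp (?n * t)) - 2 * U * (exp (- ?n * t) * exp (contraction * (?n * t)))"
    by (simp add: algebra_simps)
  also have "exp (- ?n * t) * exp (?n * t) = 1"
    by (simp add: exp_add[symmetric] algebra_simps)
  also have "exp (- ?n * t) * exp (contraction * (?n * t)) = exp (- ((sqrt mu - sqrt lam)\<^sup>2 * t))"
  proof -
    have "?n * contraction = 2 * sqrt (lam * mu)"
      using arr_pos base_pos by (simp add: contraction_def)
    moreover have "(sqrt mu - sqrt lam)\<^sup>2 = ?n - 2 * sqrt (lam * mu)"
      using arr_pos base_pos by (simp add: power2_diff real_sqrt_mult)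
    ultimately have "(sqrt mu - sqrt lam)\<^sup>2 = ?n - ?n * contraction" by simp
    then have "- ?n * t + contraction * (?n * t) = - ((sqrt mu - sqrt lam)\<^sup>2 * t)"
      by (simp only:) (simp add: algebra_simps)
    then show ?thesis by (simp add: exp_add[symmetric])
  qed
  finally show ?thesis by simp
qed

text \<open>Kolmogorov's backward equation.\<close>

lemma mm1_deriv:
  "(mm1 \<psi> i has_real_derivative (lam * mm1 \<psi> (Suc i) t + mu * mm1 \<psi> (i - 1) t - (lam + mu) * mm1 \<psi> i t)) (at t within S)"
proof -
  let ?n = "lam + mu"
  have n: "?n \<noteq> 0" using arr_pos base_pos by simp
  have s: "summable (\<lambda>n. unif \<psi> n j / fact n * x ^ n)" for j x
    by (rule summable_poisson[OF unif_abs])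
  have "?n * poisson_sum (\<lambda>n. unif \<psi> (Suc n) i) x =
      lam * poisson_sum (\<lambda>n. unif \<psi> n (Suc i)) x + mu * poisson_sum (\<lambda>n. unif \<psi> n (i - 1)) x" for x
  proof -
    have "?n * poisson_sum (\<lambda>n. unif \<psi> (Suc n) i) x = (\<Sum>n. ?n * (unif \<psi> (Suc n) i / fact n * x ^ n))"
      unfolding poisson_sum_def using summable_poisson[of "\<lambda>n. unif \<psi> (Suc n) i" U x] unif_abs
      by (intro suminf_mult[symmetric]) auto
    also have "\<dots> = (\<Sum>n. lam * (unif \<psi> n (Suc i) / fact n * x ^ n) + mu * (unif \<psi> n (i - 1) / fact n * x ^ n))"
    proof (rule suminf_cong)
      fix n
      have "?n * (unif \<psi> (Suc n) i / fact n * x ^ n) = (?n * unif \<psi> (Suc n) i) / fact n * x ^ n" by simp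
      also have "\<dots> = lam * (unif \<psi> n (Suc i) / fact n * x ^ n) + mu * (unif \<psi> n (i - 1) / fact n * x ^ n)"
        unfolding unif_Suc_eq by (simp add: add_divide_distrib distrib_right)
      finally show "?n * (unif \<psi> (Suc n) i / fact n * x ^ n) = \<dots>" .
    qed
    also have "\<dots> = lam * poisson_sum (\<lambda>n. unif \<psi> n (Suc i)) x + mu * poisson_sum (\<lambda>n. unif \<psi> n (i - 1)) x"
      unfolding poisson_sum_def
      by (subst suminf_add[symmetric]) (intro summable_mult s, intro summable_mult s, simp only: suminf_mult[OF s])
    finally show ?thesis .
  qed
  note split = this
  have D: "((\<lambda>t. poisson_sum (\<lambda>n. unif \<psi> n i) (?n * t)) has_real_derivative
      poisson_sum (\<lambda>n. unif \<psi> (Suc n) i) (?n * t) * ?n) (at t within S)"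
    by (rule DERIV_chain'[OF _ poisson_sum_deriv[OF unif_abs]]) (auto intro!: derivative_eq_intros)
  have E: "((\<lambda>t. exp (- ?n * t)) has_real_derivative - ?n * exp (- ?n * t)) (at t within S)"
    by (auto intro!: derivative_eq_intros)
  have "exp (- ?n * t) * (poisson_sum (\<lambda>n. unif \<psi> (Suc n) i) (?n * t) * ?n) + (- ?n * exp (- ?n * t)) * poisson_sum (\<lambda>n. unif \<psi> n i) (?n * t)
    = exp (- ?n * t) * (?n * poisson_sum (\<lambda>n. unif \<psi> (Suc n) i) (?n * t)) - ?n * mm1 \<psi> i t"
    by (simp add: mm1_def algebra_simps)
  also have "\<dots> = lam * mm1 \<psi> (Suc i) t + mu * mm1 \<psi> (i - 1) t - ?n * mm1 \<psi> i t"
    unfolding split by (simp add: mm1_def algebra_simps)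
  finally have eq: "exp (- ?n * t) * (poisson_sum (\<lambda>n. unif \<psi> (Suc n) i) (?n * t) * ?n) + (- ?n * exp (- ?n * t)) * poisson_sum (\<lambda>n. unif \<psi> n i) (?n * t)
    = lam * mm1 \<psi> (Suc i) t + mu * mm1 \<psi> (i - 1) t - ?n * mm1 \<psi> i t" .
  show ?thesis
    using DERIV_mult'[OF E D] unfolding eq mm1_def[abs_def] by simp
qed

lemma mm1_measurable: "mm1 \<psi> i \<in> borel_measurable borel"
  using mm1_deriv[where S = UNIV]
  by (intro borel_measurable_continuous_onI continuous_at_imp_continuous_on ballI DERIV_isCont) auto

end
end

section \<open>Bellman equations of the no-repair model\<close>

text \<open>A list of weights may contain the same point several times, which happens for an empty queue.\<close>

lemma sum_filter_weights:
  assumes "finite A" "fst ` set xs \<subseteq> A" "\<forall>x\<in>set xs. 0 \<le> snd x"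
  shows "(\<Sum>x\<in>A. ennreal (sum_list (map snd (filter (\<lambda>z. fst z = x) xs))) * g x) =
    sum_list (map (\<lambda>z. ennreal (snd z) * g (fst z)) xs)"
  using assms(2,3)
proof (induction xs)
  case (Cons z xs)
  have "(\<Sum>x\<in>A. ennreal (sum_list (map snd (filter (\<lambda>z. fst z = x) (z # xs)))) * g x) =
    (\<Sum>x\<in>A. (if x = fst z then ennreal (snd z) * g (fst z) else 0) +
       ennreal (sum_list (map snd (filter (\<lambda>z. fst z = x) xs))) * g x)"
  proof (intro sum.cong refl)
    fix x
    have "0 \<le> sum_list (map snd (filter (\<lambda>z. fst z = x) xs))"
      using Cons.prems by (intro sum_list_nonneg) auto
    then show "ennreal (sum_list (map snd (filter (\<lambda>z. fst z = x) (z # xs)))) * g x =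
      (if x = fst z then ennreal (snd z) * g (fst z) else 0) +
       ennreal (sum_list (map snd (filter (\<lambda>z. fst z = x) xs))) * g x"
      using Cons.prems by (auto simp: ennreal_plus distrib_right)
  qed
  also have "\<dots> = ennreal (snd z) * g (fst z) + sum_list (map (\<lambda>z. ennreal (snd z) * g (fst z)) xs)"
    using Cons assms(1) by (simp add: sum.distrib sum.delta)
  finally show ?case by simp
qed simp

lemma nn_integral_pmf_of_list:
  assumes "pmf_of_list_wf xs"
  shows "(\<integral>\<^sup>+x. g x \<partial>measure_pmf (pmf_of_list xs)) = sum_list (map (\<lambda>z. ennreal (snd z) * g (fst z)) xs)"
proof -
  have "(\<integral>\<^sup>+x. g x \<partial>measure_pmf (pmf_of_list xs)) =
    (\<Sum>x\<in>set_pmf (pmf_of_list xs). g x * ennreal (pmf (pmf_of_list xs) x))"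
    by (rule nn_integral_measure_pmf_finite[OF finite_set_pmf_of_list[OF assms]]) simp
  also have "\<dots> = (\<Sum>x\<in>fst ` set xs. g x * ennreal (pmf (pmf_of_list xs) x))"
    using set_pmf_of_list[OF assms] by (intro sum.mono_neutral_left) (auto simp: set_pmf_iff)
  also have "\<dots> = (\<Sum>x\<in>fst ` set xs. ennreal (sum_list (map snd (filter (\<lambda>z. fst z = x) xs))) * g x)"
    by (simp add: pmf_pmf_of_list[OF assms] mult.commute)
  also have "\<dots> = sum_list (map (\<lambda>z. ennreal (snd z) * g (fst z)) xs)"
    using assms by (intro sum_filter_weights) (auto simp: pmf_of_list_wf_def)
  finally show ?thesis .
qed

context vacation_queue begin

abbreviation rates :: real where "rates \<equiv> srv Q Slow + srv Q Fast"

lemma srv_le_rates: "srv Q u \<le> rates"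
  using srv_pos[of Slow] srv_pos[of Fast] by (cases u) auto

text \<open>Without a case distinction at \<open>0\<close>: in an empty queue \<open>i - 1\<close> is \<open>i\<close>, so that the probability of a
service is added to that of staying.\<close>

definition on_step :: "speed \<Rightarrow> (nat \<Rightarrow> real) \<Rightarrow> (nat \<Rightarrow> real) \<Rightarrow> nat \<Rightarrow> real"
  where "on_step u v w i = arr Q * v (Suc i) + brk Q * w i + srv Q u * v (i - 1) + (rates - srv Q u) * v i"

definition off_step :: "(nat \<Rightarrow> real) \<Rightarrow> nat \<Rightarrow> real"
  where "off_step w i = arr Q * w (Suc i) + srv Q (base Q) * w (i - 1) + (1 - arr Q - srv Q (base Q)) * w i"

lemma rest_eq: "1 - arr Q - brk Q = rates"
  using normalised by simp

lemma on_list_wf: "0 \<le> m \<Longrightarrow> m \<le> rates \<Longrightarrow>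
    pmf_of_list_wf [(On (i + 1), arr Q), (Off i, brk Q), (On (i - 1), m), (On i, 1 - arr Q - brk Q - m)]"
  using normalised arr_pos brk_pos by (intro pmf_of_list_wfI) auto

lemma off_list_wf: "0 \<le> m \<Longrightarrow> m \<le> rates \<Longrightarrow>
    pmf_of_list_wf [(Off (i + 1), arr Q), (Off (i - 1), m), (Off i, 1 - arr Q - m)]"
  using normalised arr_pos brk_pos by (intro pmf_of_list_wfI) auto

lemma nn_integral_on:
  assumes "\<And>j. g (On j) = ennreal (v j)" "\<And>j. g (Off j) = ennreal (w j)" "\<And>j. 0 \<le> v j" "\<And>j. 0 \<le> w j"
  shows "(\<integral>\<^sup>+x. g x \<partial>measure_pmf (nr_kernel Q (On i) u)) = ennreal (on_step u v w i)"
proof -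
  define m where "m = (if i > 0 then srv Q u else 0)"
  have m: "0 \<le> m" "m \<le> rates" using srv_pos[of u] srv_le_rates[of u] slow_pos slow_less_fast by (auto simp: m_def)
  have m': "0 \<le> rates - m" using m by simp
  have "(\<integral>\<^sup>+x. g x \<partial>measure_pmf (nr_kernel Q (On i) u)) =
    ennreal (arr Q) * ennreal (v (Suc i)) + (ennreal (brk Q) * ennreal (w i) + (ennreal m * ennreal (v (i - 1)) + ennreal (rates - m) * ennreal (v i)))"
    using nn_integral_pmf_of_list[OF on_list_wf[OF m, of i], of g]
    by (simp add: Let_def assms rest_eq flip: m_def)
  also have "\<dots> = ennreal (arr Q * v (Suc i) + (brk Q * w i + (m * v (i - 1) + (rates - m) * v i)))"
    using m m' arr_pos brk_pos assms(3,4)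
    by (simp only: ennreal_mult[symmetric] ennreal_plus[symmetric] mult_nonneg_nonneg add_nonneg_nonneg less_imp_le)
  also have "arr Q * v (Suc i) + (brk Q * w i + (m * v (i - 1) + (rates - m) * v i)) = on_step u v w i"
    by (cases i) (simp_all add: on_step_def m_def algebra_simps)
  finally show ?thesis .
qed

lemma nn_integral_off:
  assumes "\<And>j. g (Off j) = ennreal (w j)" "\<And>j. 0 \<le> w j"
  shows "(\<integral>\<^sup>+x. g x \<partial>measure_pmf (nr_kernel Q (Off i) u)) = ennreal (off_step w i)"
proof -
  define m where "m = (if i > 0 then srv Q (base Q) else 0)"
  have m: "0 \<le> m" "m \<le> rates" using srv_pos[of "base Q"] srv_le_rates[of "base Q"] slow_pos slow_less_fast by (auto simp: m_def)
  have m': "0 \<le> 1 - arr Q - m" using m normalised brk_pos by simp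
  have "(\<integral>\<^sup>+x. g x \<partial>measure_pmf (nr_kernel Q (Off i) u)) =
    ennreal (arr Q) * ennreal (w (Suc i)) + (ennreal m * ennreal (w (i - 1)) + ennreal (1 - arr Q - m) * ennreal (w i))"
    using nn_integral_pmf_of_list[OF off_list_wf[OF m, of i], of g]
    by (simp add: Let_def assms flip: m_def)
  also have "\<dots> = ennreal (arr Q * w (Suc i) + (m * w (i - 1) + (1 - arr Q - m) * w i))"
    using m m' arr_pos assms(2)
    by (simp only: ennreal_mult[symmetric] ennreal_plus[symmetric] mult_nonneg_nonneg add_nonneg_nonneg less_imp_le)
  also have "arr Q * w (Suc i) + (m * w (i - 1) + (1 - arr Q - m) * w i) = off_step w i"
    by (cases i) (simp_all add: off_step_def m_def algebra_simps)
  finally show ?thesis .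
qed

end

text \<open>Deterministic rules that depend on the stage and on the state. They comprise the stationary policies
and their modifications in the first step, which is all that the optimality equation needs.\<close>

type_synonym rule = "nat \<Rightarrow> nr_state \<Rightarrow> speed"

definition rule_policy :: "rule \<Rightarrow> nr_policy"
  where "rule_policy d = (\<lambda>past x. return_pmf (d (length past) x))"

primrec rule_chain :: "queue \<Rightarrow> rule \<Rightarrow> nr_state \<Rightarrow> nat \<Rightarrow> nr_state pmf" where
  "rule_chain Q d s 0 = return_pmf s"
| "rule_chain Q d s (Suc n) = bind_pmf (rule_chain Q d s n) (\<lambda>x. nr_kernel Q x (d n x))"

lemma rule_history_length:
  "p \<in> set_pmf (nr_history Q (rule_policy d) s n) \<Longrightarrow> length (fst p) = n"
proof (induction n arbitrary: p)
  case (Suc n)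
  then show ?case by (force simp: set_bind_pmf rule_policy_def bind_return_pmf)
qed simp

lemma rule_history_state:
  "map_pmf snd (nr_history Q (rule_policy d) s n) = rule_chain Q d s n"
proof (induction n)
  case (Suc n)
  have "map_pmf snd (nr_history Q (rule_policy d) s (Suc n)) =
    bind_pmf (nr_history Q (rule_policy d) s n) (\<lambda>p. nr_kernel Q (snd p) (d (length (fst p)) (snd p)))"
    by (simp add: map_bind_pmf rule_policy_def bind_return_pmf split_beta pmf.map_comp o_def)
  also have "\<dots> = bind_pmf (nr_history Q (rule_policy d) s n) (\<lambda>p. nr_kernel Q (snd p) (d n (snd p)))"
    by (intro bind_pmf_cong refl) (simp add: rule_history_length)
  also have "\<dots> = bind_pmf (map_pmf snd (nr_history Q (rule_policy d) s n)) (\<lambda>x. nr_kernel Q x (d n x))"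
    by (simp add: bind_map_pmf)
  finally show ?case unfolding Suc by simp
qed simp

definition rule_cost :: "queue \<Rightarrow> real \<Rightarrow> rule \<Rightarrow> nr_state \<Rightarrow> ennreal"
  where "rule_cost Q \<alpha> d s =
    (\<Sum>n. ennreal ((1 - \<alpha>) ^ n) * (\<integral>\<^sup>+x. ennreal (nr_cost Q x (d n x)) \<partial>measure_pmf (rule_chain Q d s n)))"

lemma nr_disc_cost_rule: "nr_disc_cost Q \<alpha> (rule_policy d) s = rule_cost Q \<alpha> d s"
proof -
  have "(\<integral>\<^sup>+ (past, x). (\<integral>\<^sup>+ a. ennreal (nr_cost Q x a) \<partial>measure_pmf (rule_policy d past x))
          \<partial>measure_pmf (nr_history Q (rule_policy d) s n)) =
    (\<integral>\<^sup>+x. ennreal (nr_cost Q x (d n x)) \<partial>measure_pmf (rule_chain Q d s n))" for n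
  proof -
    have "(\<integral>\<^sup>+ (past, x). (\<integral>\<^sup>+ a. ennreal (nr_cost Q x a) \<partial>measure_pmf (rule_policy d past x))
          \<partial>measure_pmf (nr_history Q (rule_policy d) s n)) =
      (\<integral>\<^sup>+p. ennreal (nr_cost Q (snd p) (d n (snd p))) \<partial>measure_pmf (nr_history Q (rule_policy d) s n))"
      using rule_history_length[of _ Q d s n]
      by (intro nn_integral_cong_AE AE_pmfI) (fastforce simp: rule_policy_def nn_integral_return_pmf split: prod.splits)
    also have "\<dots> = (\<integral>\<^sup>+x. ennreal (nr_cost Q x (d n x)) \<partial>measure_pmf (map_pmf snd (nr_history Q (rule_policy d) s n)))"
      by simp
    finally show ?thesis unfolding rule_history_state .
  qed
  then show ?thesis unfolding nr_disc_cost_def rule_cost_def by simp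
qed

lemma rule_chain_first:
  "rule_chain Q d s (Suc n) = bind_pmf (nr_kernel Q s (d 0 s)) (\<lambda>y. rule_chain Q (\<lambda>n. d (Suc n)) y n)"
proof (induction n)
  case 0
  then show ?case by (simp add: bind_return_pmf bind_return_pmf')
next
  case (Suc n)
  show ?case
    by (subst rule_chain.simps(2), subst Suc) (simp add: bind_assoc_pmf)
qed

lemma suminf_split_first: "(\<Sum>n. g n) = g 0 + (\<Sum>n. g (Suc n))" for g :: "nat \<Rightarrow> ennreal"
  using suminf_offset[of g 1] by (simp add: add.commute)

text \<open>Discounting makes the cost from the second stage on a multiple of the cost of the shifted rule.\<close>

lemma rule_cost_first:
  assumes "\<alpha> \<le> 1"
  shows "rule_cost Q \<alpha> d s = ennreal (nr_cost Q s (d 0 s)) +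
    ennreal (1 - \<alpha>) * (\<integral>\<^sup>+y. rule_cost Q \<alpha> (\<lambda>n. d (Suc n)) y \<partial>measure_pmf (nr_kernel Q s (d 0 s)))"
proof -
  let ?t = "\<lambda>d s n. ennreal ((1 - \<alpha>) ^ n) * (\<integral>\<^sup>+x. ennreal (nr_cost Q x (d n x)) \<partial>measure_pmf (rule_chain Q d s n))"
  let ?K = "nr_kernel Q s (d 0 s)" and ?d = "\<lambda>n. d (Suc n)"
  have "rule_cost Q \<alpha> d s = ?t d s 0 + (\<Sum>n. ?t d s (Suc n))"
    unfolding rule_cost_def by (rule suminf_split_first)
  also have "?t d s 0 = ennreal (nr_cost Q s (d 0 s))"
    by (simp add: nn_integral_return_pmf)
  also have "(\<Sum>n. ?t d s (Suc n)) = (\<Sum>n. ennreal (1 - \<alpha>) * (\<integral>\<^sup>+y. ?t ?d y n \<partial>measure_pmf ?K))"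
  proof (rule suminf_cong)
    fix n
    have "?t d s (Suc n) = ennreal (1 - \<alpha>) * (ennreal ((1 - \<alpha>) ^ n) *
       (\<integral>\<^sup>+y. (\<integral>\<^sup>+x. ennreal (nr_cost Q x (d (Suc n) x)) \<partial>measure_pmf (rule_chain Q ?d y n)) \<partial>measure_pmf ?K))"
      unfolding rule_chain_first using assms
      by (simp add: nn_integral_bind_pmf ennreal_mult mult.assoc)
    then show "?t d s (Suc n) = ennreal (1 - \<alpha>) * (\<integral>\<^sup>+y. ?t ?d y n \<partial>measure_pmf ?K)"
      by (simp add: nn_integral_cmult)
  qed
  also have "\<dots> = ennreal (1 - \<alpha>) * (\<Sum>n. (\<integral>\<^sup>+y. ?t ?d y n \<partial>measure_pmf ?K))"
    by (rule ennreal_suminf_cmult)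
  also have "(\<Sum>n. (\<integral>\<^sup>+y. ?t ?d y n \<partial>measure_pmf ?K)) = (\<integral>\<^sup>+y. rule_cost Q \<alpha> ?d y \<partial>measure_pmf ?K)"
    unfolding rule_cost_def by (rule nn_integral_suminf[symmetric]) simp
  finally show ?thesis .
qed

fun level :: "nr_state \<Rightarrow> nat" where
  "level (On i) = i" | "level (Off i) = i"

context vacation_queue begin

lemma level_kernel: "y \<in> set_pmf (nr_kernel Q x u) \<Longrightarrow> level y \<le> Suc (level x)"
proof (cases x)
  case (On i)
  define m where "m = (if i > 0 then srv Q u else 0)"
  have m: "0 \<le> m" "m \<le> rates" using srv_pos[of u] srv_le_rates[of u] slow_pos slow_less_fast by (auto simp: m_def)
  assume "y \<in> set_pmf (nr_kernel Q x u)"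
  then show ?thesis
    using set_pmf_of_list[OF on_list_wf[OF m, of i]] by (auto simp: On Let_def simp flip: m_def)
next
  case (Off i)
  define m where "m = (if i > 0 then srv Q (base Q) else 0)"
  have m: "0 \<le> m" "m \<le> rates" using srv_pos[of "base Q"] srv_le_rates[of "base Q"] slow_pos slow_less_fast by (auto simp: m_def)
  assume "y \<in> set_pmf (nr_kernel Q x u)"
  then show ?thesis
    using set_pmf_of_list[OF off_list_wf[OF m, of i]] by (auto simp: Off Let_def simp flip: m_def)
qed

lemma level_rule_chain: "y \<in> set_pmf (rule_chain Q d s n) \<Longrightarrow> level y \<le> level s + n"
proof (induction n arbitrary: y)
  case (Suc n)
  then obtain x where x: "x \<in> set_pmf (rule_chain Q d s n)" "y \<in> set_pmf (nr_kernel Q x (d n x))"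
    by (auto simp: set_bind_pmf)
  then show ?case using Suc.IH[OF x(1)] level_kernel[OF x(2)] by simp
qed simp

text \<open>A bound for the discounted cost from stage \<open>n\<close> on, started at level \<open>i\<close>: a queue grows by at most one
customer per step.\<close>

definition tail_cost :: "real \<Rightarrow> nat \<Rightarrow> nat \<Rightarrow> real"
  where "tail_cost a n i = (\<Sum>m. a ^ (n + m) * (srv_cost Q Fast + hcost Q (i + (n + m))))"

lemma srv_cost_le: "srv_cost Q u \<le> srv_cost Q Fast"
  using slow_free fast_cost_pos by (cases u) auto

lemma summable_hcost_shift:
  assumes "0 < x" "x < 1"
  shows "summable (\<lambda>n. x ^ n * hcost Q (i + n))"
proof -
  have "summable (\<lambda>n. hcost Q (n + i) * x ^ (n + i))"
    using hcost_growth[OF assms] by (subst summable_iff_shift)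
  then have "summable (\<lambda>n. inverse (x ^ i) * (hcost Q (n + i) * x ^ (n + i)))"
    by (rule summable_mult)
  then show ?thesis
    using assms by (simp add: power_add field_simps)
qed

lemma summable_bound_cost:
  assumes "0 < a" "a < 1"
  shows "summable (\<lambda>m. a ^ m * (srv_cost Q Fast + hcost Q (i + m)))"
proof -
  have "summable (\<lambda>m. srv_cost Q Fast * a ^ m + a ^ m * hcost Q (i + m))"
    using assms by (intro summable_add summable_mult summable_geometric summable_hcost_shift) auto
  then show ?thesis by (simp add: algebra_simps)
qed

lemma nr_cost_nonneg: "0 \<le> nr_cost Q x u"
  by (cases x) (simp_all add: hcost_nonneg srv_cost_nonneg)

lemma nr_cost_le: "nr_cost Q x u \<le> srv_cost Q Fast + hcost Q (level x)"
  by (cases x) (simp_all add: srv_cost_le)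

lemma rule_cost_le:
  assumes \<alpha>: "0 < \<alpha>" "\<alpha> < 1"
  shows "rule_cost Q \<alpha> d s \<le> ennreal (tail_cost (1 - \<alpha>) 0 (level s))"
proof -
  have "rule_cost Q \<alpha> d s \<le> (\<Sum>n. ennreal ((1 - \<alpha>) ^ n * (srv_cost Q Fast + hcost Q (level s + n))))"
    unfolding rule_cost_def
  proof (intro suminf_le summableI)
    fix n
    have "(\<integral>\<^sup>+x. ennreal (nr_cost Q x (d n x)) \<partial>measure_pmf (rule_chain Q d s n)) \<le>
      (\<integral>\<^sup>+x. ennreal (srv_cost Q Fast + hcost Q (level s + n)) \<partial>measure_pmf (rule_chain Q d s n))"
      using monoD[OF hcost_mono] level_rule_chain
      by (intro nn_integral_mono_AE AE_pmfI ennreal_leI order_trans[OF nr_cost_le] add_left_mono) auto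
    also have "\<dots> = ennreal (srv_cost Q Fast + hcost Q (level s + n))" by simp
    finally show "ennreal ((1 - \<alpha>) ^ n) * (\<integral>\<^sup>+x. ennreal (nr_cost Q x (d n x)) \<partial>measure_pmf (rule_chain Q d s n))
      \<le> ennreal ((1 - \<alpha>) ^ n * (srv_cost Q Fast + hcost Q (level s + n)))"
      using \<alpha> fast_cost_pos hcost_nonneg[of "level s + n"] by (subst ennreal_mult) (auto intro: mult_left_mono)
  qed
  also have "\<dots> = ennreal (tail_cost (1 - \<alpha>) 0 (level s))"
    unfolding tail_cost_def using \<alpha> fast_cost_pos hcost_nonneg summable_bound_cost[of "1 - \<alpha>" "level s"]
    by (subst suminf_ennreal2) (auto intro!: mult_nonneg_nonneg add_nonneg_nonneg simp: less_imp_le)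
  finally show ?thesis .
qed

definition as_rule :: "(nat \<Rightarrow> speed) \<Rightarrow> nr_state \<Rightarrow> speed"
  where "as_rule f x = (case x of On i \<Rightarrow> f i | Off i \<Rightarrow> Slow)"

lemma stationary_eq: "stationary f = rule_policy (\<lambda>_. as_rule f)"
  by (auto simp: stationary_def rule_policy_def as_rule_def fun_eq_iff split: nr_state.splits)

definition on_value :: "real \<Rightarrow> nat \<Rightarrow> real"
  where "on_value \<alpha> i = enn2real (nr_opt Q \<alpha> (On i))"

definition off_value :: "real \<Rightarrow> nat \<Rightarrow> real"
  where "off_value \<alpha> i = enn2real (nr_opt Q \<alpha> (Off i))"

end

text \<open>Because the optimal value is attained by a policy, it satisfies the evaluation equation of that policy
and the optimality inequality for every other action.\<close>

locale discounted_optimum = vacation_queue +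
  fixes f :: "nat \<Rightarrow> speed" and \<alpha> :: real
  assumes \<alpha>: "0 < \<alpha>" "\<alpha> < 1"
    and optimal: "nr_disc_cost Q \<alpha> (stationary f) s = nr_opt Q \<alpha> s"
    and base_slow: "base Q = Slow"
begin

lemma nr_opt_eq: "nr_opt Q \<alpha> s = rule_cost Q \<alpha> (\<lambda>_. as_rule f) s"
  using optimal[of s] by (simp add: stationary_eq nr_disc_cost_rule)

lemma nr_opt_le_tail: "nr_opt Q \<alpha> s \<le> ennreal (tail_cost (1 - \<alpha>) 0 (level s))"
  unfolding nr_opt_eq by (rule rule_cost_le[OF \<alpha>])

lemma nr_opt_value: "nr_opt Q \<alpha> (On i) = ennreal (on_value \<alpha> i)" "nr_opt Q \<alpha> (Off i) = ennreal (off_value \<alpha> i)"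
proof -
  have fin: "nr_opt Q \<alpha> s < top" for s
    using nr_opt_le_tail[of s] ennreal_less_top by (rule le_less_trans)
  show "nr_opt Q \<alpha> (On i) = ennreal (on_value \<alpha> i)" "nr_opt Q \<alpha> (Off i) = ennreal (off_value \<alpha> i)"
    using fin by (simp_all add: on_value_def off_value_def)
qed

lemma value_nonneg: "0 \<le> on_value \<alpha> i" "0 \<le> off_value \<alpha> i"
  by (simp_all add: on_value_def off_value_def)

lemma tail_cost_nonneg: "0 \<le> tail_cost (1 - \<alpha>) n i"
  unfolding tail_cost_def using summable_ignore_initial_segment[OF summable_bound_cost[of "1 - \<alpha>" i], of n] \<alpha> fast_cost_pos hcost_nonneg
  by (intro suminf_nonneg) (auto simp: add_ac intro!: mult_nonneg_nonneg add_nonneg_nonneg)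

lemma value_le_tail: "on_value \<alpha> i \<le> tail_cost (1 - \<alpha>) 0 i" "off_value \<alpha> i \<le> tail_cost (1 - \<alpha>) 0 i"
  using nr_opt_le_tail[of "On i"] nr_opt_le_tail[of "Off i"] tail_cost_nonneg[of 0 i] unfolding nr_opt_value by simp_all

lemma nr_opt_fixed:
  "nr_opt Q \<alpha> s = ennreal (nr_cost Q s (as_rule f s)) +
    ennreal (1 - \<alpha>) * (\<integral>\<^sup>+y. nr_opt Q \<alpha> y \<partial>measure_pmf (nr_kernel Q s (as_rule f s)))"
  unfolding nr_opt_eq using \<alpha> by (subst rule_cost_first) auto

text \<open>Acting once with \<open>u\<close> and following \<open>f\<close> afterwards is one of the competing policies.\<close>

lemma nr_opt_le_deviation:
  "nr_opt Q \<alpha> s \<le> ennreal (nr_cost Q s u) +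
    ennreal (1 - \<alpha>) * (\<integral>\<^sup>+y. nr_opt Q \<alpha> y \<partial>measure_pmf (nr_kernel Q s u))"
proof -
  let ?d = "\<lambda>n. if n = 0 then \<lambda>_. u else as_rule f"
  have "nr_opt Q \<alpha> s \<le> nr_disc_cost Q \<alpha> (rule_policy ?d) s"
    unfolding nr_opt_def by (rule INF_lower) simp
  also have "\<dots> = ennreal (nr_cost Q s u) +
    ennreal (1 - \<alpha>) * (\<integral>\<^sup>+y. nr_opt Q \<alpha> y \<partial>measure_pmf (nr_kernel Q s u))"
    unfolding nr_disc_cost_rule nr_opt_eq using \<alpha> by (subst rule_cost_first) auto
  finally show ?thesis .
qed

lemma on_step_nonneg: "(\<And>j. 0 \<le> v j) \<Longrightarrow> (\<And>j. 0 \<le> w j) \<Longrightarrow> 0 \<le> on_step u v w i"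
  unfolding on_step_def using arr_pos brk_pos srv_pos[of u] srv_le_rates[of u]
  by (intro add_nonneg_nonneg mult_nonneg_nonneg) auto

lemma off_step_nonneg: "(\<And>j. 0 \<le> w j) \<Longrightarrow> 0 \<le> off_step w i"
  unfolding off_step_def using arr_pos brk_pos srv_pos[of "base Q"] srv_le_rates[of "base Q"] normalised
  by (intro add_nonneg_nonneg mult_nonneg_nonneg) auto

lemma on_value_fixed:
  "on_value \<alpha> i = srv_cost Q (f i) + hcost Q i + (1 - \<alpha>) * on_step (f i) (on_value \<alpha>) (off_value \<alpha>) i"
proof -
  have n: "0 \<le> on_step (f i) (on_value \<alpha>) (off_value \<alpha>) i" by (intro on_step_nonneg value_nonneg)
  have c: "0 \<le> srv_cost Q (f i) + hcost Q i" using nr_cost_nonneg[of "On i" "f i"] by simp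
  have "ennreal (on_value \<alpha> i) = ennreal (srv_cost Q (f i) + hcost Q i) +
    ennreal (1 - \<alpha>) * ennreal (on_step (f i) (on_value \<alpha>) (off_value \<alpha>) i)"
    using nr_opt_fixed[of "On i"] nn_integral_on[of "nr_opt Q \<alpha>" "on_value \<alpha>" "off_value \<alpha>" i "f i"]
    by (simp add: as_rule_def nr_opt_value value_nonneg)
  also have "\<dots> = ennreal (srv_cost Q (f i) + hcost Q i + (1 - \<alpha>) * on_step (f i) (on_value \<alpha>) (off_value \<alpha>) i)"
    using n c \<alpha> by (simp add: ennreal_mult[symmetric] ennreal_plus[symmetric] del: ennreal_plus)
  finally show ?thesis
    using n c \<alpha> value_nonneg(1)[of i] by (subst (asm) ennreal_inj) auto
qed

lemma off_value_fixed:
  "off_value \<alpha> i = srv_cost Q (base Q) + hcost Q i + (1 - \<alpha>) * off_step (off_value \<alpha>) i"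
proof -
  have n: "0 \<le> off_step (off_value \<alpha>) i" by (intro off_step_nonneg value_nonneg)
  have c: "0 \<le> srv_cost Q (base Q) + hcost Q i" using nr_cost_nonneg[of "Off i" Slow] by simp
  have "ennreal (off_value \<alpha> i) = ennreal (srv_cost Q (base Q) + hcost Q i) +
    ennreal (1 - \<alpha>) * ennreal (off_step (off_value \<alpha>) i)"
    using nr_opt_fixed[of "Off i"] nn_integral_off[of "nr_opt Q \<alpha>" "off_value \<alpha>" i Slow]
    by (simp add: as_rule_def nr_opt_value value_nonneg)
  also have "\<dots> = ennreal (srv_cost Q (base Q) + hcost Q i + (1 - \<alpha>) * off_step (off_value \<alpha>) i)"
    using n c \<alpha> by (simp add: ennreal_mult[symmetric] ennreal_plus[symmetric] del: ennreal_plus)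
  finally show ?thesis
    using n c \<alpha> value_nonneg(2)[of i] by (subst (asm) ennreal_inj) auto
qed

lemma on_value_le:
  "on_value \<alpha> i \<le> srv_cost Q u + hcost Q i + (1 - \<alpha>) * on_step u (on_value \<alpha>) (off_value \<alpha>) i"
proof -
  have n: "0 \<le> on_step u (on_value \<alpha>) (off_value \<alpha>) i" by (intro on_step_nonneg value_nonneg)
  have c: "0 \<le> srv_cost Q u + hcost Q i" using nr_cost_nonneg[of "On i" u] by simp
  have "ennreal (on_value \<alpha> i) \<le> ennreal (srv_cost Q u + hcost Q i) +
    ennreal (1 - \<alpha>) * ennreal (on_step u (on_value \<alpha>) (off_value \<alpha>) i)"
    using nr_opt_le_deviation[of "On i" u] nn_integral_on[of "nr_opt Q \<alpha>" "on_value \<alpha>" "off_value \<alpha>" i u]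
    by (simp add: nr_opt_value value_nonneg)
  also have "\<dots> = ennreal (srv_cost Q u + hcost Q i + (1 - \<alpha>) * on_step u (on_value \<alpha>) (off_value \<alpha>) i)"
    using n c \<alpha> by (simp add: ennreal_mult[symmetric] ennreal_plus[symmetric] del: ennreal_plus)
  finally show ?thesis
    using n c \<alpha> by (subst (asm) ennreal_le_iff) auto
qed

end

section \<open>Shape of the discounted value\<close>

context vacation_queue begin

text \<open>The mean holding cost until a queue with \<open>i + 1\<close> customers, served at the baseline rate, first has
only \<open>i\<close> customers: until then, the expected time with \<open>i + j\<close> customers is \<open>rho Q ^ j / arr Q\<close>.\<close>

definition increment_bound :: "nat \<Rightarrow> real"
  where "increment_bound i = (\<Sum>j. rho Q ^ Suc j * hcost Q (i + Suc j)) / lam"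

lemma summable_increment_bound: "summable (\<lambda>j. rho Q ^ Suc j * hcost Q (i + Suc j))"
  using summable_hcost_shift[OF rho_bounds, of i] by (subst summable_Suc_iff)

text \<open>The Poisson equation in increments, without subtraction of the average cost.\<close>

lemma increment_bound_rec: "mu * increment_bound i = hcost Q (Suc i) + lam * increment_bound (Suc i)"
proof -
  let ?r = "rho Q"
  have S: "lam * increment_bound k = (\<Sum>j. ?r ^ Suc j * hcost Q (k + Suc j))" for k
    using arr_pos by (simp add: increment_bound_def del: power_Suc)
  have "(\<Sum>j. ?r ^ Suc j * hcost Q (i + Suc j)) = ?r * hcost Q (Suc i) + (\<Sum>j. ?r ^ Suc (Suc j) * hcost Q (i + Suc (Suc j)))"
    using suminf_split_head[OF summable_increment_bound[of i]] by simp
  also have "(\<Sum>j. ?r ^ Suc (Suc j) * hcost Q (i + Suc (Suc j))) = ?r * (\<Sum>j. ?r ^ Suc j * hcost Q (Suc i + Suc j))"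
    using summable_increment_bound[of "Suc i"] by (subst suminf_mult[symmetric]) (simp_all add: mult.assoc)
  finally have "lam * increment_bound i = ?r * (hcost Q (Suc i) + lam * increment_bound (Suc i))"
    by (simp only: S distrib_left)
  then have "lam * (mu * increment_bound i) = lam * (hcost Q (Suc i) + lam * increment_bound (Suc i))"
    using base_pos by (simp add: rho_def field_simps)
  moreover have "lam \<noteq> 0" using arr_pos by simp
  ultimately show ?thesis by (metis mult_left_cancel)
qed

lemma increment_bound_nonneg: "0 \<le> increment_bound i"
  unfolding increment_bound_def using arr_pos rho_bounds hcost_nonneg summable_increment_bound
  by (intro divide_nonneg_pos suminf_nonneg mult_nonneg_nonneg) auto

lemma increment_bound_mono: "mono increment_bound"
  unfolding mono_def increment_bound_def
  using arr_pos rho_bounds monoD[OF hcost_mono]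
  by (auto intro!: divide_right_mono suminf_le mult_left_mono summable_increment_bound simp del: power_Suc add_Suc_right)

end

definition backward_diff :: "(nat \<Rightarrow> real) \<Rightarrow> nat \<Rightarrow> real"
  where "backward_diff v i = v i - v (i - 1)"

lemma backward_diff_0 [simp]: "backward_diff v 0 = 0"
  by (simp add: backward_diff_def)

context discounted_optimum begin

abbreviation a :: real where "a \<equiv> 1 - \<alpha>"
abbreviation fast_gain :: real where "fast_gain \<equiv> srv Q Fast - srv Q Slow"

lemma a_bounds: "0 < a" "a < 1" "0 \<le> a" "a \<le> 1"
  using \<alpha> by auto

lemma srv_nonneg: "0 \<le> srv Q Slow" "0 \<le> srv Q Fast" "0 \<le> lam" "0 \<le> brk Q" "0 \<le> fast_gain"
  using slow_pos slow_less_fast arr_pos brk_pos by auto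

text \<open>What the fast service changes in the Bellman operator, as a function of the increment \<open>x\<close> of the value.
It is antitone, but no steeper than \<open>a * fast_gain\<close>; these two properties carry convexity through
the minimisation.\<close>

definition switch_gain :: "real \<Rightarrow> real"
  where "switch_gain x = min 0 (srv_cost Q Fast - a * fast_gain * x)"

lemma switch_gain_antimono: "x \<le> y \<Longrightarrow> switch_gain y \<le> switch_gain x"
proof -
  assume "x \<le> y"
  then have "a * fast_gain * x \<le> a * fast_gain * y"
    using a_bounds srv_nonneg by (intro mult_left_mono mult_nonneg_nonneg) auto
  then show ?thesis by (simp add: switch_gain_def)
qed

lemma switch_gain_plus_mono: "x \<le> y \<Longrightarrow> a * srv Q Fast * x + switch_gain x \<le> a * srv Q Fast * y + switch_gain y"
proof -
  assume xy: "x \<le> y"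
  have eq: "a * srv Q Fast * z + switch_gain z = min (a * srv Q Fast * z) (srv_cost Q Fast + a * srv Q Slow * z)" for z
    by (simp add: switch_gain_def min_def algebra_simps)
  have "a * srv Q Fast * x \<le> a * srv Q Fast * y" "a * srv Q Slow * x \<le> a * srv Q Slow * y"
    using xy a_bounds srv_nonneg by (intro mult_left_mono mult_nonneg_nonneg; simp)+
  then show ?thesis unfolding eq by (intro min.mono add_left_mono)
qed

lemma switch_gain_0 [simp]: "switch_gain 0 = 0"
  using fast_cost_pos by (simp add: switch_gain_def)

text \<open>Value iteration for the discounted no-repair model. The minimum over the two speeds is written as
the value of the slow speed plus the (nonpositive) gain from switching to the fast one.\<close>

primrec iter :: "nat \<Rightarrow> (nat \<Rightarrow> real) \<times> (nat \<Rightarrow> real)" where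
  "iter 0 = (\<lambda>_. 0, \<lambda>_. 0)"
| "iter (Suc n) =
    (\<lambda>i. hcost Q i + a * on_step Slow (fst (iter n)) (snd (iter n)) i + switch_gain (backward_diff (fst (iter n)) i),
     \<lambda>i. hcost Q i + a * off_step (snd (iter n)) i)"

abbreviation on_iter :: "nat \<Rightarrow> nat \<Rightarrow> real" where "on_iter n \<equiv> fst (iter n)"
abbreviation off_iter :: "nat \<Rightarrow> nat \<Rightarrow> real" where "off_iter n \<equiv> snd (iter n)"

lemma on_step_Fast: "a * on_step Fast v w i = a * on_step Slow v w i - a * fast_gain * backward_diff v i"
  by (simp add: on_step_def backward_diff_def algebra_simps)

lemma on_iter_le: "on_iter (Suc n) i \<le> srv_cost Q u + hcost Q i + a * on_step u (on_iter n) (off_iter n) i"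
  using slow_free by (cases u) (simp_all add: on_step_Fast switch_gain_def)

lemma on_iter_attained:
  obtains u where "on_iter (Suc n) i = srv_cost Q u + hcost Q i + a * on_step u (on_iter n) (off_iter n) i"
proof (cases "srv_cost Q Fast \<le> a * fast_gain * backward_diff (on_iter n) i")
  case True
  then show ?thesis by (intro that[of Fast]) (simp add: on_step_Fast switch_gain_def)
next
  case False
  then show ?thesis using slow_free by (intro that[of Slow]) (simp add: switch_gain_def)
qed

lemma off_step_eq: "off_step w i = lam * w (Suc i) + brk Q * w i + srv Q Slow * w (i - 1) + srv Q Fast * w i"
proof -
  have "1 - lam - mu = brk Q + srv Q Fast" using normalised by (simp add: base_slow)
  then show ?thesis unfolding off_step_def by (simp only: base_slow) (simp add: distrib_right)
qed

lemma on_step_Slow: "on_step Slow v w i = lam * v (Suc i) + brk Q * w i + srv Q Slow * v (i - 1) + srv Q Fast * v i"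
  by (simp add: on_step_def)

lemma on_step_diff: "on_step u v w i - on_step u v' w' i = on_step u (\<lambda>i. v i - v' i) (\<lambda>i. w i - w' i) i"
  by (simp add: on_step_def algebra_simps)

lemma off_step_diff: "off_step w i - off_step w' i = off_step (\<lambda>i. w i - w' i) i"
  by (simp add: off_step_def algebra_simps)

lemma on_step_le_const:
  assumes "\<And>j. j \<le> Suc i \<Longrightarrow> v j \<le> K" "\<And>j. j \<le> Suc i \<Longrightarrow> w j \<le> K"
  shows "on_step u v w i \<le> K"
proof -
  have "on_step u v w i \<le> lam * K + brk Q * K + srv Q u * K + (rates - srv Q u) * K"
    unfolding on_step_def using assms arr_pos brk_pos srv_pos[of u] srv_le_rates[of u]
    by (intro add_mono mult_left_mono) auto
  also have "\<dots> = (lam + srv Q Slow + srv Q Fast + brk Q) * K" by (simp add: algebra_simps)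
  finally show ?thesis using normalised by simp
qed

lemma off_step_le_const:
  assumes "\<And>j. j \<le> Suc i \<Longrightarrow> w j \<le> K"
  shows "off_step w i \<le> K"
proof -
  have "off_step w i \<le> lam * K + brk Q * K + srv Q Slow * K + srv Q Fast * K"
    unfolding off_step_eq using assms srv_nonneg by (intro add_mono mult_left_mono) auto
  also have "\<dots> = (lam + srv Q Slow + srv Q Fast + brk Q) * K" by (simp add: algebra_simps)
  finally show ?thesis using normalised by simp
qed

lemma tail_cost_Suc: "a * tail_cost a n (Suc i) = tail_cost a (Suc n) i"
  unfolding tail_cost_def using summable_ignore_initial_segment[OF summable_bound_cost[OF a_bounds(1,2), of "Suc i"], of n]
  by (subst suminf_mult[symmetric]) (auto simp: add_ac mult.assoc)

lemma summable_tail: "summable (\<lambda>m. a ^ (n + m) * (srv_cost Q Fast + hcost Q (i + (n + m))))"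
  using summable_ignore_initial_segment[OF summable_bound_cost[OF a_bounds(1,2), of i], of n] by (simp add: add_ac)

lemma tail_cost_mono: "i \<le> j \<Longrightarrow> tail_cost a n i \<le> tail_cost a n j"
  unfolding tail_cost_def using a_bounds monoD[OF hcost_mono]
  by (intro suminf_le summable_tail mult_left_mono add_left_mono) auto

lemma tail_cost_tendsto: "(\<lambda>n. tail_cost a n i) \<longlonglongrightarrow> 0"
proof -
  let ?g = "\<lambda>m. a ^ m * (srv_cost Q Fast + hcost Q (i + m))"
  have s: "summable ?g" by (rule summable_bound_cost[OF a_bounds(1,2)])
  have "tail_cost a n i = suminf ?g - sum ?g {..<n}" for n
    using suminf_minus_initial_segment[OF s, of n] by (simp add: tail_cost_def add_ac)
  moreover have "(\<lambda>n. suminf ?g - sum ?g {..<n}) \<longlonglongrightarrow> suminf ?g - suminf ?g"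
    by (intro tendsto_diff tendsto_const summable_LIMSEQ s)
  ultimately show ?thesis by simp
qed

text \<open>The error is nonnegative, and one step moves it by at most one level and discounts it, just as it
does with \<open>tail_cost\<close>.\<close>

lemma iter_error:
  "on_iter n i \<le> on_value \<alpha> i \<and> on_value \<alpha> i - on_iter n i \<le> tail_cost a n i \<and>
   off_iter n i \<le> off_value \<alpha> i \<and> off_value \<alpha> i - off_iter n i \<le> tail_cost a n i"
proof (induction n arbitrary: i)
  case 0
  then show ?case using value_nonneg value_le_tail by simp
next
  case (Suc n)
  let ?dv = "\<lambda>i. on_value \<alpha> i - on_iter n i" and ?dw = "\<lambda>i. off_value \<alpha> i - off_iter n i"
  have le: "?dv j \<le> tail_cost a n (Suc i)" "?dw j \<le> tail_cost a n (Suc i)" if "j \<le> Suc i" for j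
    using Suc[of j] tail_cost_mono[OF that, of n] by auto
  have nonneg: "0 \<le> ?dv j" "0 \<le> ?dw j" for j using Suc[of j] by auto
  have step: "a * x \<le> tail_cost a (Suc n) i" if "x \<le> tail_cost a n (Suc i)" for x
    unfolding tail_cost_Suc[symmetric] using that a_bounds by (intro mult_left_mono) auto
  have "on_iter (Suc n) i \<le> on_value \<alpha> i"
  proof -
    have "0 \<le> a * on_step (f i) ?dv ?dw i"
      using a_bounds nonneg by (intro mult_nonneg_nonneg on_step_nonneg) auto
    then show ?thesis
      using on_iter_le[of n i "f i"] on_value_fixed[of i] unfolding on_step_diff[symmetric]
      by (simp only: right_diff_distrib)
  qed
  moreover have "on_value \<alpha> i - on_iter (Suc n) i \<le> tail_cost a (Suc n) i"
  proof -
    obtain u where u: "on_iter (Suc n) i = srv_cost Q u + hcost Q i + a * on_step u (on_iter n) (off_iter n) i"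
      by (rule on_iter_attained)
    have "on_value \<alpha> i - on_iter (Suc n) i \<le> a * on_step u ?dv ?dw i"
      using on_value_le[of i u] unfolding u on_step_diff[symmetric] by (simp only: right_diff_distrib)
    also have "\<dots> \<le> tail_cost a (Suc n) i"
      by (rule step) (rule on_step_le_const[OF le])
    finally show ?thesis .
  qed
  moreover have "off_iter (Suc n) i \<le> off_value \<alpha> i"
  proof -
    have "0 \<le> a * off_step ?dw i"
      using a_bounds nonneg by (intro mult_nonneg_nonneg off_step_nonneg) auto
    then show ?thesis
      using off_value_fixed[of i] unfolding off_step_diff[symmetric]
      by (simp add: base_slow slow_free right_diff_distrib)
  qed
  moreover have "off_value \<alpha> i - off_iter (Suc n) i \<le> tail_cost a (Suc n) i"
  proof -
    have "off_value \<alpha> i - off_iter (Suc n) i = a * off_step ?dw i"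
      using off_value_fixed[of i] unfolding off_step_diff[symmetric]
      by (simp add: base_slow slow_free right_diff_distrib)
    also have "\<dots> \<le> tail_cost a (Suc n) i"
      by (rule step) (rule off_step_le_const[OF le(2)])
    finally show ?thesis .
  qed
  ultimately show ?case by blast
qed

lemma iter_tendsto: "(\<lambda>n. on_iter n i) \<longlonglongrightarrow> on_value \<alpha> i" "(\<lambda>n. off_iter n i) \<longlonglongrightarrow> off_value \<alpha> i"
proof -
  have "(\<lambda>n. on_value \<alpha> i - on_iter n i) \<longlonglongrightarrow> 0" "(\<lambda>n. off_value \<alpha> i - off_iter n i) \<longlonglongrightarrow> 0"
    using iter_error[of _ i]
    by (auto intro!: tendsto_sandwich[OF _ _ tendsto_const tail_cost_tendsto[of i]] always_eventually)
  from tendsto_diff[OF tendsto_const this(1), of "on_value \<alpha> i"] tendsto_diff[OF tendsto_const this(2), of "off_value \<alpha> i"]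
  show "(\<lambda>n. on_iter n i) \<longlonglongrightarrow> on_value \<alpha> i" "(\<lambda>n. off_iter n i) \<longlonglongrightarrow> off_value \<alpha> i" by simp_all
qed

text \<open>In terms of backward differences, which vanish at \<open>0\<close>, the conditions are: both functions are convex
and nondecreasing, the advantage \<open>w - v\<close> of a working sensor is nondecreasing and nonnegative, and the
increments of \<open>w\<close> are bounded independently of the discount rate.\<close>

definition shaped :: "(nat \<Rightarrow> real) \<Rightarrow> (nat \<Rightarrow> real) \<Rightarrow> bool"
  where "shaped v w \<longleftrightarrow> (\<forall>i. backward_diff v i \<le> backward_diff v (Suc i) \<and> backward_diff w i \<le> backward_diff w (Suc i) \<and>
     backward_diff v i \<le> backward_diff w i \<and> v i \<le> w i \<and> backward_diff w (Suc i) \<le> increment_bound i)"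

lemma backward_diff_on_iter_Suc:
  "backward_diff (on_iter (Suc n)) (Suc i) = hcost Q (Suc i) - hcost Q i +
     a * (lam * backward_diff (on_iter n) (Suc (Suc i)) + brk Q * backward_diff (off_iter n) (Suc i)
        + srv Q Slow * backward_diff (on_iter n) i + srv Q Fast * backward_diff (on_iter n) (Suc i))
     + switch_gain (backward_diff (on_iter n) (Suc i)) - switch_gain (backward_diff (on_iter n) i)"
  unfolding backward_diff_def[of "on_iter (Suc n)"]
  by (simp add: on_step_Slow) (simp add: backward_diff_def algebra_simps)

lemma backward_diff_off_iter_Suc:
  "backward_diff (off_iter (Suc n)) (Suc i) = hcost Q (Suc i) - hcost Q i +
     a * (lam * backward_diff (off_iter n) (Suc (Suc i)) + brk Q * backward_diff (off_iter n) (Suc i)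
        + srv Q Slow * backward_diff (off_iter n) i + srv Q Fast * backward_diff (off_iter n) (Suc i))"
  unfolding backward_diff_def[of "off_iter (Suc n)"]
  by (simp add: off_step_eq) (simp add: backward_diff_def algebra_simps)

text \<open>The increments of \<open>on_iter\<close> stay below those of \<open>off_iter\<close> since the minimisation can only slow down
the growth: the gain of the fast service grows with the number of customers. Convexity of
\<open>on_iter\<close> uses that the fast rate exceeds \<open>fast_gain\<close>, so that \<open>switch_gain\<close> is
compensated (\<open>switch_gain_plus_mono\<close>).\<close>

lemma shaped_iter: "shaped (on_iter n) (off_iter n)"
proof (induction n)
  case 0
  then show ?case by (simp add: shaped_def backward_diff_def increment_bound_nonneg)
next
  case (Suc n)
  let ?v = "backward_diff (on_iter n)" and ?w = "backward_diff (off_iter n)"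
  let ?v' = "backward_diff (on_iter (Suc n))" and ?w' = "backward_diff (off_iter (Suc n))"
  have mv: "?v i \<le> ?v (Suc i)" and mw: "?w i \<le> ?w (Suc i)" and vw: "?v i \<le> ?w i"
    and le: "on_iter n i \<le> off_iter n i" and X: "?w (Suc i) \<le> increment_bound i" for i
    using Suc by (auto simp: shaped_def)
  have v0: "0 \<le> ?v i" and w0: "0 \<le> ?w i" for i
    using lift_Suc_mono_le[of ?v 0 i] lift_Suc_mono_le[of ?w 0 i] mv mw by simp_all
  have h1: "hcost Q i \<le> hcost Q (Suc i)" for i using monoD[OF hcost_mono, of i "Suc i"] by simp
  note sn = srv_nonneg a_bounds
  have v'1: "?v' i \<le> ?v' (Suc i)" for i
  proof (cases i)
    case 0
    have "0 \<le> a * (lam * ?v (Suc (Suc 0)) + brk Q * ?w (Suc 0) + srv Q Slow * ?v 0)"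
      using v0 w0 sn by (intro mult_nonneg_nonneg add_nonneg_nonneg) auto
    moreover have "0 \<le> a * srv Q Fast * ?v (Suc 0) + switch_gain (?v (Suc 0))"
      using switch_gain_plus_mono[OF v0[of "Suc 0"]] by simp
    ultimately show ?thesis
      using h1[of 0] by (simp add: 0 backward_diff_on_iter_Suc distrib_left del: iter.simps)
  next
    case (Suc j)
    have "a * (lam * ?v (Suc (Suc j)) + brk Q * ?w (Suc j) + srv Q Slow * ?v j)
       \<le> a * (lam * ?v (Suc (Suc (Suc j))) + brk Q * ?w (Suc (Suc j)) + srv Q Slow * ?v (Suc j))"
      using mv mw sn by (intro mult_left_mono add_mono) auto
    moreover have "a * srv Q Fast * ?v (Suc j) + switch_gain (?v (Suc j)) \<le>
        a * srv Q Fast * ?v (Suc (Suc j)) + switch_gain (?v (Suc (Suc j)))"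
      by (rule switch_gain_plus_mono[OF mv])
    moreover have "switch_gain (?v (Suc j)) \<le> switch_gain (?v j)"
      by (rule switch_gain_antimono[OF mv])
    ultimately show ?thesis
      using hcost_convex[of j] by (simp add: Suc backward_diff_on_iter_Suc distrib_left del: iter.simps)
  qed
  have w'1: "?w' i \<le> ?w' (Suc i)" for i
  proof (cases i)
    case 0
    have "0 \<le> a * (lam * ?w (Suc (Suc 0)) + brk Q * ?w (Suc 0) + srv Q Slow * ?w 0 + srv Q Fast * ?w (Suc 0))"
      using w0 sn by (intro mult_nonneg_nonneg add_nonneg_nonneg) auto
    then show ?thesis
      using h1[of 0] by (simp add: 0 backward_diff_off_iter_Suc del: iter.simps)
  next
    case (Suc j)
    have "a * (lam * ?w (Suc (Suc j)) + brk Q * ?w (Suc j) + srv Q Slow * ?w j + srv Q Fast * ?w (Suc j))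
       \<le> a * (lam * ?w (Suc (Suc (Suc j))) + brk Q * ?w (Suc (Suc j)) + srv Q Slow * ?w (Suc j) + srv Q Fast * ?w (Suc (Suc j)))"
      using mw sn by (intro mult_left_mono add_mono) auto
    then show ?thesis
      using hcost_convex[of j] by (simp add: Suc backward_diff_off_iter_Suc del: iter.simps)
  qed
  have vw': "?v' i \<le> ?w' i" for i
  proof (cases i)
    case (Suc j)
    have "a * (lam * ?v (Suc (Suc j)) + brk Q * ?w (Suc j) + srv Q Slow * ?v j + srv Q Fast * ?v (Suc j))
       \<le> a * (lam * ?w (Suc (Suc j)) + brk Q * ?w (Suc j) + srv Q Slow * ?w j + srv Q Fast * ?w (Suc j))"
      using vw sn by (intro mult_left_mono add_mono) auto
    then show ?thesis
      using switch_gain_antimono[OF mv[of j]] by (simp add: Suc backward_diff_on_iter_Suc backward_diff_off_iter_Suc del: iter.simps)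
  qed simp
  have le': "on_iter (Suc n) i \<le> off_iter (Suc n) i" for i
  proof -
    have "a * on_step Slow (on_iter n) (off_iter n) i \<le> a * off_step (off_iter n) i"
      unfolding on_step_Slow off_step_eq using le sn by (intro mult_left_mono add_mono) auto
    moreover have "switch_gain (?v i) \<le> 0" by (simp add: switch_gain_def)
    ultimately show ?thesis by simp
  qed
  have X': "?w' (Suc i) \<le> increment_bound i" for i
  proof -
    let ?S = "lam * ?w (Suc (Suc i)) + brk Q * ?w (Suc i) + srv Q Slow * ?w i + srv Q Fast * ?w (Suc i)"
    have "0 \<le> ?S" using w0 sn by (intro mult_nonneg_nonneg add_nonneg_nonneg) auto
    then have "a * ?S \<le> ?S" using a_bounds mult_right_mono[of a 1 ?S] by simp
    also have "\<dots> \<le> lam * increment_bound (Suc i) + brk Q * increment_bound i + (hcost Q i + lam * increment_bound i) + srv Q Fast * increment_bound i"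
    proof (intro add_mono mult_left_mono X sn)
      show "srv Q Slow * ?w i \<le> hcost Q i + lam * increment_bound i"
      proof (cases i)
        case 0
        then show ?thesis using sn increment_bound_nonneg[of 0] hcost_nonneg[of 0] by simp
      next
        case (Suc j)
        have "srv Q Slow * ?w i \<le> srv Q Slow * increment_bound j"
          unfolding Suc using sn by (intro mult_left_mono X)
        then show ?thesis using increment_bound_rec[of j] by (simp add: Suc base_slow)
      qed
    qed
    also have "\<dots> = hcost Q i + (lam * increment_bound (Suc i) + (brk Q + lam + srv Q Fast) * increment_bound i)"
      by (simp add: algebra_simps)
    also have "brk Q + lam + srv Q Fast = 1 - srv Q Slow" using normalised by simp
    also have "lam * increment_bound (Suc i) = srv Q Slow * increment_bound i - hcost Q (Suc i)"
      using increment_bound_rec[of i] by (simp add: base_slow)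
    finally show ?thesis
      unfolding backward_diff_off_iter_Suc by (simp add: algebra_simps)
  qed
  show ?case
    unfolding shaped_def using v'1 w'1 vw' le' X' by blast
qed

lemma shaped_value: "shaped (on_value \<alpha>) (off_value \<alpha>)"
  unfolding shaped_def backward_diff_def
proof (intro allI conjI)
  fix i
  have v: "(\<lambda>n. on_iter n i) \<longlonglongrightarrow> on_value \<alpha> i" and w: "(\<lambda>n. off_iter n i) \<longlonglongrightarrow> off_value \<alpha> i" for i
    by (rule iter_tendsto)+
  note s = shaped_iter[unfolded shaped_def backward_diff_def, rule_format]
  show "on_value \<alpha> i - on_value \<alpha> (i - 1) \<le> on_value \<alpha> (Suc i) - on_value \<alpha> (Suc i - 1)"
    by (intro tendsto_le[OF sequentially_bot tendsto_diff[OF v v] tendsto_diff[OF v v]] always_eventually allI) (use s in blast)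
  show "off_value \<alpha> i - off_value \<alpha> (i - 1) \<le> off_value \<alpha> (Suc i) - off_value \<alpha> (Suc i - 1)"
    by (intro tendsto_le[OF sequentially_bot tendsto_diff[OF w w] tendsto_diff[OF w w]] always_eventually allI) (use s in blast)
  show "on_value \<alpha> i - on_value \<alpha> (i - 1) \<le> off_value \<alpha> i - off_value \<alpha> (i - 1)"
    by (intro tendsto_le[OF sequentially_bot tendsto_diff[OF w w] tendsto_diff[OF v v]] always_eventually allI) (use s in blast)
  show "on_value \<alpha> i \<le> off_value \<alpha> i"
    by (intro tendsto_le[OF sequentially_bot w v] always_eventually allI) (use s in blast)
  show "off_value \<alpha> (Suc i) - off_value \<alpha> (Suc i - 1) \<le> increment_bound i"
    by (intro tendsto_le[OF sequentially_bot tendsto_const tendsto_diff[OF w w]] always_eventually allI) (use s in blast)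
qed

end

section \<open>Vanishing discount\<close>

lemma tendsto_Lim_self:
  assumes "F \<noteq> bot" "(g \<longlongrightarrow> x) F"
  shows "(g \<longlongrightarrow> Lim F g) F"
  using assms by (simp add: tendsto_Lim)

context discounted_optimum begin

abbreviation off_incr :: "nat \<Rightarrow> real" where "off_incr \<equiv> backward_diff (off_value \<alpha>)"

lemma
  shows off_incr_le: "off_incr i \<le> increment_bound i"
    and off_incr_nonneg: "0 \<le> off_incr i"
    and on_incr_nonneg: "0 \<le> backward_diff (on_value \<alpha>) i"
    and on_incr_le: "backward_diff (on_value \<alpha>) i \<le> off_incr i"
    and on_le_off: "on_value \<alpha> i \<le> off_value \<alpha> i"
proof -
  note s = shaped_value[unfolded shaped_def, rule_format]
  show "0 \<le> off_incr i" "0 \<le> backward_diff (on_value \<alpha>) i" for i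
    using lift_Suc_mono_le[of off_incr 0 i] lift_Suc_mono_le[of "backward_diff (on_value \<alpha>)" 0 i] s by auto
  show "off_incr i \<le> increment_bound i" "backward_diff (on_value \<alpha>) i \<le> off_incr i" "on_value \<alpha> i \<le> off_value \<alpha> i"
    using s[of i] by auto
qed

lemma off_incr_Suc_le: "off_incr (Suc i) \<le> increment_bound i"
  using shaped_value by (auto simp: shaped_def)

lemma off_value_poisson:
  "\<alpha> * off_value \<alpha> i = hcost Q i + a * (lam * off_incr (Suc i) - mu * off_incr i)"
proof -
  define L where "L = lam * off_incr (Suc i) - mu * off_incr i"
  have "off_step (off_value \<alpha>) i = off_value \<alpha> i + L"
    by (simp add: L_def off_step_def backward_diff_def algebra_simps)
  then have "off_value \<alpha> i = hcost Q i + a * (off_value \<alpha> i + L)"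
    using off_value_fixed[of i] by (simp add: base_slow slow_free)
  then show ?thesis unfolding L_def[symmetric] by (simp add: algebra_simps)
qed

lemma off_value_sum: "off_value \<alpha> i = off_value \<alpha> 0 + (\<Sum>j<i. off_incr (Suc j))"
  by (induction i) (simp_all add: backward_diff_def)

lemma off_value_ge: "off_value \<alpha> 0 \<le> off_value \<alpha> i"
  unfolding off_value_sum[of i] using off_incr_nonneg by (simp add: sum_nonneg)

text \<open>Detailed balance makes the differences in \<open>off_value_poisson\<close> telescope.\<close>

lemma stationary_partial_sum:
  "(\<Sum>i\<le>N. stat_dist Q i * (\<alpha> * off_value \<alpha> i)) =
    (\<Sum>i\<le>N. stat_dist Q i * hcost Q i) + a * (lam * stat_dist Q N * off_incr (Suc N))"
proof (induction N)
  case 0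
  then show ?case unfolding off_value_poisson by (simp add: algebra_simps)
next
  case (Suc N)
  have "stat_dist Q (Suc N) * (\<alpha> * off_value \<alpha> (Suc N)) = stat_dist Q (Suc N) * hcost Q (Suc N) +
     a * (lam * stat_dist Q (Suc N) * off_incr (Suc (Suc N))) - a * ((mu * stat_dist Q (Suc N)) * off_incr (Suc N))"
    unfolding off_value_poisson by (simp add: algebra_simps)
  then show ?case
    unfolding sum.atMost_Suc Suc stat_dist_balance by (simp add: algebra_simps)
qed

end

context vacation_queue begin

definition mean_hcost :: real where "mean_hcost = (\<Sum>i. stat_dist Q i * hcost Q i)"

lemma summable_mean_hcost: "summable (\<lambda>i. stat_dist Q i * hcost Q i)"
  using summable_mult[OF summable_hcost_shift[OF rho_bounds, of 0], of "1 - rho Q"]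
  by (simp add: stat_dist_def mult.assoc)

text \<open>The remainder of the stationary mean is the boundary term of \<open>stationary_partial_sum\<close> at the bound for
the increments. This makes the upper estimate of the average cost exact.\<close>

lemma mean_hcost_split:
  "mean_hcost = (\<Sum>i\<le>N. stat_dist Q i * hcost Q i) + lam * stat_dist Q N * increment_bound N"
proof -
  have "lam * stat_dist Q N * increment_bound N = stat_dist Q N * (\<Sum>j. rho Q ^ Suc j * hcost Q (N + Suc j))"
    using arr_pos by (simp add: increment_bound_def)
  also have "\<dots> = (\<Sum>j. stat_dist Q N * (rho Q ^ Suc j * hcost Q (N + Suc j)))"
    by (rule suminf_mult[symmetric, OF summable_increment_bound])
  also have "\<dots> = (\<Sum>j. stat_dist Q (j + Suc N) * hcost Q (j + Suc N))"
    by (simp add: stat_dist_def power_add mult_ac add_ac)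
  finally show ?thesis
    using suminf_split_initial_segment[OF summable_mean_hcost, of "Suc N"]
    by (simp add: mean_hcost_def lessThan_Suc_atMost)
qed

lemma hcost_exponential_bound:
  assumes "0 < y" "y < 1"
  obtains C where "0 \<le> C" "\<And>n. hcost Q n * y ^ n \<le> C"
proof -
  have "Bseq (\<lambda>n. hcost Q n * y ^ n)"
    using hcost_growth[OF assms] by (intro convergent_imp_Bseq) (auto simp: convergent_def dest: summable_LIMSEQ_zero)
  then obtain C where "0 < C" "\<And>n. norm (hcost Q n * y ^ n) \<le> C"
    by (auto elim: BseqE)
  then show ?thesis
    using that[of C] by (smt (verit) real_norm_def)
qed

text \<open>The holding cost grows more slowly than any exponential \<open>(1 / y) ^ n\<close> with \<open>y < 1\<close>; take \<open>y\<close>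
between \<open>max (rho Q) q\<close> and \<open>1\<close>.\<close>

lemma summable_increment_bound_geometric:
  assumes q: "0 \<le> q" "q < 1"
  shows "summable (\<lambda>k. q ^ k * increment_bound (i + k))"
proof -
  define y where "y = (1 + max (rho Q) q) / 2"
  have y: "0 < y" "y < 1" "rho Q < y" "q < y"
    using rho_bounds q by (auto simp: y_def max_def)
  obtain C where C: "0 \<le> C" "\<And>n. hcost Q n * y ^ n \<le> C"
    using hcost_exponential_bound[OF y(1,2)] by blast
  have h: "hcost Q n \<le> C / y ^ n" for n
    using C(2)[of n] y by (simp add: field_simps)
  define S where "S = (\<Sum>j. (rho Q / y) ^ Suc j)"
  have s: "summable (\<lambda>j. (rho Q / y) ^ Suc j)"
    using y rho_bounds by (subst summable_Suc_iff) (auto intro!: summable_geometric)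
  have X: "increment_bound m \<le> C * S / lam * (1 / y) ^ m" for m
  proof -
    have "(\<Sum>j. rho Q ^ Suc j * hcost Q (m + Suc j)) \<le> (\<Sum>j. (C / y ^ m) * (rho Q / y) ^ Suc j)"
    proof (intro suminf_le summable_increment_bound summable_mult s)
      fix j
      have "rho Q ^ Suc j * hcost Q (m + Suc j) \<le> rho Q ^ Suc j * (C / y ^ (m + Suc j))"
        using rho_bounds by (intro mult_left_mono h) auto
      then show "rho Q ^ Suc j * hcost Q (m + Suc j) \<le> C / y ^ m * (rho Q / y) ^ Suc j"
        using y by (simp add: power_add power_divide field_simps)
    qed
    also have "\<dots> = C / y ^ m * S" unfolding S_def by (rule suminf_mult[OF s])
    finally show ?thesis
      using arr_pos by (simp add: increment_bound_def divide_right_mono power_one_over field_simps)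
  qed
  show ?thesis
  proof (rule summable_comparison_test')
    show "summable (\<lambda>k. C * S / lam * (1 / y) ^ i * (q / y) ^ k)"
      using y q by (intro summable_mult summable_geometric) auto
    fix k
    have "q ^ k * increment_bound (i + k) \<le> q ^ k * (C * S / lam * (1 / y) ^ (i + k))"
      using q by (intro mult_left_mono X) auto
    also have "\<dots> = C * S / lam * (1 / y) ^ i * (q / y) ^ k"
      by (simp add: power_add power_divide ac_simps)
    finally show "norm (q ^ k * increment_bound (i + k)) \<le> C * S / lam * (1 / y) ^ i * (q / y) ^ k"
      using q increment_bound_nonneg[of "i + k"] by simp
  qed
qed

end

locale vanishing_discount = vacation_queue +
  fixes f :: "nat \<Rightarrow> speed"
  assumes optimal_near_0: "\<forall>\<^sub>F \<alpha> in at_right 0. discounted_optimum Q f \<alpha>"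
begin

lemma stat_dist_partial_le_1: "(\<Sum>i\<le>N. stat_dist Q i) \<le> 1"
  using stat_dist_sums stat_dist_nonneg sum_le_suminf[of "stat_dist Q" "{..N}"] by (auto simp: sums_iff)

text \<open>Both estimates come from \<open>stationary_partial_sum\<close>. Since the value is least at \<open>0\<close>, the rate never
exceeds the stationary mean; since its increments are bounded uniformly, the value at \<open>0\<close> differs
little, after multiplication with the discount rate, from the values on any finite set.\<close>

lemma discounted_rate_tendsto: "((\<lambda>\<alpha>. \<alpha> * off_value \<alpha> 0) \<longlongrightarrow> mean_hcost) (at_right 0)"
proof (rule order_tendstoI)
  fix u assume "mean_hcost < u"
  show "\<forall>\<^sub>F \<alpha> in at_right 0. \<alpha> * off_value \<alpha> 0 < u"
    using optimal_near_0
  proof eventually_elim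
    fix \<alpha> assume "discounted_optimum Q f \<alpha>"
    then interpret discounted_optimum Q f \<alpha> .
    have "(\<Sum>i\<le>N. stat_dist Q i) * (\<alpha> * off_value \<alpha> 0) \<le> mean_hcost" for N
    proof -
      have "(\<Sum>i\<le>N. stat_dist Q i) * (\<alpha> * off_value \<alpha> 0) \<le> (\<Sum>i\<le>N. stat_dist Q i * (\<alpha> * off_value \<alpha> i))"
        unfolding sum_distrib_right using stat_dist_nonneg off_value_ge \<alpha>
        by (intro sum_mono mult_left_mono) auto
      also have "\<dots> \<le> (\<Sum>i\<le>N. stat_dist Q i * hcost Q i) + 1 * (lam * stat_dist Q N * increment_bound N)"
        unfolding stationary_partial_sum using a_bounds srv_nonneg stat_dist_nonneg off_incr_Suc_le off_incr_nonneg
        by (intro add_left_mono mult_mono) (auto intro!: mult_nonneg_nonneg)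
      finally show ?thesis using mean_hcost_split[of N] by simp
    qed
    moreover have "(\<lambda>N. (\<Sum>i\<le>N. stat_dist Q i) * (\<alpha> * off_value \<alpha> 0)) \<longlonglongrightarrow> 1 * (\<alpha> * off_value \<alpha> 0)"
      using stat_dist_sums by (intro tendsto_mult tendsto_const) (simp add: sums_def_le)
    ultimately have "1 * (\<alpha> * off_value \<alpha> 0) \<le> mean_hcost"
      by (intro LIMSEQ_le_const2) auto
    then show "\<alpha> * off_value \<alpha> 0 < u" using \<open>mean_hcost < u\<close> by simp
  qed
next
  fix l assume l: "l < mean_hcost"
  have "(\<lambda>N. \<Sum>i\<le>N. stat_dist Q i * hcost Q i) \<longlonglongrightarrow> mean_hcost"
    using summable_mean_hcost unfolding mean_hcost_def by (rule summable_LIMSEQ')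
  then have "\<forall>\<^sub>F N in sequentially. l < (\<Sum>i\<le>N. stat_dist Q i * hcost Q i)"
    using l by (rule order_tendstoD)
  then obtain N where N: "l < (\<Sum>i\<le>N. stat_dist Q i * hcost Q i)"
    by (auto simp: eventually_sequentially)
  define Y where "Y = (\<Sum>j<N. increment_bound j)"
  have "((\<lambda>\<alpha>::real. (\<Sum>i\<le>N. stat_dist Q i * hcost Q i) - \<alpha> * Y) \<longlongrightarrow> (\<Sum>i\<le>N. stat_dist Q i * hcost Q i) - 0 * Y) (at_right 0)"
    by (intro tendsto_intros)
  then have "\<forall>\<^sub>F \<alpha> in at_right 0. l < (\<Sum>i\<le>N. stat_dist Q i * hcost Q i) - \<alpha> * Y"
    using N by (intro order_tendstoD) auto
  then show "\<forall>\<^sub>F \<alpha> in at_right 0. l < \<alpha> * off_value \<alpha> 0"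
    using optimal_near_0
  proof eventually_elim
    fix \<alpha> assume l: "l < (\<Sum>i\<le>N. stat_dist Q i * hcost Q i) - \<alpha> * Y" and "discounted_optimum Q f \<alpha>"
    interpret discounted_optimum Q f \<alpha> by fact
    have "off_value \<alpha> i \<le> off_value \<alpha> 0 + Y" if "i \<le> N" for i
    proof -
      have "(\<Sum>j<i. off_incr (Suc j)) \<le> (\<Sum>j<i. increment_bound j)"
        by (intro sum_mono off_incr_Suc_le)
      also have "\<dots> \<le> Y"
        unfolding Y_def using that increment_bound_nonneg by (intro sum_mono2) auto
      finally show ?thesis by (simp add: off_value_sum[of i])
    qed
    then have "(\<Sum>i\<le>N. stat_dist Q i * (\<alpha> * off_value \<alpha> i)) \<le> (\<Sum>i\<le>N. stat_dist Q i * (\<alpha> * (off_value \<alpha> 0 + Y)))"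
      using stat_dist_nonneg \<alpha> by (intro sum_mono mult_left_mono) auto
    also have "\<dots> = (\<Sum>i\<le>N. stat_dist Q i) * (\<alpha> * (off_value \<alpha> 0 + Y))"
      by (simp add: sum_distrib_right)
    also have "\<dots> \<le> 1 * (\<alpha> * (off_value \<alpha> 0 + Y))"
      using \<alpha> value_nonneg increment_bound_nonneg stat_dist_partial_le_1
      by (intro mult_right_mono) (auto simp: Y_def sum_nonneg)
    finally have "(\<Sum>i\<le>N. stat_dist Q i * hcost Q i) \<le> \<alpha> * (off_value \<alpha> 0 + Y)"
    proof -
      assume *: "(\<Sum>i\<le>N. stat_dist Q i * (\<alpha> * off_value \<alpha> i)) \<le> 1 * (\<alpha> * (off_value \<alpha> 0 + Y))"
      have "0 \<le> a * (lam * stat_dist Q N * off_incr (Suc N))"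
        using a_bounds srv_nonneg stat_dist_nonneg off_incr_nonneg by (intro mult_nonneg_nonneg) auto
      then show ?thesis using * unfolding stationary_partial_sum by simp
    qed
    then show "l < \<alpha> * off_value \<alpha> 0" using l by (simp add: distrib_left)
  qed
qed

lemma tendsto_a: "((\<lambda>\<alpha>::real. 1 - \<alpha>) \<longlongrightarrow> 1) (at_right 0)"
  by (auto intro!: tendsto_eq_intros)

text \<open>Solved for the next increment, \<open>off_value_poisson\<close> is a recursion that starts with the convergent
discounted rate.\<close>

lemma off_incr_converges:
  "((\<lambda>\<alpha>. \<alpha> * off_value \<alpha> i) \<longlongrightarrow> mean_hcost) (at_right 0) \<and>
   (\<exists>l. ((\<lambda>\<alpha>. backward_diff (off_value \<alpha>) i) \<longlongrightarrow> l) (at_right 0))"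
proof (induction i)
  case 0
  then show ?case using discounted_rate_tendsto by auto
next
  case (Suc i)
  then obtain l where l: "((\<lambda>\<alpha>. backward_diff (off_value \<alpha>) i) \<longlongrightarrow> l) (at_right 0)" by blast
  have "((\<lambda>\<alpha>. (\<alpha> * off_value \<alpha> i - hcost Q i + (1 - \<alpha>) * (mu * backward_diff (off_value \<alpha>) i)) / ((1 - \<alpha>) * lam))
    \<longlongrightarrow> (mean_hcost - hcost Q i + 1 * (mu * l)) / (1 * lam)) (at_right 0)"
    using Suc l tendsto_a arr_pos by (intro tendsto_intros) auto
  moreover have "\<forall>\<^sub>F \<alpha> in at_right 0. (\<alpha> * off_value \<alpha> i - hcost Q i + (1 - \<alpha>) * (mu * backward_diff (off_value \<alpha>) i)) / ((1 - \<alpha>) * lam)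
     = backward_diff (off_value \<alpha>) (Suc i)"
    using optimal_near_0
  proof eventually_elim
    fix \<alpha> assume "discounted_optimum Q f \<alpha>"
    then interpret discounted_optimum Q f \<alpha> .
    have eq: "\<alpha> * off_value \<alpha> i - hcost Q i + a * (mu * off_incr i) = off_incr (Suc i) * (a * lam)"
      unfolding off_value_poisson by (simp add: algebra_simps)
    have "a * lam \<noteq> 0" using a_bounds arr_pos by simp
    then show "(\<alpha> * off_value \<alpha> i - hcost Q i + a * (mu * off_incr i)) / (a * lam) = off_incr (Suc i)"
      unfolding eq by (rule nonzero_mult_div_cancel_right)
  qed
  ultimately have e: "((\<lambda>\<alpha>. backward_diff (off_value \<alpha>) (Suc i)) \<longlongrightarrow> (mean_hcost - hcost Q i + 1 * (mu * l)) / (1 * lam)) (at_right 0)"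
    by (rule Lim_transform_eventually)
  have "((\<lambda>\<alpha>. \<alpha> * off_value \<alpha> i + \<alpha> * backward_diff (off_value \<alpha>) (Suc i)) \<longlongrightarrow>
      mean_hcost + 0 * ((mean_hcost - hcost Q i + 1 * (mu * l)) / (1 * lam))) (at_right 0)"
    using Suc e by (intro tendsto_intros) auto
  then have "((\<lambda>\<alpha>. \<alpha> * off_value \<alpha> (Suc i)) \<longlongrightarrow> mean_hcost) (at_right 0)"
    by (simp add: backward_diff_def algebra_simps)
  with e show ?case by blast
qed

definition limit_incr :: "nat \<Rightarrow> real"
  where "limit_incr i = Lim (at_right 0) (\<lambda>\<alpha>. backward_diff (off_value \<alpha>) i)"

lemma limit_incr: "((\<lambda>\<alpha>. backward_diff (off_value \<alpha>) i) \<longlongrightarrow> limit_incr i) (at_right 0)"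
  using off_incr_converges[of i] unfolding limit_incr_def
  by (auto intro: tendsto_Lim_self[OF trivial_limit_at_right_real])

lemma H_inf_Off: "((\<lambda>\<alpha>. off_value \<alpha> i - off_value \<alpha> 0) \<longlongrightarrow> H_inf Q (Off i)) (at_right 0)"
proof -
  have "off_value \<alpha> i - off_value \<alpha> 0 = (\<Sum>j<i. backward_diff (off_value \<alpha>) (Suc j))" for \<alpha>
    by (induction i) (simp_all add: backward_diff_def)
  then have "((\<lambda>\<alpha>. off_value \<alpha> i - off_value \<alpha> 0) \<longlongrightarrow> (\<Sum>j<i. limit_incr (Suc j))) (at_right 0)"
    by (simp only:) (intro tendsto_sum limit_incr)
  then show ?thesis
    unfolding H_inf_def off_value_def[symmetric] by (rule tendsto_Lim_self[OF trivial_limit_at_right_real])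
qed

text \<open>The transitions of the control policy \<open>f\<close> in which the sensor survives.\<close>

definition working_step :: "(nat \<Rightarrow> real) \<Rightarrow> nat \<Rightarrow> real"
  where "working_step u i = on_step (f i) u (\<lambda>_. 0) i"

lemma working_step_eq: "working_step u i = lam * u (Suc i) + srv Q (f i) * u (i - 1) + (rates - srv Q (f i)) * u i"
  by (simp add: working_step_def on_step_def)

lemma working_step_pow_bound:
  assumes "\<And>j. \<bar>u j\<bar> \<le> B j" "mono B"
  shows "\<bar>(working_step ^^ n) u i\<bar> \<le> (1 - brk Q) ^ n * B (i + n)"
proof (induction n arbitrary: i)
  case 0
  then show ?case using assms by simp
next
  case (Suc n)
  let ?v = "(working_step ^^ n) u" and ?K = "(1 - brk Q) ^ n * B (Suc i + n)"
  have q: "0 \<le> 1 - brk Q" using normalised slow_pos slow_less_fast arr_pos by simp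
  have m: "0 \<le> srv Q (f i)" "0 \<le> rates - srv Q (f i)" using srv_pos[of "f i"] srv_le_rates[of "f i"] by auto
  have b: "\<bar>?v j\<bar> \<le> ?K" if "j \<le> Suc i" for j
  proof -
    have "\<bar>?v j\<bar> \<le> (1 - brk Q) ^ n * B (j + n)" by (rule Suc)
    also have "\<dots> \<le> ?K" using q that by (intro mult_left_mono monoD[OF assms(2)]) auto
    finally show ?thesis .
  qed
  have "\<bar>working_step ?v i\<bar> \<le> \<bar>lam * ?v (Suc i)\<bar> + \<bar>srv Q (f i) * ?v (i - 1)\<bar> + \<bar>(rates - srv Q (f i)) * ?v i\<bar>"
    unfolding working_step_eq by linarith
  also have "\<dots> \<le> lam * ?K + srv Q (f i) * ?K + (rates - srv Q (f i)) * ?K"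
    unfolding abs_mult using m arr_pos b by (intro add_mono mult_mono) auto
  also have "\<dots> = (lam + rates) * ?K" by (simp add: algebra_simps)
  also have "lam + rates = 1 - brk Q" using normalised by simp
  finally show ?case by (simp add: mult.assoc)
qed

lemma working_step_linear: "working_step (\<lambda>i. c * u i + v i) i = c * working_step u i + working_step v i"
  by (simp add: working_step_def on_step_def algebra_simps)

lemma working_step_pow_linear: "(working_step ^^ n) (\<lambda>i. c * u i + v i) = (\<lambda>i. c * (working_step ^^ n) u i + (working_step ^^ n) v i)"
  by (induction n) (simp_all add: working_step_linear)

lemma working_step_pow_tendsto:
  assumes "\<And>j. ((\<lambda>\<alpha>. u \<alpha> j) \<longlongrightarrow> l j) F"
  shows "((\<lambda>\<alpha>. (working_step ^^ n) (u \<alpha>) i) \<longlongrightarrow> (working_step ^^ n) l i) F"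
proof (induction n arbitrary: i)
  case (Suc n)
  have "((\<lambda>\<alpha>. lam * (working_step ^^ n) (u \<alpha>) (Suc i) + srv Q (f i) * (working_step ^^ n) (u \<alpha>) (i - 1) + (rates - srv Q (f i)) * (working_step ^^ n) (u \<alpha>) i)
    \<longlongrightarrow> lam * (working_step ^^ n) l (Suc i) + srv Q (f i) * (working_step ^^ n) l (i - 1) + (rates - srv Q (f i)) * (working_step ^^ n) l i) F"
    by (intro tendsto_intros Suc)
  then show ?case by (simp add: working_step_eq[of "(working_step ^^ n) _"])
qed (simp add: assms)

text \<open>The saving per step from controlling a queue with working sensor by \<open>f\<close> instead of serving at the
slow rate.\<close>

definition advantage_rate :: "real \<Rightarrow> (nat \<Rightarrow> real) \<Rightarrow> nat \<Rightarrow> real"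
  where "advantage_rate \<alpha> e i = (1 - \<alpha>) * ((srv Q (f i) - srv Q Slow) * e i) - srv_cost Q (f i)"

definition advantage_bound :: "nat \<Rightarrow> real"
  where "advantage_bound i = (srv Q Fast - srv Q Slow) * increment_bound i + srv_cost Q Fast"

lemma advantage_bound_mono: "mono advantage_bound"
  unfolding advantage_bound_def mono_def
  using monoD[OF increment_bound_mono] slow_less_fast by (auto intro!: mult_left_mono)

text \<open>The advantage of a working sensor is the total saving until the sensor breaks down. In the remainder
of the iterated equation, the advantage is bounded by the value and is discounted as \<open>tail_cost\<close>.\<close>

lemma advantage_series:
  assumes "discounted_optimum Q f \<alpha>"
  defines "r \<equiv> advantage_rate \<alpha> (backward_diff (off_value \<alpha>))"
  shows "(\<lambda>n. (1 - \<alpha>) ^ n * (working_step ^^ n) r i) sums (off_value \<alpha> i - on_value \<alpha> i)"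
    and "\<bar>r j\<bar> \<le> advantage_bound j"
proof -
  interpret discounted_optimum Q f \<alpha> by fact
  define D where "D i = off_value \<alpha> i - on_value \<alpha> i" for i
  have D: "D i = a * working_step D i + r i" for i
  proof -
    have "D i = a * off_step (off_value \<alpha>) i - a * on_step (f i) (on_value \<alpha>) (off_value \<alpha>) i - srv_cost Q (f i)"
      unfolding D_def using on_value_fixed[of i] off_value_fixed[of i] slow_free by (simp add: base_slow)
    moreover have "off_step (off_value \<alpha>) i - on_step (f i) (on_value \<alpha>) (off_value \<alpha>) i =
        working_step D i + (srv Q (f i) - srv Q Slow) * off_incr i"
      unfolding off_step_eq on_step_def working_step_eq D_def backward_diff_def by (simp add: algebra_simps)
    ultimately show ?thesis
      by (simp add: r_def advantage_rate_def right_diff_distrib[symmetric] distrib_left[symmetric])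
  qed
  have D_ext: "D = (\<lambda>i. a * working_step D i + r i)" using D by (rule ext)
  have iterate: "D i = (\<Sum>n<N. a ^ n * (working_step ^^ n) r i) + a ^ N * (working_step ^^ N) D i" for N
  proof (induction N)
    case (Suc N)
    have "(working_step ^^ N) D i = (working_step ^^ N) (\<lambda>i. a * working_step D i + r i) i"
      by (rule arg_cong[OF D_ext, of "\<lambda>u. (working_step ^^ N) u i"])
    also have "\<dots> = a * (working_step ^^ Suc N) D i + (working_step ^^ N) r i"
      unfolding working_step_pow_linear by (simp add: funpow_swap1)
    finally have step: "(working_step ^^ N) D i = a * (working_step ^^ Suc N) D i + (working_step ^^ N) r i" .
    show ?case
      by (subst Suc, subst step) (simp only: sum.lessThan_Suc distrib_left power_Suc mult_ac add_ac)
  qed simp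
  have "(\<lambda>N. a ^ N * (working_step ^^ N) D i) \<longlonglongrightarrow> 0"
  proof (rule Lim_null_comparison[OF _ tail_cost_tendsto[of i]])
    have "\<bar>a ^ N * (working_step ^^ N) D i\<bar> \<le> tail_cost a N i" for N
    proof -
      have Db: "\<bar>D j\<bar> \<le> tail_cost a 0 j" for j
        using on_le_off[of j] value_nonneg[of j] value_le_tail[of j] by (simp add: D_def)
      have "\<bar>(working_step ^^ N) D i\<bar> \<le> (1 - brk Q) ^ N * tail_cost a 0 (i + N)"
        by (rule working_step_pow_bound[OF Db]) (auto simp: mono_def intro: tail_cost_mono)
      also have "\<dots> \<le> 1 * tail_cost a 0 (i + N)"
        using normalised slow_pos slow_less_fast arr_pos brk_pos tail_cost_nonneg
        by (intro mult_right_mono power_le_one) auto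
      finally have "\<bar>a ^ N * (working_step ^^ N) D i\<bar> \<le> a ^ N * tail_cost a 0 (i + N)"
        using a_bounds by (simp add: abs_mult mult_left_mono)
      also have "a ^ N * tail_cost a 0 (i + N) = tail_cost a N i"
      proof (induction N arbitrary: i)
        case (Suc N)
        have "a ^ Suc N * tail_cost a 0 (i + Suc N) = a * (a ^ N * tail_cost a 0 (Suc i + N))" by simp
        also have "\<dots> = tail_cost a (Suc N) i" unfolding Suc tail_cost_Suc ..
        finally show ?case .
      qed simp
      finally show ?thesis .
    qed
    then show "\<forall>\<^sub>F N in sequentially. norm (a ^ N * (working_step ^^ N) D i) \<le> tail_cost a N i" by simp
  qed
  then have "(\<lambda>N. D i - a ^ N * (working_step ^^ N) D i) \<longlonglongrightarrow> D i - 0"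
    by (intro tendsto_intros)
  moreover have "D i - a ^ N * (working_step ^^ N) D i = (\<Sum>n<N. a ^ n * (working_step ^^ n) r i)" for N
    using iterate[of N] by simp
  ultimately show "(\<lambda>n. a ^ n * (working_step ^^ n) r i) sums (off_value \<alpha> i - on_value \<alpha> i)"
    unfolding sums_def D_def[symmetric] by simp
  have m: "0 \<le> srv Q (f j) - srv Q Slow" "srv Q (f j) - srv Q Slow \<le> srv Q Fast - srv Q Slow"
    using slow_less_fast by (cases "f j"; simp)+
  have "0 \<le> a * ((srv Q (f j) - srv Q Slow) * off_incr j)"
    using a_bounds m off_incr_nonneg by (intro mult_nonneg_nonneg) auto
  moreover have "a * ((srv Q (f j) - srv Q Slow) * off_incr j) \<le> 1 * ((srv Q Fast - srv Q Slow) * increment_bound j)"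
    using a_bounds m off_incr_nonneg off_incr_le by (intro mult_mono mult_nonneg_nonneg) auto
  ultimately show "\<bar>r j\<bar> \<le> advantage_bound j"
    using srv_cost_nonneg[of "f j"] srv_cost_le[of "f j"] unfolding r_def advantage_rate_def advantage_bound_def by simp
qed

text \<open>Breakdowns provide a geometric factor that does not depend on the discount rate, and the savings are
bounded uniformly with subexponential growth. So the limit may be taken inside the series.\<close>

lemma advantage_converges: "\<exists>l. ((\<lambda>\<alpha>. off_value \<alpha> i - on_value \<alpha> i) \<longlongrightarrow> l) (at_right 0)"
proof -
  let ?r = "\<lambda>\<alpha>. advantage_rate \<alpha> (backward_diff (off_value \<alpha>))"
  let ?t = "\<lambda>n \<alpha>. (1 - \<alpha>) ^ n * (working_step ^^ n) (?r \<alpha>) i"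
  let ?b = "\<lambda>n. 1 ^ n * (working_step ^^ n) (advantage_rate 0 limit_incr) i"
  let ?M = "\<lambda>n. (1 - brk Q) ^ n * advantage_bound (i + n)"
  have q: "0 \<le> 1 - brk Q" "1 - brk Q < 1" using normalised slow_pos slow_less_fast arr_pos brk_pos by auto
  have r: "((\<lambda>\<alpha>. ?r \<alpha> j) \<longlongrightarrow> advantage_rate 0 limit_incr j) (at_right 0)" for j
    unfolding advantage_rate_def by (rule tendsto_eq_intros limit_incr refl | simp)+
  have lim: "((\<lambda>\<alpha>. ?t n \<alpha>) \<longlongrightarrow> ?b n) (at_right 0)" for n
    by (intro tendsto_mult tendsto_power tendsto_a working_step_pow_tendsto r)
  have ev: "\<forall>\<^sub>F \<alpha> in at_right 0. \<forall>n. norm (?t n \<alpha>) \<le> ?M n"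
    using optimal_near_0
  proof eventually_elim
    fix \<alpha> assume opt: "discounted_optimum Q f \<alpha>"
    then interpret discounted_optimum Q f \<alpha> .
    show "\<forall>n. norm (?t n \<alpha>) \<le> ?M n"
    proof
      fix n
      have "norm (?t n \<alpha>) = a ^ n * \<bar>(working_step ^^ n) (?r \<alpha>) i\<bar>"
        using a_bounds by (simp add: abs_mult)
      also have "\<dots> \<le> 1 * \<bar>(working_step ^^ n) (?r \<alpha>) i\<bar>"
        using a_bounds by (intro mult_right_mono power_le_one) auto
      also have "\<dots> \<le> ?M n"
        using working_step_pow_bound[OF advantage_series(2)[OF opt] advantage_bound_mono] by simp
      finally show "norm (?t n \<alpha>) \<le> ?M n" .
    qed
  qed
  have sM: "summable ?M"
  proof -
    have "summable (\<lambda>n. (srv Q Fast - srv Q Slow) * ((1 - brk Q) ^ n * increment_bound (i + n)) + srv_cost Q Fast * (1 - brk Q) ^ n)"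
      using q by (intro summable_add summable_mult summable_increment_bound_geometric summable_geometric) auto
    then show ?thesis by (simp add: advantage_bound_def algebra_simps)
  qed
  have "\<forall>\<^sub>F (n, \<alpha>) in sequentially \<times>\<^sub>F at_right 0. norm (?t n \<alpha>) \<le> ?M n"
    unfolding eventually_prod_filter using ev
    by (intro exI[of _ "\<lambda>_. True"] exI[of _ "\<lambda>\<alpha>. \<forall>n. norm (?t n \<alpha>) \<le> ?M n"]) auto
  from tannerys_theorem[OF lim this sM]
  have "((\<lambda>\<alpha>. \<Sum>n. ?t n \<alpha>) \<longlongrightarrow> suminf ?b) (at_right 0)" by simp
  moreover have "\<forall>\<^sub>F \<alpha> in at_right 0. (\<Sum>n. ?t n \<alpha>) = off_value \<alpha> i - on_value \<alpha> i"
    using optimal_near_0 by eventually_elim (rule sums_unique[symmetric, OF advantage_series(1)])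
  ultimately have "((\<lambda>\<alpha>. off_value \<alpha> i - on_value \<alpha> i) \<longlongrightarrow> suminf ?b) (at_right 0)"
    by (rule Lim_transform_eventually)
  then show ?thesis ..
qed

lemma H_inf_On: "((\<lambda>\<alpha>. on_value \<alpha> i - off_value \<alpha> 0) \<longlongrightarrow> H_inf Q (On i)) (at_right 0)"
proof -
  obtain l where "((\<lambda>\<alpha>. off_value \<alpha> i - on_value \<alpha> i) \<longlongrightarrow> l) (at_right 0)"
    using advantage_converges by blast
  from tendsto_diff[OF H_inf_Off[of i] this]
  have "((\<lambda>\<alpha>. on_value \<alpha> i - off_value \<alpha> 0) \<longlongrightarrow> H_inf Q (Off i) - l) (at_right 0)" by simp
  then show ?thesis
    unfolding H_inf_def off_value_def[symmetric] on_value_def[symmetric] by (rule tendsto_Lim_self[OF trivial_limit_at_right_real])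
qed

abbreviation H0 :: "nat \<Rightarrow> real" where "H0 i \<equiv> H_inf Q (Off i)"
abbreviation H1 :: "nat \<Rightarrow> real" where "H1 i \<equiv> H_inf Q (On i)"

lemma H0_0: "H0 0 = 0"
  using tendsto_unique[OF trivial_limit_at_right_real H_inf_Off[of 0]] by simp

lemma optimality_equation_Off: "mean_hcost + H0 i = hcost Q i + off_step H0 i"
proof -
  let ?w = "\<lambda>\<alpha> i. off_value \<alpha> i - off_value \<alpha> 0"
  have "((\<lambda>\<alpha>. hcost Q i + (1 - \<alpha>) * off_step (?w \<alpha>) i - \<alpha> * off_value \<alpha> 0) \<longlongrightarrow>
     hcost Q i + 1 * off_step H0 i - mean_hcost) (at_right 0)"
    unfolding off_step_def by (intro tendsto_intros tendsto_a H_inf_Off discounted_rate_tendsto)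
  moreover have "\<forall>\<^sub>F \<alpha> in at_right 0. hcost Q i + (1 - \<alpha>) * off_step (?w \<alpha>) i - \<alpha> * off_value \<alpha> 0 = ?w \<alpha> i"
    using optimal_near_0
  proof eventually_elim
    fix \<alpha> assume "discounted_optimum Q f \<alpha>"
    then interpret discounted_optimum Q f \<alpha> .
    have eq: "off_step (?w \<alpha>) i = off_step (off_value \<alpha>) i - off_value \<alpha> 0"
      by (simp add: off_step_def algebra_simps)
    have "hcost Q i + a * off_step (?w \<alpha>) i - \<alpha> * off_value \<alpha> 0 =
        hcost Q i + a * off_step (off_value \<alpha>) i - off_value \<alpha> 0"
      unfolding eq by (simp add: algebra_simps)
    also have "\<dots> = ?w \<alpha> i"
      using off_value_fixed[of i] by (simp add: base_slow slow_free)
    finally show "hcost Q i + a * off_step (?w \<alpha>) i - \<alpha> * off_value \<alpha> 0 = ?w \<alpha> i" .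
  qed
  ultimately have "((\<lambda>\<alpha>. ?w \<alpha> i) \<longlongrightarrow> hcost Q i + 1 * off_step H0 i - mean_hcost) (at_right 0)"
    by (rule Lim_transform_eventually)
  from tendsto_unique[OF trivial_limit_at_right_real this H_inf_Off[of i]] show ?thesis by simp
qed

lemma optimality_equation_On: "mean_hcost + H1 i = srv_cost Q (f i) + hcost Q i + on_step (f i) H1 H0 i"
proof -
  let ?w = "\<lambda>\<alpha> i. off_value \<alpha> i - off_value \<alpha> 0" and ?v = "\<lambda>\<alpha> i. on_value \<alpha> i - off_value \<alpha> 0"
  have "((\<lambda>\<alpha>. srv_cost Q (f i) + hcost Q i + (1 - \<alpha>) * on_step (f i) (?v \<alpha>) (?w \<alpha>) i - \<alpha> * off_value \<alpha> 0) \<longlongrightarrow>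
     srv_cost Q (f i) + hcost Q i + 1 * on_step (f i) H1 H0 i - mean_hcost) (at_right 0)"
    unfolding on_step_def by (intro tendsto_intros tendsto_a H_inf_Off H_inf_On discounted_rate_tendsto)
  moreover have "\<forall>\<^sub>F \<alpha> in at_right 0. srv_cost Q (f i) + hcost Q i + (1 - \<alpha>) * on_step (f i) (?v \<alpha>) (?w \<alpha>) i - \<alpha> * off_value \<alpha> 0 = ?v \<alpha> i"
    using optimal_near_0
  proof eventually_elim
    fix \<alpha> assume "discounted_optimum Q f \<alpha>"
    then interpret discounted_optimum Q f \<alpha> .
    have eq: "on_step (f i) (?v \<alpha>) (?w \<alpha>) i = on_step (f i) (on_value \<alpha>) (off_value \<alpha>) i - (lam + brk Q + rates) * off_value \<alpha> 0"
      by (simp add: on_step_def algebra_simps)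
    have one: "lam + brk Q + rates = 1" using normalised by simp
    have "srv_cost Q (f i) + hcost Q i + a * on_step (f i) (?v \<alpha>) (?w \<alpha>) i - \<alpha> * off_value \<alpha> 0 =
        srv_cost Q (f i) + hcost Q i + a * on_step (f i) (on_value \<alpha>) (off_value \<alpha>) i - off_value \<alpha> 0"
      unfolding eq one by (simp add: algebra_simps)
    also have "\<dots> = ?v \<alpha> i"
      using on_value_fixed[of i] by simp
    finally show "srv_cost Q (f i) + hcost Q i + a * on_step (f i) (?v \<alpha>) (?w \<alpha>) i - \<alpha> * off_value \<alpha> 0 = ?v \<alpha> i" .
  qed
  ultimately have "((\<lambda>\<alpha>. ?v \<alpha> i) \<longlongrightarrow> srv_cost Q (f i) + hcost Q i + 1 * on_step (f i) H1 H0 i - mean_hcost) (at_right 0)"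
    by (rule Lim_transform_eventually)
  from tendsto_unique[OF trivial_limit_at_right_real this H_inf_On[of i]] show ?thesis by simp
qed

lemma H_inf_shape:
  shows H1_le_H0: "H1 i \<le> H0 i"
    and H1_Suc: "H1 i \<le> H1 (Suc i)"
    and H0_Suc: "H0 i \<le> H0 (Suc i)"
    and H_diff_Suc: "H0 i - H1 i \<le> H0 (Suc i) - H1 (Suc i)"
proof -
  have *: "\<forall>\<^sub>F \<alpha> in at_right 0. on_value \<alpha> i \<le> off_value \<alpha> i \<and> on_value \<alpha> i \<le> on_value \<alpha> (Suc i) \<and>
     off_value \<alpha> i \<le> off_value \<alpha> (Suc i) \<and> off_value \<alpha> i - on_value \<alpha> i \<le> off_value \<alpha> (Suc i) - on_value \<alpha> (Suc i)"
    using optimal_near_0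
  proof eventually_elim
    fix \<alpha> assume "discounted_optimum Q f \<alpha>"
    then interpret discounted_optimum Q f \<alpha> .
    show "on_value \<alpha> i \<le> off_value \<alpha> i \<and> on_value \<alpha> i \<le> on_value \<alpha> (Suc i) \<and>
     off_value \<alpha> i \<le> off_value \<alpha> (Suc i) \<and> off_value \<alpha> i - on_value \<alpha> i \<le> off_value \<alpha> (Suc i) - on_value \<alpha> (Suc i)"
      using on_le_off[of i] on_incr_nonneg[of "Suc i"] off_incr_nonneg[of "Suc i"] on_incr_le[of "Suc i"]
      by (simp add: backward_diff_def)
  qed
  note nb = trivial_limit_at_right_real
  show "H1 i \<le> H0 i"
    by (rule tendsto_le[OF nb H_inf_Off H_inf_On]) (use * in eventually_elim, simp)
  show "H1 i \<le> H1 (Suc i)"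
    by (rule tendsto_le[OF nb H_inf_On H_inf_On]) (use * in eventually_elim, simp)
  show "H0 i \<le> H0 (Suc i)"
    by (rule tendsto_le[OF nb H_inf_Off H_inf_Off]) (use * in eventually_elim, simp)
  show "H0 i - H1 i \<le> H0 (Suc i) - H1 (Suc i)"
    by (rule tendsto_le[OF nb tendsto_diff[OF H_inf_Off H_inf_On] tendsto_diff[OF H_inf_Off H_inf_On]]) (use * in eventually_elim, simp)
qed

end

section \<open>The delayed repair policy\<close>

context vanishing_discount begin

text \<open>The limit of the discounted advantages: what a working sensor is worth with \<open>i\<close> customers present.\<close>

definition advantage :: "nat \<Rightarrow> real"
  where "advantage i = H0 i - H1 i"

lemma advantage_mono: "mono advantage"
  unfolding advantage_def mono_iff_le_Suc using H_diff_Suc by simp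

lemma advantage_nonneg: "0 \<le> advantage i"
  using H1_le_H0[of i] by (simp add: advantage_def)

lemma H0_nonneg: "0 \<le> H0 i"
  using lift_Suc_mono_le[of H0 0 i] H0_Suc H0_0 by simp

lemma H1_ge: "H1 0 \<le> H1 i"
  using lift_Suc_mono_le[of H1 0 i] H1_Suc by simp

lemma mean_hcost_nonneg: "0 \<le> mean_hcost"
  unfolding mean_hcost_def using stat_dist_nonneg hcost_nonneg summable_mean_hcost
  by (intro suminf_nonneg mult_nonneg_nonneg) auto

lemma optimality_equation_On_rates:
  "mean_hcost + (arr Q + srv_rate Q (f i) i + brk Q) * H1 i =
    srv_cost Q (f i) + hcost Q i + arr Q * H1 (Suc i) + srv_rate Q (f i) i * H1 (i - 1) + brk Q * H0 i"
proof -
  have *: "rates = 1 - arr Q - brk Q" using normalised by simp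
  show ?thesis
    using optimality_equation_On[of i] unfolding on_step_def * by (cases i) (simp_all add: srv_rate_def algebra_simps)
qed

lemma optimality_equation_Off_rates:
  "mean_hcost + (arr Q + srv_rate Q (base Q) i) * H0 i =
    hcost Q i + arr Q * H0 (Suc i) + srv_rate Q (base Q) i * H0 (i - 1)"
  using optimality_equation_Off[of i] unfolding off_step_def by (cases i) (simp_all add: srv_rate_def algebra_simps)

text \<open>In the waiting state with residual delay \<open>t\<close>, the potential is the relative value plus \<open>\<delta> * t\<close> for
the time to be made up, plus the cost of the pending repair, minus its expected yield. The yield is
truncated at \<open>U\<close>, so that the potential is bounded below and the estimates of the M/M/1 queue apply.
The constant \<open>K\<close> makes everything nonnegative. In waiting states the inequality is an
equality; at a repair it holds because truncation only lowers the yield; in active states it reduces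
to \<open>gain\<close>, by which a repair pays for the delay and for the lifetime \<open>1 / brk Q\<close> before it.\<close>

lemma delay_supersolution:
  fixes d :: "nat \<Rightarrow> real" and U \<delta> :: real
  defines "\<psi> \<equiv> \<lambda>i. min (advantage i) U" and "K \<equiv> \<bar>H1 0\<bar> + U"
  assumes base: "base Q = Slow" and U: "0 \<le> U" and d: "\<And>i. 0 \<le> d i" and \<delta>: "0 \<le> \<delta>"
    and gain: "\<And>i. rep_cost Q + \<delta> * (d i + 1 / brk Q) \<le> mm1 \<psi> i (d i)"
  shows "supersolution Q f d (\<lambda>i. srv_cost Q (f i) + hcost Q i + \<delta>) (\<lambda>i. srv_cost Q (base Q) + hcost Q i + \<delta>)
     0 (rep_cost Q) (\<lambda>i. H1 i + K) (\<lambda>i t. H0 i + K + \<delta> * t + rep_cost Q - mm1 \<psi> i t)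
     (\<lambda>i t. \<delta> - (lam * mm1 \<psi> (Suc i) t + mu * mm1 \<psi> (i - 1) t - (lam + mu) * mm1 \<psi> i t)) mean_hcost"
proof unfold_locales
  have \<psi>: "mono \<psi>" "\<And>i. 0 \<le> \<psi> i" "\<And>i. \<psi> i \<le> U"
    using monoD[OF advantage_mono] U advantage_nonneg
    by (auto simp: \<psi>_def mono_def min_def intro: order_trans)
  fix i
  show "0 \<le> d i" by (rule d)
  show "0 \<le> srv_cost Q (f i) + hcost Q i + \<delta>" "0 \<le> srv_cost Q (base Q) + hcost Q i + \<delta>"
    using srv_cost_nonneg hcost_nonneg \<delta> by (auto intro!: add_nonneg_nonneg)
  show "0 \<le> H1 i + K" using H1_ge[of i] U by (simp add: K_def)
  show "rep_cost Q + (H1 i + K) \<le> H0 i + K + \<delta> * 0 + rep_cost Q - mm1 \<psi> i 0"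
    using mm1_0[OF \<psi>, of i] by (simp add: \<psi>_def advantage_def)
  show "(\<lambda>t. H0 i + K + \<delta> * t + rep_cost Q - mm1 \<psi> i t) \<in> borel_measurable borel"
    using mm1_measurable[OF \<psi>, of i] by measurable
  show "srv_cost Q (f i) + hcost Q i + \<delta> + arr Q * (0 + (H1 (Suc i) + K)) + srv_rate Q (f i) i * (0 + (H1 (i - 1) + K))
     + brk Q * (0 + (H0 i + K + \<delta> * d i + rep_cost Q - mm1 \<psi> i (d i)))
     \<le> mean_hcost + (arr Q + srv_rate Q (f i) i + brk Q) * (H1 i + K)"
  proof -
    have "brk Q * (rep_cost Q + \<delta> * (d i + 1 / brk Q)) \<le> brk Q * mm1 \<psi> i (d i)"
      using brk_pos gain by (intro mult_left_mono) auto
    moreover have "brk Q * (rep_cost Q + \<delta> * (d i + 1 / brk Q)) = brk Q * rep_cost Q + brk Q * (\<delta> * d i) + \<delta>"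
      using brk_pos by (simp add: field_simps)
    ultimately show ?thesis
      using optimality_equation_On_rates[of i] by (simp add: algebra_simps)
  qed
  fix t :: real assume t: "0 \<le> t"
  show "0 \<le> H0 i + K + \<delta> * t + rep_cost Q - mm1 \<psi> i t"
    using mm1_le[OF \<psi> t, of i] H0_nonneg[of i] rep_cost_pos mult_nonneg_nonneg[OF \<delta> t] unfolding K_def by linarith
  show "((\<lambda>t. H0 i + K + \<delta> * t + rep_cost Q - mm1 \<psi> i t) has_real_derivative
     \<delta> - (lam * mm1 \<psi> (Suc i) t + mu * mm1 \<psi> (i - 1) t - (lam + mu) * mm1 \<psi> i t)) (at t within {0..})"
    by (rule derivative_eq_intros mm1_deriv[OF \<psi>] refl)+ simp
  show "srv_cost Q (base Q) + hcost Q i + \<delta> + arr Q * (0 + (H0 (Suc i) + K + \<delta> * t + rep_cost Q - mm1 \<psi> (Suc i) t))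
     + srv_rate Q (base Q) i * (0 + (H0 (i - 1) + K + \<delta> * t + rep_cost Q - mm1 \<psi> (i - 1) t))
     \<le> mean_hcost + (arr Q + srv_rate Q (base Q) i) * (H0 i + K + \<delta> * t + rep_cost Q - mm1 \<psi> i t)
        + (\<delta> - (lam * mm1 \<psi> (Suc i) t + mu * mm1 \<psi> (i - 1) t - (lam + mu) * mm1 \<psi> i t))"
    using optimality_equation_Off_rates[of i] slow_free
    by (cases i) (simp_all add: base srv_rate_def algebra_simps)
qed (use rep_cost_pos mean_hcost_nonneg in auto)

text \<open>Up to \<open>k\<close> the truncation has no effect, by monotonicity.\<close>

lemma mean_truncated_advantage:
  assumes "advantage k \<le> U"
  shows "(\<Sum>i\<le>k. stat_dist Q i * advantage i) \<le> (\<Sum>i. stat_dist Q i * min (advantage i) U)"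
    and "(\<Sum>i\<le>k. stat_dist Q i * advantage i) \<le> U"
proof -
  have U: "0 \<le> U" using advantage_nonneg[of k] assms by simp
  have le: "advantage i \<le> advantage k" if "i \<le> k" for i using monoD[OF advantage_mono that] .
  have "(\<Sum>i\<le>k. stat_dist Q i * advantage i) = (\<Sum>i\<le>k. stat_dist Q i * min (advantage i) U)"
    using le assms by (intro sum.cong) (auto simp: min_def intro: order_trans)
  also have "\<dots> \<le> (\<Sum>i. stat_dist Q i * min (advantage i) U)"
    using U advantage_nonneg stat_dist_nonneg
    by (intro sum_le_suminf summable_stat_dist[where K = U]) (auto simp: min_def)
  finally show "(\<Sum>i\<le>k. stat_dist Q i * advantage i) \<le> \<dots>" .
  have "(\<Sum>i\<le>k. stat_dist Q i * advantage i) \<le> (\<Sum>i\<le>k. stat_dist Q i * U)"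
    using le assms stat_dist_nonneg by (intro sum_mono mult_left_mono) (auto intro: order_trans)
  also have "\<dots> \<le> 1 * U"
    unfolding sum_distrib_right[symmetric] using U by (intro mult_right_mono stat_dist_partial_le_1)
  finally show "(\<Sum>i\<le>k. stat_dist Q i * advantage i) \<le> U" by simp
qed

end

lemma (in vacation_queue) blackwell_vanishing_discount:
  assumes "strongly_blackwell_optimal Q f" "base Q = Slow"
  shows "vanishing_discount Q f"
proof unfold_locales
  obtain \<alpha>0 where \<alpha>0: "0 < \<alpha>0"
    and opt: "\<And>\<alpha> s. 0 < \<alpha> \<Longrightarrow> \<alpha> < \<alpha>0 \<Longrightarrow> \<alpha> < 1 \<Longrightarrow> nr_disc_cost Q \<alpha> (stationary f) s = nr_opt Q \<alpha> s"
    using assms(1) unfolding strongly_blackwell_optimal_def by blast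
  have "\<forall>\<^sub>F \<alpha> in at_right 0. \<alpha> \<in> {0<..<min \<alpha>0 1}"
    using \<alpha>0 by (intro eventually_at_right_real) auto
  then show "\<forall>\<^sub>F \<alpha> in at_right 0. discounted_optimum Q f \<alpha>"
    by eventually_elim (unfold_locales, use assms(2) opt in auto)
qed

theorem theorem3p3:
  fixes Q :: queue and f :: "nat \<Rightarrow> speed" and l k :: nat and Ht U T :: real
  assumes "vacation_queue Q"
    and "base Q = Slow"
    and "strongly_blackwell_optimal Q f"
    and "crit_gap Q > 0"
    and "\<forall>i\<ge>l. H_inf Q (Off i) - H_inf Q (On i) \<ge> crit_cost Q"
    and "(\<Sum>i\<le>k. stat_dist Q i * (H_inf Q (Off i) - H_inf Q (On i))) \<ge> crit_cost Q - crit_gap Q / 3"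
    and "\<bar>Ht - H_inf Q (On k)\<bar> \<le> 1"
    and "U = H_inf Q (Off k) - Ht + 1"
    and "T = ln (6 * U * (1 + rho Q powr (- real l / 2)) / crit_gap Q)
             / (sqrt (srv Q (base Q)) - sqrt (arr Q))\<^sup>2"
  shows "avg_cost Q (two_delay_policy f (ennreal T) 0 l) (Active 0)
         \<le> ereal (g_base Q - crit_gap Q / (4 * (T + 1 / brk Q)))"
proof -
  interpret vacation_queue Q by fact
  interpret vanishing_discount Q f using assms(3,2) by (rule blackwell_vanishing_discount)
  define \<Delta> where "\<Delta> = crit_gap Q"
  define \<psi> where "\<psi> = (\<lambda>i. min (advantage i) U)"
  define E where "E = 1 + rho Q powr (- real l / 2)"
  define \<gamma> where "\<gamma> = (sqrt mu - sqrt lam)\<^sup>2"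
  define d where "d i = (if i \<le> l then T else 0)" for i
  define \<delta> where "\<delta> = \<Delta> / (4 * (T + 1 / brk Q))"
  have \<Delta>: "0 < \<Delta>" and crit: "crit_cost Q = rep_cost Q + \<Delta>"
    using assms(4) by (auto simp: \<Delta>_def crit_gap_def)
  have kU: "advantage k \<le> U"
    using assms(7,8) by (auto simp: advantage_def)
  have partial: "rep_cost Q + 2 * \<Delta> / 3 \<le> (\<Sum>i\<le>k. stat_dist Q i * advantage i)"
    using assms(6) crit by (simp add: advantage_def \<Delta>_def[symmetric])
  \<comment> \<open>Two thirds of the gap remain in the truncated stationary mean; the convergence error may use up a sixth.\<close>
  have mean: "rep_cost Q + 2 * \<Delta> / 3 \<le> (\<Sum>i. stat_dist Q i * \<psi> i)" and U: "rep_cost Q + 2 * \<Delta> / 3 \<le> U"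
    using mean_truncated_advantage[OF kU] partial by (auto simp: \<psi>_def)
  have Upos: "0 < U" using U rep_cost_pos \<Delta> by simp
  have \<psi>: "mono \<psi>" "\<And>i. 0 \<le> \<psi> i" "\<And>i. \<psi> i \<le> U"
    using monoD[OF advantage_mono] Upos advantage_nonneg
    by (auto simp: \<psi>_def mono_def min_def intro: order_trans)
  have E: "2 \<le> E"
  proof -
    have "rho Q powr (real l / 2) \<le> 1" "0 < rho Q powr (real l / 2)"
      using rho_bounds by (auto intro!: powr_le1)
    then have "1 \<le> 1 / rho Q powr (real l / 2)" by simp
    also have "\<dots> = rho Q powr (- real l / 2)"
      using powr_minus_divide[of "rho Q" "real l / 2"] by simp
    finally show ?thesis by (simp add: E_def)
  qed
  have \<gamma>: "0 < \<gamma>"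
    using stable by (simp add: \<gamma>_def)
  have T: "T = ln (6 * U * E / \<Delta>) / \<gamma>"
    using assms(9) by (simp add: E_def \<gamma>_def \<Delta>_def)
  \<comment> \<open>This makes the logarithm, and with it the delay, positive.\<close>
  have arg: "1 < 6 * U * E / \<Delta>"
  proof -
    have "\<Delta> < 6 * U * 2" using U rep_cost_pos \<Delta> by simp
    also have "\<dots> \<le> 6 * U * E" using E Upos by (intro mult_left_mono) auto
    finally show ?thesis using \<Delta> by simp
  qed
  have Tpos: "0 < T" unfolding T using arg \<gamma> by simp
  have decay: "exp (- (\<gamma> * T)) = \<Delta> / (6 * U * E)"
  proof -
    have "exp (- (\<gamma> * T)) = inverse (exp (ln (6 * U * E / \<Delta>)))"
      unfolding T using \<gamma> by (simp add: exp_minus)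
    also have "\<dots> = \<Delta> / (6 * U * E)" using arg by simp
    finally show ?thesis .
  qed
  have "2 * U * exp (- (\<gamma> * T)) = \<Delta> / (3 * E)"
    unfolding decay using Upos by simp
  also have "\<dots> \<le> \<Delta> / 6"
    using E \<Delta> by (intro divide_left_mono) auto
  finally have err: "2 * U * exp (- (\<gamma> * T)) \<le> \<Delta> / 6" .
  have cycle: "0 < T + 1 / brk Q"
    using Tpos brk_pos by (intro add_pos_pos) auto
  have cancel: "x / (4 * s) * s = x / 4" if "0 < s" for x s :: real
    using that by simp
  \<comment> \<open>The claimed improvement per cycle is a quarter of the gap.\<close>
  have gap: "\<delta> * (T + 1 / brk Q) = \<Delta> / 4"
    unfolding \<delta>_def by (rule cancel[OF cycle])
  have \<delta>: "0 \<le> \<delta>"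
    using cycle \<Delta> by (simp add: \<delta>_def)
  have gain: "rep_cost Q + \<delta> * (d i + 1 / brk Q) \<le> mm1 \<psi> i (d i)" for i
  proof (cases "i \<le> l")
    case True
    have "rep_cost Q + 2 * \<Delta> / 3 - \<Delta> / 6 \<le> mm1 \<psi> i T"
      using mm1_lower[OF \<psi>, of T i] mean err Tpos by (simp add: \<gamma>_def)
    then show ?thesis using True gap \<Delta> by (simp add: d_def)
  next
    case False
    then have "crit_cost Q \<le> advantage i"
      using assms(5) by (simp add: advantage_def)
    then have "rep_cost Q + 2 * \<Delta> / 3 \<le> \<psi> i"
      using U crit \<Delta> by (simp add: \<psi>_def)
    moreover have "\<delta> * (1 / brk Q) \<le> \<Delta> / 4"
      unfolding gap[symmetric] using \<delta> Tpos by (intro mult_left_mono) auto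
    ultimately show ?thesis using False \<Delta> mm1_0[OF \<psi>, of i] by (simp add: d_def)
  qed
  have "supersolution Q f d (\<lambda>i. srv_cost Q (f i) + hcost Q i + \<delta>) (\<lambda>i. srv_cost Q (base Q) + hcost Q i + \<delta>)
     0 (rep_cost Q) (\<lambda>i. H1 i + (\<bar>H1 0\<bar> + U)) (\<lambda>i t. H0 i + (\<bar>H1 0\<bar> + U) + \<delta> * t + rep_cost Q - mm1 \<psi> i t)
     (\<lambda>i t. \<delta> - (lam * mm1 \<psi> (Suc i) t + mu * mm1 \<psi> (i - 1) t - (lam + mu) * mm1 \<psi> i t)) mean_hcost"
    unfolding \<psi>_def
    by (rule delay_supersolution[OF assms(2)]) (use Upos Tpos \<delta> gain in \<open>auto simp: d_def \<psi>_def\<close>)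
  then have "avg_cost Q (f, \<lambda>i. ennreal (d i)) (Active 0) \<le> ereal (mean_hcost - \<delta>)"
    using \<delta> by (rule avg_cost_supersolution)
  moreover have "two_delay_policy f (ennreal T) 0 l = (f, \<lambda>i. ennreal (d i))"
    by (auto simp: two_delay_policy_def d_def)
  moreover have "g_base Q = mean_hcost"
    using slow_free by (simp add: g_base_def mean_hcost_def assms(2) mult.commute)
  ultimately show ?thesis
    by (simp add: \<delta>_def \<Delta>_def)
qed

end
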